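(* Let $N$ be a non-negative integer and let $\alpha,\beta\in\mathbb{C}$ be such that $-\alpha,-\beta\notin\{1,2,\dots,N,N+2,N+3,\dots\}$ and $-\alpha-\beta\notin\{1,2,\dots,2N+1,2N+3,2N+4,\dots\}$. Then the family of monic Hahn polynomials $h_n^{\alpha,\beta}(x;N)$, $n\ge 0$, is a monic orthogonal polynomial sequence with respect to the $\Delta$-Sobolev inner product $$(f,g)_S=\sum_{x=0}^{N}f(x)g(x)\rho^{\alpha,\beta}(x;N)+\int_{C}(\Delta^{N+1}f(z))(\Delta^{N+1}g(z))\,\omega^{\alpha,\beta}(z;N)\,dz,$$ where $$\rho^{\alpha,\beta}(x;N)=\frac{\Gamma(\beta+N+1-x)\Gamma(\alpha+x+1)}{\Gamma(N+1-x)\Gamma(x+1)},\qquad \omega^{\alpha,\beta}(z;N)=\Gamma(-z)\Gamma(\beta+N+1-z)\Gamma(1+z)\Gamma(\alpha+N+2+z),$$ and $C$ is a complex contour from $-\infty i$ to $\infty i$ which separates the poles of $\Gamma(-z)\Gamma(\beta+N+1-z)$ from the poles of $\Gamma(1+z)\Gamma(\alpha+N+2+z)$. That is, $(h_n^{\alpha,\beta}(\cdot;N),h_m^{\alpha,\beta}(\cdot;N))_S=0$ for $m\neq n$, and it is nonzero for $m=n$. Furthermore, this $\Delta$-Sobolev inner product characterizes the polynomials $h_n^{\alpha,\beta}(x;N)$ for all $n\in\mathbb{N}_0$: for every $n\ge 0$, $h_n^{\alpha,\beta}(x;N)$ is the unique monic polynomial $P$ of degree $n$ such that $(P,x^m)_S=0$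 for all $0\le m<n$.
   Context: $\mathbb{N}_0=\{0,1,2,\dots\}$; $(a)_0=1$, $(a)_n=a(a+1)\cdots(a+n-1)$; $\Delta f(x)=f(x+1)-f(x)$. Monic Hahn polynomials for all degrees $n\ge0$ are defined by $$h_n^{\alpha,\beta}(x;N)=\frac{(\alpha+1)_n}{(\alpha+\beta+n+1)_n}\sum_{k=0}^n\frac{(-n)_k(\alpha+\beta+n+1)_k(-x)_k\,(-N+k)_{n-k}}{(\alpha+1)_k\,k!},$$ where the quotients $(\alpha+1)_n/(\alpha+1)_k$ and $(\alpha+\beta+n+1)_k/(\alpha+\beta+n+1)_n$ are read as $(\alpha+1+k)_{n-k}$ and $1/(\alpha+\beta+n+k+1)_{n-k}$. For $n\ge N+1$ the terms with $k\le N$ vanish, because $(-N+k)_{n-k}=0$. "Inner product" means a symmetric bilinear form on polynomials, not necessarily positive definite.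
   Formalization: If α = −N−1 or β = −N−1, a Gamma factor in the numerator of ρ has a pole at every x = 0,…,N, so ρ is undefined; there the value of Γ at its pole is replaced by its residue (ρ up to the common infinite factor). For all other parameters ρ is as stated. *)

theory Defs
  imports "HOL-Complex_Analysis.Complex_Analysis" "HOL-Computational_Algebra.Polynomial"
begin

(* The quotients (alpha+1)_n / (alpha+1)_k and (alpha+beta+n+1)_k / (alpha+beta+n+1)_n are written
   as pochhammer (alpha+1+k) (n-k) and 1 / pochhammer (alpha+beta+n+k+1) (n-k).  The latter
   denominator can vanish for -alpha-beta = 2N+2, but then only for n >= N+1 and k <= N, where the
   factor (-N+k)_(n-k) is zero as well, so that the term is zero, as it is in HOL. *)
definition hahn_poly :: "nat \<Rightarrow> complex \<Rightarrow> complex \<Rightarrow> nat \<Rightarrow> complex poly" where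
  "hahn_poly N \<alpha> \<beta> n =
    (\<Sum>k\<le>n. smult
       (pochhammer (- of_nat n) k * pochhammer (\<alpha> + 1 + of_nat k) (n - k)
          * pochhammer (- of_nat N + of_nat k) (n - k)
        / (pochhammer (\<alpha> + \<beta> + of_nat n + of_nat k + 1) (n - k) * fact k))
       (pochhammer (- [:0, 1:]) k))"

definition fwd_diff :: "(complex \<Rightarrow> complex) \<Rightarrow> complex \<Rightarrow> complex" where
  "fwd_diff f x = f (x + 1) - f x"

(* For alpha = -N-1 (resp. beta = -N-1), Gamma(alpha+x+1) (resp. Gamma(beta+N+1-x)) has a pole at
   every x = 0,...,N.  The discrete weight is then read up to its common infinite factor, i.e. as
   the leading Laurent coefficient: the pole value of Gamma is replaced by the residue
   (-1)^m / m! at -m.  (HOL itself sets Gamma to 0 at its poles.) *)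
definition Gamma_lead :: "complex \<Rightarrow> complex" where
  "Gamma_lead z = (if z \<in> \<int>\<^sub>\<le>\<^sub>0 then residue Gamma z else Gamma z)"

definition hahn_rho :: "nat \<Rightarrow> complex \<Rightarrow> complex \<Rightarrow> nat \<Rightarrow> complex" where
  "hahn_rho N \<alpha> \<beta> x =
     Gamma_lead (\<beta> + of_nat N + 1 - of_nat x) * Gamma_lead (\<alpha> + of_nat x + 1)
     / (Gamma (of_nat N + 1 - of_nat x) * Gamma (of_nat x + 1))"

definition hahn_omega :: "nat \<Rightarrow> complex \<Rightarrow> complex \<Rightarrow> complex \<Rightarrow> complex" where
  "hahn_omega N \<alpha> \<beta> z =
     Gamma (- z) * Gamma (\<beta> + of_nat N + 1 - z) * Gamma (1 + z) * Gamma (\<alpha> + of_nat N + 2 + z)"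

(* A contour parametrised by the real line, tending to infinity in the directions -i and i. *)
definition imaginary_contour :: "(real \<Rightarrow> complex) \<Rightarrow> bool" where
  "imaginary_contour \<gamma> \<longleftrightarrow>
     (\<forall>a b. \<gamma> piecewise_C1_differentiable_on {a..b}) \<and>
     filterlim \<gamma> at_infinity at_bot \<and> ((\<lambda>t. sgn (\<gamma> t)) \<longlongrightarrow> - \<i>) at_bot \<and>
     filterlim \<gamma> at_infinity at_top \<and> ((\<lambda>t. sgn (\<gamma> t)) \<longlongrightarrow> \<i>) at_top"

(* The points of A lie to the right of the contour and those of B to the left: they can be joined
   off the contour to real points near +infinity, resp. -infinity.  For a simple imaginary_contour
   the complement has just these two components. *)
definition separates :: "(real \<Rightarrow> complex) \<Rightarrow> complex set \<Rightarrow> complex set \<Rightarrow> bool" where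
  "separates \<gamma> A B \<longleftrightarrow>
     (\<forall>a\<in>A. \<forall>\<^sub>F x in at_top. connected_component (- range \<gamma>) a (complex_of_real x)) \<and>
     (\<forall>b\<in>B. \<forall>\<^sub>F x in at_bot. connected_component (- range \<gamma>) b (complex_of_real x))"

definition has_improper_contour_integral ::
    "(complex \<Rightarrow> complex) \<Rightarrow> complex \<Rightarrow> (real \<Rightarrow> complex) \<Rightarrow> bool" where
  "has_improper_contour_integral f I \<gamma> \<longleftrightarrow>
     (\<forall>a b. a \<le> b \<longrightarrow> f contour_integrable_on (subpath a b \<gamma>)) \<and>
     ((\<lambda>(a, b). contour_integral (subpath a b \<gamma>) f) \<longlongrightarrow> I) (at_bot \<times>\<^sub>F at_top)"

definition improper_contour_integral :: "(real \<Rightarrow> complex) \<Rightarrow> (complex \<Rightarrow> complex) \<Rightarrow> complex" where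
  "improper_contour_integral \<gamma> f = (THE I. has_improper_contour_integral f I \<gamma>)"

definition sobolev_integrand ::
    "nat \<Rightarrow> complex \<Rightarrow> complex \<Rightarrow> complex poly \<Rightarrow> complex poly \<Rightarrow> complex \<Rightarrow> complex" where
  "sobolev_integrand N \<alpha> \<beta> f g z =
     (fwd_diff ^^ (N + 1)) (poly f) z * (fwd_diff ^^ (N + 1)) (poly g) z * hahn_omega N \<alpha> \<beta> z"

definition sobolev_form ::
    "nat \<Rightarrow> complex \<Rightarrow> complex \<Rightarrow> (real \<Rightarrow> complex) \<Rightarrow> complex poly \<Rightarrow> complex poly \<Rightarrow> complex" where
  "sobolev_form N \<alpha> \<beta> \<gamma> f g =
     (\<Sum>x = 0..N. poly f (of_nat x) * poly g (of_nat x) * hahn_rho N \<alpha> \<beta> x)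
     + improper_contour_integral \<gamma> (sobolev_integrand N \<alpha> \<beta> f g)"

definition symmetric_bilinear :: "(complex poly \<Rightarrow> complex poly \<Rightarrow> complex) \<Rightarrow> bool" where
  "symmetric_bilinear B \<longleftrightarrow>
     (\<forall>f g. B f g = B g f) \<and>
     (\<forall>f g h. B (f + g) h = B f h + B g h) \<and>
     (\<forall>c f g. B (smult c f) g = c * B f g)"

definition monic_of_degree :: "nat \<Rightarrow> complex poly \<Rightarrow> bool" where
  "monic_of_degree n P \<longleftrightarrow> degree P = n \<and> lead_coeff P = 1"

definition monic_OPS ::
    "(complex poly \<Rightarrow> complex poly \<Rightarrow> complex) \<Rightarrow> (nat \<Rightarrow> complex poly) \<Rightarrow> bool" where
  "monic_OPS B p \<longleftrightarrow>
     (\<forall>n. monic_of_degree n (p n)) \<and>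
     (\<forall>n m. m \<noteq> n \<longrightarrow> B (p n) (p m) = 0) \<and>
     (\<forall>n. B (p n) (p n) \<noteq> 0)"

end

theory Submission
  imports Defs "HOL-Real_Asymp.Real_Asymp"
begin

text \<open>For \<open>n \<le> N\<close> the difference \<open>\<Delta>\<^sup>N\<^sup>+\<^sup>1 h\<^sub>n\<close> vanishes, and for \<open>n > N\<close> the polynomial \<open>h\<^sub>n\<close> vanishes on
  \<open>{0..N}\<close> while \<open>\<Delta>\<^sup>N\<^sup>+\<^sup>1 h\<^sub>n\<close> is a multiple of a continuous Hahn polynomial. So the two terms of the
  form never interact, and both are functionals \<open>L\<close> with a Pearson equation
  \<open>L (q(z + 1) (z + A) (z + B)) = L (q(z) z (z - E))\<close>. Such an equation determines all the
  moments \<open>L ((-z)\<^sub>k (z + A)\<^sub>l)\<close> up to the factor \<open>L 1\<close>; orthogonality is then the vanishing of an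
  \<open>n\<close>-th difference, and the norms follow from a partial fraction expansion.

  For the integral, the Pearson equation says that the contour may be translated by \<open>1\<close>. That
  \<open>L 1 \<noteq> 0\<close> is carried by the recurrences in the parameters to large parameters, where the contour
  may be replaced by the line \<open>Re z = -1/2\<close> and the normalised integrand tends to a positive function.\<close>

section \<open>Functionals with a Pearson equation\<close>

text \<open>One family serves both functionals: \<open>ghahn A B S n\<close> is the monic multiple
  of 3F2(-n, S + n, -x; A, B; 1), with S = A + B + E - 1 tied to the Pearson equation. The sum has A
  = \<alpha> + 1, B = -N, E = \<beta> + N + 1; the integral has A = \<alpha> + N + 2, B = 1 and the
  same E. A difference raises A and B by 1 and S by 2, so N + 1 differences lead from the first set
  to the second. The obstacle is the generality of the contour. It may wander and cross itself, its
  real part may be unbounded, and a pole is only known to be connected, off the contour, to far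
  points of a real ray. Hence tails are controlled in cones, and two contours are compared through
  winding numbers that are computed with logarithms. The mass L 1 of the integral is a case of
  Barnes' first lemma, 2 pi i Gamma(b) Gamma(d + 1) / (b + d) with b = \<alpha> + N + 2 and d =
  \<beta> + N + 1. Only its being nonzero matters here, and this can be read off from a limit of
  large parameters without evaluating the integral.\<close>

definition ghahn :: "complex \<Rightarrow> complex \<Rightarrow> complex \<Rightarrow> nat \<Rightarrow> complex poly" where
  "ghahn A B S n =
    (\<Sum>k\<le>n. smult
       (pochhammer (- of_nat n) k * pochhammer (A + of_nat k) (n - k)
          * pochhammer (B + of_nat k) (n - k)
        / (pochhammer (S + of_nat n + of_nat k) (n - k) * fact k))
       (pochhammer (- [:0, 1:]) k))"

lemma hahn_poly_eq: "hahn_poly N \<alpha> \<beta> n = ghahn (\<alpha> + 1) (- of_nat N) (\<alpha> + \<beta> + 1) n"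
  unfolding hahn_poly_def ghahn_def
  by (intro sum.cong refl arg_cong2[of _ _ _ _ smult] arg_cong2[of _ _ _ _ "(/)"]
        arg_cong2[of _ _ _ _ "(*)"] arg_cong2[of _ _ _ _ pochhammer]) (simp_all add: algebra_simps)

lemma degree_lead_pochhammer_linear:
  fixes a c :: complex
  assumes "c \<noteq> 0"
  shows "degree (pochhammer [:a, c:] k) = k" "lead_coeff (pochhammer [:a, c:] k) = c ^ k"
proof -
  have "degree (pochhammer [:a, c:] k) = k \<and> lead_coeff (pochhammer [:a, c:] k) = c ^ k"
  proof (induction k)
    case (Suc k)
    have e: "[:a, c:] + of_nat k = [:a + of_nat k, c:]" by (simp add: of_nat_poly)
    have nz: "pochhammer [:a, c:] k \<noteq> 0" using Suc assms by auto
    have "degree (pochhammer [:a, c:] (Suc k)) = Suc k"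
      unfolding pochhammer_Suc e using nz assms Suc by (subst degree_mult_eq) auto
    moreover have "lead_coeff (pochhammer [:a, c:] (Suc k)) = c ^ Suc k"
      unfolding pochhammer_Suc e lead_coeff_mult using Suc assms by (metis lead_coeff_pCons(1) lead_coeff_pCons(2) mult.commute one_neq_zero pCons_eq_0_iff power_Suc)
    ultimately show ?case by blast
  qed simp
  then show "degree (pochhammer [:a, c:] k) = k" "lead_coeff (pochhammer [:a, c:] k) = c ^ k"
    by auto
qed

lemma pochhammer_minus_X: "pochhammer (- [:0, 1:]) k = pochhammer [:0, -1 :: complex:] k"
  by simp

lemma pochhammer_minus_of_nat_self: "pochhammer (- of_nat n :: complex) n = (-1) ^ n * fact n"
  by (simp add: pochhammer_same)

text \<open>At k = n all products of length n - k are empty, so the coefficient is (-1)^n, and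
  (-x)_n has leading coefficient (-1)^n. The parameters do not enter, which covers vanishing
  denominators too.\<close>

lemma monic_ghahn: "monic_of_degree n (ghahn A B S n)"
proof -
  define c where "c k = pochhammer (- of_nat n) k * pochhammer (A + of_nat k) (n - k)
          * pochhammer (B + of_nat k) (n - k)
        / (pochhammer (S + of_nat n + of_nat k) (n - k) * fact k)" for k
  have deg: "degree (smult (c k) (pochhammer (- [:0, 1:]) k)) \<le> k" for k
    using degree_lead_pochhammer_linear(1)[of "-1" 0 k]
    by (metis degree_smult_le neg_equal_0_iff_equal one_neq_zero pochhammer_minus_X)
  have split: "ghahn A B S n = (\<Sum>k<n. smult (c k) (pochhammer (- [:0, 1:]) k))
      + smult (c n) (pochhammer (- [:0, 1:]) n)"
    unfolding ghahn_def c_def[symmetric] by (simp only: lessThan_Suc_atMost[symmetric] sum.lessThan_Suc)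
  have cn: "c n = (-1) ^ n"
    by (simp add: c_def pochhammer_minus_of_nat_self)
  have top: "coeff (smult (c n) (pochhammer (- [:0, 1:]) n)) n = 1"
    using degree_lead_pochhammer_linear[of "-1" 0 n]
    by (simp add: cn power_mult_distrib[symmetric])
  have low: "coeff (\<Sum>k<n. smult (c k) (pochhammer (- [:0, 1:]) k)) i = 0" if "i \<ge> n" for i
    unfolding coeff_sum
  proof (intro sum.neutral ballI coeff_eq_0)
    fix k assume "k \<in> {..<n}"
    then have "k < i" using that by simp
    with deg[of k] show "degree (smult (c k) (pochhammer (- [:0, 1:]) k)) < i" by (rule le_less_trans)
  qed
  have "coeff (ghahn A B S n) i = 0" if "i > n" for i
  proof -
    have "coeff (smult (c n) (pochhammer (- [:0, 1:]) n)) i = 0"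
      using that deg[of n] by (intro coeff_eq_0) linarith
    then show ?thesis using low[of i] that by (simp add: split)
  qed
  moreover have 1: "coeff (ghahn A B S n) n = 1"
    using low[of n] top by (simp add: split)
  ultimately have "degree (ghahn A B S n) = n"
    by (intro antisym degree_le le_degree) auto
  then show ?thesis using 1 by (simp add: monic_of_degree_def)
qed

section \<open>Forward differences of the family\<close>

definition poly_diff :: "complex poly \<Rightarrow> complex poly" where
  "poly_diff p = pcompose p [:1, 1:] - p"

lemma poly_poly_diff: "poly (poly_diff p) = fwd_diff (poly p)"
  by (rule ext) (simp add: poly_diff_def fwd_diff_def poly_pcompose add.commute)

lemma poly_poly_diff_funpow: "poly ((poly_diff ^^ k) p) = (fwd_diff ^^ k) (poly p)"
  by (induction k) (simp_all add: poly_poly_diff)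

lemma poly_diff_add: "poly_diff (p + q) = poly_diff p + poly_diff q"
  by (simp add: poly_diff_def pcompose_add)

lemma poly_diff_smult: "poly_diff (smult c p) = smult c (poly_diff p)"
  by (simp add: poly_diff_def pcompose_smult smult_diff_right)

lemma poly_diff_sum: "poly_diff (sum f I) = (\<Sum>i\<in>I. poly_diff (f i))"
  by (simp add: poly_diff_def pcompose_sum sum_subtractf)

lemma poly_diff_funpow_add: "(poly_diff ^^ k) (p + q) = (poly_diff ^^ k) p + (poly_diff ^^ k) q"
  by (induction k) (simp_all add: poly_diff_add)

lemma poly_diff_funpow_smult: "(poly_diff ^^ k) (smult c p) = smult c ((poly_diff ^^ k) p)"
  by (induction k) (simp_all add: poly_diff_smult)

lemma poly_pochhammer: "poly (pochhammer p k) x = pochhammer (poly p x) k"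
  by (induction k) (simp_all add: pochhammer_Suc of_nat_poly)

text \<open>(-x-1)_k and (-x)_k share the factor (-x)_(k-1), and the remaining linear factors differ
  by -k. For differences these polynomials play the role of the powers; at k = 0 the factor 0 makes
  the truncated index harmless.\<close>

lemma poly_diff_pochhammer:
  "poly_diff (pochhammer (- [:0, 1:]) k) = smult (- of_nat k) (pochhammer (- [:0, 1:]) (k - 1))"
proof (cases k)
  case 0 then show ?thesis by (simp add: poly_diff_def pcompose_1)
next
  case (Suc j)
  have "poly (poly_diff (pochhammer (- [:0, 1:]) k)) x
      = poly (smult (- of_nat k) (pochhammer (- [:0, 1:]) (k - 1))) x" for x
  proof -
    have "pochhammer (- 1 - x) (Suc j) = (-1 - x) * pochhammer (-x) j"
      using pochhammer_rec[of "-1-x" j] by simp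
    moreover have "pochhammer (- x) (Suc j) = pochhammer (- x) j * (- x + of_nat j)"
      by (simp add: pochhammer_Suc)
    moreover have "poly (poly_diff (pochhammer (- [:0, 1:]) k)) x
      = pochhammer (- 1 - x) (Suc j) - pochhammer (- x) (Suc j)"
      by (simp add: poly_diff_def poly_pcompose poly_pochhammer Suc)
    moreover have "poly (smult (- of_nat k) (pochhammer (- [:0, 1:]) (k - 1))) x
      = (- 1 - of_nat j) * pochhammer (- x) j"
      by (simp add: poly_pochhammer Suc algebra_simps)
    moreover have "(-1 - x) * P - P * (- x + of_nat j) = (- 1 - of_nat j) * P" for P
      by (simp add: algebra_simps)
    ultimately show ?thesis by simp
  qed
  then show ?thesis by (simp add: poly_eq_poly_eq_iff[symmetric] fun_eq_iff)
qed


lemma smult_sum_right: "smult c (sum f I) = (\<Sum>i\<in>I. smult c (f i))"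
  by (induction I rule: infinite_finite_induct) (simp_all add: smult_add_right)

text \<open>The term with index k + 1 becomes the term with index k: (-n-1)_(k+1) = -(n+1) (-n)_k,
  and S + (n+1) + (k+1) = (S+2) + n + k preserves the shape of the denominator.\<close>

lemma poly_diff_ghahn:
  "poly_diff (ghahn A B S (Suc n)) = smult (of_nat (Suc n)) (ghahn (A + 1) (B + 1) (S + 2) n)"
proof -
  have t: "poly_diff (smult (pochhammer (- of_nat (Suc n)) (Suc k) * pochhammer (A + of_nat (Suc k)) (Suc n - Suc k)
          * pochhammer (B + of_nat (Suc k)) (Suc n - Suc k)
        / (pochhammer (S + of_nat (Suc n) + of_nat (Suc k)) (Suc n - Suc k) * fact (Suc k)))
       (pochhammer (- [:0, 1:]) (Suc k)))
     = smult (of_nat (Suc n)) (smult (pochhammer (- of_nat n) k * pochhammer (A + 1 + of_nat k) (n - k)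
          * pochhammer (B + 1 + of_nat k) (n - k)
        / (pochhammer (S + 2 + of_nat n + of_nat k) (n - k) * fact k))
       (pochhammer (- [:0, 1:]) k))" for k
  proof -
    have p: "pochhammer (- of_nat (Suc n) :: complex) (Suc k) = - of_nat (Suc n) * pochhammer (- of_nat n) k"
      using pochhammer_rec[of "- of_nat (Suc n) :: complex" k] by simp
    have e: "A + of_nat (Suc k) = A + 1 + of_nat k" "B + of_nat (Suc k) = B + 1 + of_nat k"
      "S + of_nat (Suc n) + of_nat (Suc k) = S + 2 + of_nat n + of_nat k" by simp_all
    \<comment> \<open>For d = 0 or f = 0 both sides are 0 by the convention on division, so a
      vanishing denominator does no harm; m stands for k + 1.\<close>
    have c: "- s * P * a * b / (d * (m * f)) * - m = s * (P * a * b / (d * f))"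
      if "m \<noteq> 0" for s P a b d m f :: complex
      using that by (cases "d = 0"; cases "f = 0") (simp_all add: field_simps)
    show ?thesis
      unfolding poly_diff_smult poly_diff_pochhammer p fact_Suc smult_smult of_nat_mult of_nat_fact
        diff_Suc_Suc e diff_Suc_1
      by (subst c) (simp_all only: of_nat_neq_0 not_False_eq_True)
  qed
  show ?thesis
    unfolding ghahn_def poly_diff_sum smult_sum_right
    by (subst sum.atMost_Suc_shift) (simp only: t, simp add: poly_diff_smult poly_diff_def pcompose_1)
qed

text \<open>With k = N + 1 and B = -N the second parameter becomes 1, the value that belongs to the
  integral.\<close>

lemma poly_diff_funpow_ghahn:
  "(poly_diff ^^ k) (ghahn A B S (k + j))
     = smult (fact (k + j) / fact j) (ghahn (A + of_nat k) (B + of_nat k) (S + 2 * of_nat k) j)"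
proof (induction k arbitrary: A B S)
  case (Suc k)
  have e: "A + 1 + of_nat k = A + of_nat (Suc k)" "B + 1 + of_nat k = B + of_nat (Suc k)"
     "S + 2 + 2 * of_nat k = S + 2 * of_nat (Suc k)" by simp_all
  show ?case
    unfolding add_Suc funpow_Suc_right o_apply poly_diff_ghahn poly_diff_funpow_smult Suc e
    by (simp del: of_nat_Suc)
qed simp

text \<open>Pascal's rule: a sum of order n + 1 is one of order n for the differences of f. Both
  evaluations below are inductions on this.\<close>

lemma alternating_binomial_sum_Suc:
  fixes f :: "nat \<Rightarrow> complex"
  shows "(\<Sum>k\<le>Suc n. (-1) ^ k * of_nat (Suc n choose k) * f k)
       = (\<Sum>k\<le>n. (-1) ^ k * of_nat (n choose k) * (f k - f (Suc k)))"
proof -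
  have "(\<Sum>k\<le>n. (-1) ^ k * of_nat (n choose k) * f k) = (\<Sum>k\<le>Suc n. (-1) ^ k * of_nat (n choose k) * f k)"
    by simp
  also have "\<dots> = f 0 + (\<Sum>k\<le>n. (-1) ^ Suc k * of_nat (n choose Suc k) * f (Suc k))"
    by (subst sum.atMost_Suc_shift) simp
  finally have 1: "(\<Sum>k\<le>n. (-1) ^ k * of_nat (n choose k) * f k)
    = f 0 + (\<Sum>k\<le>n. (-1) ^ Suc k * of_nat (n choose Suc k) * f (Suc k))" .
  have "(\<Sum>k\<le>Suc n. (-1) ^ k * of_nat (Suc n choose k) * f k)
      = f 0 + (\<Sum>k\<le>n. (-1) ^ Suc k * of_nat (Suc n choose Suc k) * f (Suc k))"
    by (subst sum.atMost_Suc_shift) simp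
  also have "\<dots> = f 0 + (\<Sum>k\<le>n. (-1) ^ Suc k * of_nat (n choose Suc k) * f (Suc k))
      - (\<Sum>k\<le>n. (-1) ^ k * of_nat (n choose k) * f (Suc k))"
    by (simp add: sum_negf sum.distrib sum_subtractf algebra_simps)
  finally show ?thesis
    unfolding 1[symmetric] by (simp add: sum_subtractf algebra_simps)
qed

lemma degree_poly_diff_less:
  assumes "degree q > 0"
  shows "degree (poly_diff q) < degree q"
proof -
  have d: "degree (pcompose q [:1, 1:]) = degree q" by (simp add: degree_pcompose)
  have "degree (poly_diff q) \<le> degree q"
    unfolding poly_diff_def using d by (intro degree_diff_le) auto
  moreover have "coeff (poly_diff q) (degree q) = 0"
    using lead_coeff_comp[of "[:1, 1::complex:]" q] d by (simp add: poly_diff_def)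
  ultimately show ?thesis
    using assms by (metis le_neq_implies_less leading_coeff_0_iff degree_0)
qed

text \<open>Each use of the recurrence lowers the degree, and a constant has difference zero; so
  more than deg q steps leave nothing.\<close>

lemma alternating_binomial_sum_poly:
  "degree q < n \<Longrightarrow> (\<Sum>k\<le>n. (-1) ^ k * of_nat (n choose k) * poly q (of_nat k :: complex)) = 0"
proof (induction n arbitrary: q)
  case (Suc n)
  have d: "poly q (of_nat k) - poly q (of_nat (Suc k)) = poly (- poly_diff q) (of_nat k)" for k
    by (simp add: poly_diff_def poly_pcompose)
  show ?case
  proof (cases "degree q = 0")
    case True
    then show ?thesis unfolding alternating_binomial_sum_Suc d
      by (auto elim!: degree_eq_zeroE simp: poly_diff_def)
  next
    case False
    then have "degree (- poly_diff q) < n" using degree_poly_diff_less[of q] Suc.prems by simp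
    then show ?thesis unfolding alternating_binomial_sum_Suc d by (rule Suc.IH)
  qed
qed simp

text \<open>Partial fraction expansion of n! / (x (x+1) ... (x+n)). The recurrence produces the same
  sum at x and at x + 1, and the two values combine over the denominator
  \<open>pochhammer x (Suc (Suc n))\<close>.\<close>

lemma alternating_binomial_sum_inverse:
  assumes "\<And>k. k \<le> n \<Longrightarrow> x + of_nat k \<noteq> 0"
  shows "(\<Sum>k\<le>n. (-1) ^ k * of_nat (n choose k) * (1 / (x + of_nat k :: complex)))
       = fact n / pochhammer x (Suc n)"
  using assms
proof (induction n arbitrary: x)
  case (Suc n)
  have e: "1 / (x + of_nat (Suc k)) = 1 / (x + 1 + of_nat k)" for k by (simp add: algebra_simps)
  have 1: "x + 1 + of_nat k \<noteq> 0" if "k \<le> n" for k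
    using Suc.prems[of "Suc k"] that by (simp add: algebra_simps)
  have 2: "x + of_nat k \<noteq> 0" if "k \<le> n" for k
    using Suc.prems[of k] that by simp
  have p1: "pochhammer x (Suc (Suc n)) = x * pochhammer (x + 1) (Suc n)" by (rule pochhammer_rec)
  have p2: "pochhammer x (Suc (Suc n)) = pochhammer x (Suc n) * (x + of_nat (Suc n))"
    by (rule pochhammer_Suc)
  have nz: "pochhammer x (Suc (Suc n)) \<noteq> 0"
    unfolding pochhammer_eq_0_iff using Suc.prems by (auto simp: eq_neg_iff_add_eq_0 less_Suc_eq_le)
  have "fact n / pochhammer x (Suc n) - fact n / pochhammer (x + 1) (Suc n)
      = fact n * (x + of_nat (Suc n)) / pochhammer x (Suc (Suc n)) - fact n * x / pochhammer x (Suc (Suc n))"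
  proof -
    have "fact n / pochhammer x (Suc n) = fact n * (x + of_nat (Suc n)) / pochhammer x (Suc (Suc n))"
      using nz unfolding p2 by simp
    moreover have "fact n / pochhammer (x + 1) (Suc n) = fact n * x / pochhammer x (Suc (Suc n))"
      using nz unfolding p1 by simp
    ultimately show ?thesis by simp
  qed
  also have "\<dots> = fact (Suc n) / pochhammer x (Suc (Suc n))"
    by (simp add: diff_divide_distrib[symmetric] algebra_simps)
  finally show ?case
    unfolding alternating_binomial_sum_Suc right_diff_distrib sum_subtractf e
    by (simp only: Suc.IH[of "x + 1", OF 1] Suc.IH[of x, OF 2])
qed simp


text \<open>For a functional given by a weight w, \<open>pearson\<close> expresses w(z + 1) (z + 1)
  (z + 1 - E) = w(z) (z + A) (z + B) together with invariance of the sum or integral under z -> z +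
  1.\<close>

locale pearson_functional =
  fixes L :: "complex poly \<Rightarrow> complex" and A B E :: complex
  assumes L_add: "L (p + q) = L p + L q"
    and L_smult: "L (smult c p) = c * L p"
    and pearson: "L (pcompose q [:1, 1:] * [:A, 1:] * [:B, 1:]) = L (q * [:0, 1:] * [:- E, 1:])"
begin

abbreviation "S \<equiv> A + B + E - 1"

text \<open>Two bases at once: (-z)_k is the one in which \<open>ghahn\<close> is expanded, (z+A)_l
  supplies the test functions. In this mixed form the moments obey two-term recurrences.\<close>

definition M :: "nat \<Rightarrow> nat \<Rightarrow> complex" where
  "M k l = L (pochhammer (- [:0, 1:]) k * pochhammer [:A, 1:] l)"

lemma L_0: "L 0 = 0"
  using L_smult[of 0 0] by simp

lemma L_diff: "L (p - q) = L p - L q"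
  using L_add[of p "smult (-1) q"] L_smult[of "-1" q] by simp

lemma L_sum: "L (sum f I) = (\<Sum>i\<in>I. L (f i))"
  by (induction I rule: infinite_finite_induct) (simp_all add: L_0 L_add)

text \<open>The Pearson equation for q = (1-z)_k (z+A)_l. On one side z + A extends (z+1+A)_l to
  (z+A)_(l+1), on the other z extends (1-z)_k to -(-z)_(k+1). Splitting z + B as (B+k) - (-z+k) and
  z - E as (z+A+l) - (E+A+l) leaves the moment with both indices raised on each side, where it
  cancels.\<close>

lemma M_shift: "(B + of_nat k) * M k (Suc l) = (E + A + of_nat l) * M (Suc k) l"
proof -
  let ?q = "pochhammer [:1, -1:] k * pochhammer [:A, 1:] l"
  have "pcompose ?q [:1, 1:] * [:A, 1:] * [:B, 1:]
     = smult (B + of_nat k) (pochhammer (- [:0, 1:]) k * pochhammer [:A, 1:] (Suc l))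
       - pochhammer (- [:0, 1:]) (Suc k) * pochhammer [:A, 1:] (Suc l)" (is "?l = ?r")
  proof -
    have "poly ?l x = poly ?r x" for x
      using pochhammer_rec[of "A + x" l] pochhammer_Suc[of "- x" k]
      by (simp add: poly_pcompose poly_pochhammer) (simp add: algebra_simps)
    then show ?thesis by (simp add: poly_eq_poly_eq_iff[symmetric] fun_eq_iff)
  qed
  moreover have "?q * [:0, 1:] * [:- E, 1:]
     = smult (E + A + of_nat l) (pochhammer (- [:0, 1:]) (Suc k) * pochhammer [:A, 1:] l)
       - pochhammer (- [:0, 1:]) (Suc k) * pochhammer [:A, 1:] (Suc l)" (is "?l = ?r")
  proof -
    have "poly ?l x = poly ?r x" for x
      using pochhammer_Suc[of "A + x" l] pochhammer_rec[of "- x" k]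
      by (simp add: poly_pcompose poly_pochhammer) (simp add: algebra_simps)
    then show ?thesis by (simp add: poly_eq_poly_eq_iff[symmetric] fun_eq_iff)
  qed
  ultimately show ?thesis
    using pearson[of ?q] by (simp only: L_diff L_smult M_def[symmetric]) simp
qed

lemma M_Suc_right: "M k (Suc l) = (A + of_nat l + of_nat k) * M k l - M (Suc k) l"
proof -
  have "pochhammer (- [:0, 1:]) k * pochhammer [:A, 1:] (Suc l)
     = smult (A + of_nat l + of_nat k) (pochhammer (- [:0, 1:]) k * pochhammer [:A, 1:] l)
       - pochhammer (- [:0, 1:]) (Suc k) * pochhammer [:A, 1:] l" (is "?l = ?r")
  proof -
    have "poly ?l x = poly ?r x" for x
      using pochhammer_Suc[of "A + x" l] pochhammer_Suc[of "- x" k]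
      by (simp add: poly_pochhammer) (simp add: algebra_simps)
    then show ?thesis by (simp add: poly_eq_poly_eq_iff[symmetric] fun_eq_iff)
  qed
  then show ?thesis by (simp only: M_def L_diff L_smult)
qed

text \<open>\<open>M_shift\<close> and \<open>M_Suc_right\<close> are two linear equations for
  \<open>M (Suc k) l\<close> and \<open>M k (Suc l)\<close> with determinant (B + k) + (E + A + l) =
  S + 1 + k + l. The solutions are stated without dividing by it.\<close>

lemma M_rec_left:
  "(S + 1 + of_nat k + of_nat l) * M (Suc k) l = (A + of_nat l + of_nat k) * (B + of_nat k) * M k l"
  using M_shift[of k l] unfolding M_Suc_right by (simp add: algebra_simps)

lemma M_rec_right:
  "(S + 1 + of_nat k + of_nat l) * M k (Suc l) = (E + A + of_nat l) * (A + of_nat l + of_nat k) * M k l"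
proof -
  have "(S + 1 + of_nat k + of_nat l) * M k (Suc l)
     = (B + of_nat k) * M k (Suc l) + (E + A + of_nat l) * M k (Suc l)" by (simp add: algebra_simps)
  also have "\<dots> = (E + A + of_nat l) * (M (Suc k) l + M k (Suc l))"
    unfolding M_shift by (simp add: algebra_simps)
  also have "M (Suc k) l + M k (Suc l) = (A + of_nat l + of_nat k) * M k l"
    by (simp add: M_Suc_right)
  finally show ?thesis by (simp add: algebra_simps)
qed

lemma M_left:
  assumes "\<And>i. i < k \<Longrightarrow> S + 1 + of_nat i + of_nat l \<noteq> 0"
  shows "pochhammer (S + 1 + of_nat l) k * M k l
     = pochhammer (A + of_nat l) k * pochhammer B k * M 0 l"
  using assms
proof (induction k)
  case (Suc k)
  have "pochhammer (S + 1 + of_nat l) (Suc k) * M (Suc k) l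
     = pochhammer (S + 1 + of_nat l) k * ((S + 1 + of_nat k + of_nat l) * M (Suc k) l)"
    by (simp add: pochhammer_Suc algebra_simps)
  also have "\<dots> = (A + of_nat l + of_nat k) * (B + of_nat k) * (pochhammer (S + 1 + of_nat l) k * M k l)"
    unfolding M_rec_left by (simp add: algebra_simps)
  also have "\<dots> = pochhammer (A + of_nat l) (Suc k) * pochhammer B (Suc k) * M 0 l"
    using Suc by (simp add: pochhammer_Suc)
  finally show ?case .
qed simp

lemma M_right:
  assumes "\<And>i. i < l \<Longrightarrow> S + 1 + of_nat i \<noteq> 0"
  shows "pochhammer (S + 1) l * M 0 l = pochhammer (E + A) l * pochhammer A l * L 1"
  using assms
proof (induction l)
  case (Suc l)
  have "pochhammer (S + 1) (Suc l) * M 0 (Suc l)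
     = pochhammer (S + 1) l * ((S + 1 + of_nat 0 + of_nat l) * M 0 (Suc l))"
    by (simp add: pochhammer_Suc algebra_simps)
  also have "\<dots> = (E + A + of_nat l) * (A + of_nat l) * (pochhammer (S + 1) l * M 0 l)"
    unfolding M_rec_right by (simp add: algebra_simps)
  also have "\<dots> = pochhammer (E + A) (Suc l) * pochhammer A (Suc l) * L 1"
    using Suc by (simp add: pochhammer_Suc)
  finally show ?case .
qed (simp add: M_def)


text \<open>After expanding \<open>ghahn\<close> in (-z)_k and inserting \<open>M_left\<close>, the
  split products in A, B and S complete to length n and leave the sum. The hypotheses on S and A
  make the denominators (S+n)_n, (S+1+l)_k and (A)_l nonzero.\<close>

lemma L_ghahn_times:
  assumes S: "\<And>m. 1 \<le> m \<Longrightarrow> m \<le> 2 * n \<Longrightarrow> S + of_nat m \<noteq> 0"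
    and A: "pochhammer A n \<noteq> 0" and "l \<le> n" "0 < n"
  shows "L (ghahn A B S n * pochhammer [:A, 1:] l)
    = pochhammer A n * pochhammer B n * M 0 l / (pochhammer (S + of_nat n) n * pochhammer A l)
      * (\<Sum>k\<le>n. (-1) ^ k * of_nat (n choose k) *
          (pochhammer (A + of_nat k) l * (pochhammer (S + of_nat n) k / pochhammer (S + 1 + of_nat l) k)))"
proof -
  have A': "pochhammer A k \<noteq> 0" if "k \<le> n" for k
    using A that by (auto simp: pochhammer_eq_0_iff)
  have S1: "pochhammer (S + 1 + of_nat l) k \<noteq> 0" if "k \<le> n" for k
  proof
    assume "pochhammer (S + 1 + of_nat l) k = 0"
    then obtain i where "i < k" "S + 1 + of_nat l = - of_nat i" by (auto simp: pochhammer_eq_0_iff)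
    moreover from this have "S + of_nat (1 + l + i) = 0" by (simp add: algebra_simps)
    ultimately show False using S[of "1 + l + i"] that assms by simp
  qed
  have Sn: "pochhammer (S + of_nat n) n \<noteq> 0"
  proof
    assume "pochhammer (S + of_nat n) n = 0"
    then obtain i where "i < n" "S + of_nat n = - of_nat i" by (auto simp: pochhammer_eq_0_iff)
    moreover from this have "S + of_nat (n + i) = 0" by (simp add: algebra_simps)
    ultimately show False using S[of "n + i"] assms by simp
  qed
  have term_eq: "pochhammer (- of_nat n) k * pochhammer (A + of_nat k) (n - k)
          * pochhammer (B + of_nat k) (n - k)
        / (pochhammer (S + of_nat n + of_nat k) (n - k) * fact k) * M k l
     = pochhammer A n * pochhammer B n * M 0 l / (pochhammer (S + of_nat n) n * pochhammer A l)
       * ((-1) ^ k * of_nat (n choose k) *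
          (pochhammer (A + of_nat k) l * (pochhammer (S + of_nat n) k / pochhammer (S + 1 + of_nat l) k)))"
    if "k \<le> n" for k
  proof -
    have m: "M k l = pochhammer (A + of_nat l) k * pochhammer B k * M 0 l / pochhammer (S + 1 + of_nat l) k"
    proof -
      have "S + 1 + of_nat i + of_nat l \<noteq> 0" if "i < k" for i
        using S[of "1 + i + l"] that \<open>k \<le> n\<close> assms by (simp add: algebra_simps)
      from M_left[OF this] show ?thesis using S1[OF that] by (simp add: field_simps)
    qed
    have c: "pochhammer (- of_nat n) k / fact k = (-1) ^ k * (of_nat (n choose k) :: complex)"
      by (simp add: binomial_gbinomial gbinomial_pochhammer mult.assoc[symmetric] flip: power_mult_distrib)
    have b: "pochhammer B k * pochhammer (B + of_nat k) (n - k) = pochhammer B n"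
      using pochhammer_product[OF that, of B] by simp
    have sn: "pochhammer (S + of_nat n) k * pochhammer (S + of_nat n + of_nat k) (n - k) = pochhammer (S + of_nat n) n"
      using pochhammer_product[OF that, of "S + of_nat n"] by simp
    have a1: "pochhammer A k * pochhammer (A + of_nat k) (n - k) = pochhammer A n"
      using pochhammer_product[OF that, of A] by simp
    have a2: "pochhammer A l * pochhammer (A + of_nat l) k = pochhammer A k * pochhammer (A + of_nat k) l"
      using pochhammer_product[of l "l + k" A] pochhammer_product[of k "l + k" A] by simp
    have nz: "pochhammer (S + of_nat n) k \<noteq> 0" "pochhammer (S + of_nat n + of_nat k) (n - k) \<noteq> 0"
      using sn Sn by auto
    have a: "pochhammer (A + of_nat k) (n - k) * pochhammer (A + of_nat l) k
        = pochhammer A n * pochhammer (A + of_nat k) l / pochhammer A l"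
      using a1 a2 A'[OF that] A'[OF \<open>l \<le> n\<close>] by (simp add: field_simps) (metis mult.assoc mult.commute)
    have s: "1 / pochhammer (S + of_nat n + of_nat k) (n - k) = pochhammer (S + of_nat n) k / pochhammer (S + of_nat n) n"
      using nz Sn sn by (simp add: field_simps)
    have "pochhammer (- of_nat n) k * pochhammer (A + of_nat k) (n - k)
          * pochhammer (B + of_nat k) (n - k)
        / (pochhammer (S + of_nat n + of_nat k) (n - k) * fact k) * M k l
      = (pochhammer (- of_nat n) k / fact k) * (pochhammer (A + of_nat k) (n - k) * pochhammer (A + of_nat l) k)
        * (pochhammer B k * pochhammer (B + of_nat k) (n - k))
        * (1 / pochhammer (S + of_nat n + of_nat k) (n - k)) * M 0 l / pochhammer (S + 1 + of_nat l) k"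
      unfolding m by (simp add: mult_ac)
    also have "\<dots> = pochhammer A n * pochhammer B n * M 0 l / (pochhammer (S + of_nat n) n * pochhammer A l)
       * ((-1) ^ k * of_nat (n choose k) *
          (pochhammer (A + of_nat k) l * (pochhammer (S + of_nat n) k / pochhammer (S + 1 + of_nat l) k)))"
      unfolding a b c s by (simp add: mult_ac)
    finally show ?thesis .
  qed
  have "L (ghahn A B S n * pochhammer [:A, 1:] l)
    = (\<Sum>k\<le>n. pochhammer (- of_nat n) k * pochhammer (A + of_nat k) (n - k)
          * pochhammer (B + of_nat k) (n - k)
        / (pochhammer (S + of_nat n + of_nat k) (n - k) * fact k) * M k l)"
    unfolding ghahn_def sum_distrib_right L_sum mult_smult_left L_smult M_def ..
  also have "\<dots> = (\<Sum>k\<le>n. pochhammer A n * pochhammer B n * M 0 l / (pochhammer (S + of_nat n) n * pochhammer A l)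
       * ((-1) ^ k * of_nat (n choose k) *
          (pochhammer (A + of_nat k) l * (pochhammer (S + of_nat n) k / pochhammer (S + 1 + of_nat l) k))))"
    by (intro sum.cong refl term_eq) simp
  finally show ?thesis by (simp only: sum_distrib_left)
qed

text \<open>(S+n)_k / (S+1+l)_k = (S+1+l+k)_(n-1-l) / (S+1+l)_(n-1-l) is a polynomial in k of degree
  n-1-l. Together with (A+k)_l this makes degree n-1, so the alternating sum of order n
  vanishes.\<close>

lemma L_ghahn_times_less:
  assumes S: "\<And>m. 1 \<le> m \<Longrightarrow> m \<le> 2 * n \<Longrightarrow> S + of_nat m \<noteq> 0"
    and A: "pochhammer A n \<noteq> 0" and "l < n"
  shows "L (ghahn A B S n * pochhammer [:A, 1:] l) = 0"
proof -
  define q where "q = pochhammer [:A, 1:] l * pochhammer [:S + 1 + of_nat l, 1:] (n - 1 - l)"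
  have nz: "pochhammer (S + 1 + of_nat l) (n - 1 - l + k) \<noteq> 0" if "k \<le> n" for k
  proof
    assume "pochhammer (S + 1 + of_nat l) (n - 1 - l + k) = 0"
    then obtain i where "i < n - 1 - l + k" "S + 1 + of_nat l = - of_nat i" by (auto simp: pochhammer_eq_0_iff)
    moreover from this have "S + of_nat (1 + l + i) = 0" by (simp add: algebra_simps)
    moreover from calculation(1) have "1 + l + i \<le> 2 * n" using that \<open>l < n\<close> by linarith
    ultimately show False using S[of "1 + l + i"] by simp
  qed
  have t: "pochhammer (A + of_nat k) l * (pochhammer (S + of_nat n) k / pochhammer (S + 1 + of_nat l) k)
      = poly q (of_nat k) / pochhammer (S + 1 + of_nat l) (n - 1 - l)" if "k \<le> n" for k
  proof -
    have "S + 1 + of_nat l + of_nat (n - 1 - l) = S + of_nat n"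
      using \<open>l < n\<close> by (simp add: of_nat_diff)
    note h = this
    have e1: "pochhammer (S + 1 + of_nat l) (n - 1 - l + k)
       = pochhammer (S + 1 + of_nat l) (n - 1 - l) * pochhammer (S + of_nat n) k"
      using pochhammer_product'[of "S + 1 + of_nat l" "n - 1 - l" k] unfolding h .
    have e2: "pochhammer (S + 1 + of_nat l) (n - 1 - l + k)
       = pochhammer (S + 1 + of_nat l) k * pochhammer (S + 1 + of_nat l + of_nat k) (n - 1 - l)"
      using pochhammer_product'[of "S + 1 + of_nat l" k "n - 1 - l"] by (simp only: add.commute)
    have "pochhammer (S + of_nat n) k / pochhammer (S + 1 + of_nat l) k
       = pochhammer (S + 1 + of_nat l + of_nat k) (n - 1 - l) / pochhammer (S + 1 + of_nat l) (n - 1 - l)"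
    proof -
      have "pochhammer (S + 1 + of_nat l) k \<noteq> 0" "pochhammer (S + 1 + of_nat l) (n - 1 - l) \<noteq> 0"
        using nz[OF that] unfolding e2 using e1 e2 nz[OF that] by (auto simp only: mult_eq_0_iff)
      then show ?thesis
        using e1 e2 by (metis frac_eq_eq mult.commute)
    qed
    then show ?thesis by (simp add: q_def poly_pochhammer)
  qed
  have "degree q < n"
    using \<open>l < n\<close> degree_mult_le[of "pochhammer [:A, 1:] l" "pochhammer [:S + 1 + of_nat l, 1:] (n - 1 - l)"]
      degree_lead_pochhammer_linear(1)[of 1 A l]
      degree_lead_pochhammer_linear(1)[of 1 "S + 1 + of_nat l" "n - 1 - l"]
    unfolding q_def by (simp only: one_neq_zero not_False_eq_True simp_thms)
  then have 0: "(\<Sum>k\<le>n. (-1) ^ k * of_nat (n choose k) * poly q (of_nat k)) = 0"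
    by (rule alternating_binomial_sum_poly)
  have "(\<Sum>k\<le>n. (-1) ^ k * of_nat (n choose k) *
          (pochhammer (A + of_nat k) l * (pochhammer (S + of_nat n) k / pochhammer (S + 1 + of_nat l) k)))
     = (\<Sum>k\<le>n. (-1) ^ k * of_nat (n choose k) * poly q (of_nat k)) / pochhammer (S + 1 + of_nat l) (n - 1 - l)"
    unfolding sum_divide_distrib by (intro sum.cong refl) (use t in simp)
  with 0 show ?thesis
    using L_ghahn_times[of n l, OF S A] \<open>l < n\<close> by simp
qed

text \<open>For l = n the quotient (S+n)_k / (S+1+n)_k equals (S+n) / (S+n+k), no longer a
  polynomial. Dividing (A+k)_n by S+n+k leaves a quotient of degree below n, which sums to zero, and
  a remainder c, whose sum is the partial fraction expansion.\<close>

lemma L_ghahn_times_self: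
  assumes S: "\<And>m. 1 \<le> m \<Longrightarrow> m \<le> 2 * n \<Longrightarrow> S + of_nat m \<noteq> 0"
    and A: "pochhammer A n \<noteq> 0" and B: "pochhammer B n \<noteq> 0"
    and EA: "pochhammer (E + A) n \<noteq> 0" and EB: "pochhammer (E + B) n \<noteq> 0"
    and L1: "L 1 \<noteq> 0"
  shows "L (ghahn A B S n * pochhammer [:A, 1:] n) \<noteq> 0"
proof (cases "n = 0")
  case True
  then show ?thesis using L1 by (simp add: ghahn_def one_pCons)
next
  case False
  define q where "q = pochhammer [:A, 1:] n"
  define c where "c = pochhammer (A - (S + of_nat n)) n"
  define r where "r = synthetic_div q (- (S + of_nat n))"
  have degq: "degree q = n" using degree_lead_pochhammer_linear(1)[of 1 A n] by (simp add: q_def)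
  have pq: "poly q (- (S + of_nat n)) = c" 
    by (simp only: q_def c_def poly_pochhammer poly_pCons poly_0 mult_zero_right add_0_right
        mult_1_right diff_conv_add_uminus)
  have qr: "poly q x = (x + (S + of_nat n)) * poly r x + c" for x
    using arg_cong[OF synthetic_div_correct'[of "- (S + of_nat n)" q], of "\<lambda>p. poly p x"]
    by (simp add: r_def algebra_simps flip: pq)
  have degr: "degree r < n" using degq False by (simp add: r_def degree_synthetic_div)
  have Snk: "S + of_nat n + of_nat k \<noteq> 0" if "k \<le> n" for k
    using S[of "n + k"] that False by (simp add: algebra_simps)
  have t: "pochhammer (A + of_nat k) n * (pochhammer (S + of_nat n) k / pochhammer (S + 1 + of_nat n) k)
      = (S + of_nat n) * poly r (of_nat k) + (S + of_nat n) * c * (1 / (S + of_nat n + of_nat k))"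
    if "k \<le> n" for k
  proof -
    have "pochhammer (S + of_nat n) (Suc k) = (S + of_nat n) * pochhammer (S + 1 + of_nat n) k"
      using pochhammer_rec[of "S + of_nat n" k] by (simp add: algebra_simps)
    moreover have "pochhammer (S + of_nat n) (Suc k) = pochhammer (S + of_nat n) k * (S + of_nat n + of_nat k)"
      by (rule pochhammer_Suc)
    moreover have "pochhammer (S + of_nat n) (Suc k) \<noteq> 0"
    proof
      assume "pochhammer (S + of_nat n) (Suc k) = 0"
      then obtain i where i: "i \<le> k" "S + of_nat n = - of_nat i" by (auto simp: pochhammer_eq_0_iff less_Suc_eq_le)
      then show False using Snk[of i] that by simp
    qed
    ultimately have "pochhammer (S + of_nat n) k / pochhammer (S + 1 + of_nat n) k
       = (S + of_nat n) / (S + of_nat n + of_nat k)"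
      using Snk[OF that] by (auto simp: frac_eq_eq)
    moreover have "pochhammer (A + of_nat k) n = (S + of_nat n + of_nat k) * poly r (of_nat k) + c"
      using qr[of "of_nat k"] by (simp add: q_def poly_pochhammer add_ac)
    moreover have "X \<noteq> 0 \<Longrightarrow> (X * y + z) * (w / X) = w * y + w * z * (1 / X)" for X y z w :: complex
      by (simp add: field_simps)
    ultimately show ?thesis using Snk[OF that] by (simp only:)
  qed
  have "(\<Sum>k\<le>n. (-1) ^ k * of_nat (n choose k) *
          (pochhammer (A + of_nat k) n * (pochhammer (S + of_nat n) k / pochhammer (S + 1 + of_nat n) k)))
     = (\<Sum>k\<le>n. (S + of_nat n) * ((-1) ^ k * of_nat (n choose k) * poly r (of_nat k))
         + (S + of_nat n) * c * ((-1) ^ k * of_nat (n choose k) * (1 / (S + of_nat n + of_nat k))))"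
  proof (intro sum.cong refl)
    fix k assume "k \<in> {..n}"
    then show "(-1) ^ k * of_nat (n choose k) *
          (pochhammer (A + of_nat k) n * (pochhammer (S + of_nat n) k / pochhammer (S + 1 + of_nat n) k))
      = (S + of_nat n) * ((-1) ^ k * of_nat (n choose k) * poly r (of_nat k))
         + (S + of_nat n) * c * ((-1) ^ k * of_nat (n choose k) * (1 / (S + of_nat n + of_nat k)))"
      using t[of k] by (simp add: distrib_left mult_ac)
  qed
  also have "\<dots> = (S + of_nat n) * (\<Sum>k\<le>n. (-1) ^ k * of_nat (n choose k) * poly r (of_nat k))
      + (S + of_nat n) * c * (\<Sum>k\<le>n. (-1) ^ k * of_nat (n choose k) * (1 / (S + of_nat n + of_nat k)))"
    by (simp only: sum.distrib sum_distrib_left)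
  also have "(\<Sum>k\<le>n. (-1) ^ k * of_nat (n choose k) * (1 / (S + of_nat n + of_nat k)))
      = fact n / pochhammer (S + of_nat n) (Suc n)"
    by (rule alternating_binomial_sum_inverse[OF Snk])
  also have "(\<Sum>k\<le>n. (-1) ^ k * of_nat (n choose k) * poly r (of_nat k)) = 0"
    by (rule alternating_binomial_sum_poly[OF degr])
  finally have sum: "(\<Sum>k\<le>n. (-1) ^ k * of_nat (n choose k) *
          (pochhammer (A + of_nat k) n * (pochhammer (S + of_nat n) k / pochhammer (S + 1 + of_nat n) k)))
     = (S + of_nat n) * c * (fact n / pochhammer (S + of_nat n) (Suc n))" by simp
  \<comment> \<open>Since A - S = 1 - E - B, the product c read backwards is (-1)^n (E+B)_n.\<close>
  have c: "c \<noteq> 0"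
  proof -
    have "A - (S + of_nat n) = - (E + B) + 1 - of_nat n" by (simp add: algebra_simps)
    then have "c = pochhammer (- (E + B) + 1 - of_nat n) n" by (simp only: c_def)
    also have "\<dots> = (-1) ^ n * pochhammer (E + B) n"
    proof -
      have "- (E + B) + 1 - of_nat n = - (E + B + of_nat n - 1)" "E + B + of_nat n - 1 - of_nat n + 1 = E + B"
        by simp_all
      then show ?thesis by (simp only: pochhammer_minus)
    qed
    finally show ?thesis using EB by simp
  qed
  have p: "pochhammer (S + of_nat n) (Suc n) \<noteq> 0"
  proof
    assume "pochhammer (S + of_nat n) (Suc n) = 0"
    then obtain i where i: "i \<le> n" "S + of_nat n = - of_nat i" by (auto simp: pochhammer_eq_0_iff less_Suc_eq_le)
    then show False using Snk[of i] by simp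
  qed
  then have p': "pochhammer (S + of_nat n) n \<noteq> 0" by (simp add: pochhammer_Suc)
  have "pochhammer (S + 1) n * M 0 n = pochhammer (E + A) n * pochhammer A n * L 1"
  proof (rule M_right)
    show "S + 1 + of_nat i \<noteq> 0" if "i < n" for i
      using S[of "1 + i"] that by (simp add: algebra_simps)
  qed
  then have "M 0 n \<noteq> 0" using EA A L1 by auto
  have "0 < n" using False by simp
  from \<open>M 0 n \<noteq> 0\<close> have "pochhammer A n * pochhammer B n * M 0 n / (pochhammer (S + of_nat n) n * pochhammer A n)
      * ((S + of_nat n) * c * (fact n / pochhammer (S + of_nat n) (Suc n))) \<noteq> 0"
    using p p' c A B Snk[of 0] by simp
  then show ?thesis
    by (simp only: L_ghahn_times[OF S A le_refl \<open>0 < n\<close>] sum not_False_eq_True)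
qed

lemma L_ghahn_mult_degree_less:
  assumes S: "\<And>m. 1 \<le> m \<Longrightarrow> m \<le> 2 * n \<Longrightarrow> S + of_nat m \<noteq> 0"
    and A: "pochhammer A n \<noteq> 0" and "q = 0 \<or> degree q < n"
  shows "L (ghahn A B S n * q) = 0"
  using assms(3)
\<comment> \<open>The measure puts the zero polynomial below the constants, whose degree is also 0.
  Each step removes the leading term as a multiple of (z+A)_l.\<close>
proof (induction "if q = 0 then 0 else Suc (degree q)" arbitrary: q rule: less_induct)
  case less
  show ?case
  proof (cases "q = 0")
    case False
    define f where "f = smult (lead_coeff q) (pochhammer [:A, 1:] (degree q))"
    have f: "degree f = degree q" "lead_coeff f = lead_coeff q" "f \<noteq> 0"
      using False degree_lead_pochhammer_linear[of 1 A "degree q"] by (auto simp: f_def)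
    have "q - f = 0 \<or> degree (q - f) < degree q"
    proof (cases "degree q = 0")
      case True
      then show ?thesis using f by (metis degree_eq_zeroE lead_coeff_pCons(2) diff_self)
    next
      case nz: False
      have "degree (q - f) \<le> degree q" using f by (intro degree_diff_le) auto
      moreover have "coeff (q - f) (degree q) = 0" using f by simp
      ultimately show ?thesis by (metis leading_coeff_0_iff le_neq_implies_less)
    qed
    then have "L (ghahn A B S n * (q - f)) = 0"
      using less False by (intro less.hyps) auto
    moreover have "L (ghahn A B S n * f) = 0"
      using L_ghahn_times_less[OF S A, of "degree q"] less.prems False by (simp add: f_def L_smult)
    ultimately show ?thesis by (simp add: right_diff_distrib L_diff)
  qed (simp add: L_0)
qed

text \<open>\<open>ghahn\<close> and (z+A)_n are both monic of degree n, so by orthogonality one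
  factor may be replaced by (z+A)_n.\<close>

lemma L_ghahn_norm:
  assumes S: "\<And>m. 1 \<le> m \<Longrightarrow> m \<le> 2 * n \<Longrightarrow> S + of_nat m \<noteq> 0"
    and A: "pochhammer A n \<noteq> 0" and B: "pochhammer B n \<noteq> 0"
    and EA: "pochhammer (E + A) n \<noteq> 0" and EB: "pochhammer (E + B) n \<noteq> 0"
    and L1: "L 1 \<noteq> 0"
  shows "L (ghahn A B S n * ghahn A B S n) \<noteq> 0"
proof -
  define f where "f = pochhammer [:A, 1:] n"
  have f: "degree f = n" "lead_coeff f = 1"
    using degree_lead_pochhammer_linear[of 1 A n] by (simp_all add: f_def)
  have g: "degree (ghahn A B S n) = n" "lead_coeff (ghahn A B S n) = 1"
    using monic_ghahn unfolding monic_of_degree_def by blast+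
  have "degree (ghahn A B S n - f) \<le> n" using f g by (intro degree_diff_le) auto
  moreover have "coeff (ghahn A B S n - f) n = 0" using f g by simp
  ultimately have "ghahn A B S n - f = 0 \<or> degree (ghahn A B S n - f) < n"
    by (metis leading_coeff_0_iff le_neq_implies_less)
  then have "L (ghahn A B S n * (ghahn A B S n - f)) = 0"
    by (intro L_ghahn_mult_degree_less[OF S A])
  moreover have "L (ghahn A B S n * f) \<noteq> 0"
    unfolding f_def by (rule L_ghahn_times_self[OF S A B EA EB L1])
  ultimately show ?thesis by (simp add: right_diff_distrib L_diff)
qed

end

section \<open>Contour integrals between the imaginary infinities\<close>

text \<open>A cone instead of a strip: a direction tending to i allows an unbounded real part, only
  small compared with the imaginary part. Convexity supplies primitives and joining
  segments.\<close>

definition upper_sector :: "real \<Rightarrow> complex set" where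
  "upper_sector M = {z. M < Im z \<and> \<bar>Re z\<bar> < Im z}"

definition lower_sector :: "real \<Rightarrow> complex set" where
  "lower_sector M = {z. M < - Im z \<and> \<bar>Re z\<bar> < - Im z}"

lemma upper_sector_eq: "upper_sector M = {z. M < Im z} \<inter> {z. Re z - Im z < 0} \<inter> {z. - Re z - Im z < 0}"
  by (auto simp: upper_sector_def)

lemma lower_sector_eq: "lower_sector M = uminus ` upper_sector M"
proof -
  have "z \<in> uminus ` upper_sector M" if "z \<in> lower_sector M" for z
    using that by (intro image_eqI[of _ _ "- z"]) (auto simp: lower_sector_def upper_sector_def)
  then show ?thesis by (auto simp: lower_sector_def upper_sector_def)
qed

lemma open_upper_sector: "open (upper_sector M)"
  unfolding upper_sector_eq
  by (intro open_Int open_Collect_less continuous_intros)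

lemma convex_upper_sector: "convex (upper_sector M)"
proof -
  have "convex {z. M < Im z}" by (rule convex_halfspace_Im_gt)
  moreover have "convex {z :: complex. inner (Complex 1 (-1)) z < 0}" by (rule convex_halfspace_lt)
  moreover have "convex {z :: complex. inner (Complex (-1) (-1)) z < 0}" by (rule convex_halfspace_lt)
  ultimately show ?thesis
    unfolding upper_sector_eq by (intro convex_Int) (simp_all add: inner_complex_def)
qed

lemma convex_lower_sector: "convex (lower_sector M)"
  unfolding lower_sector_eq by (intro convex_negations convex_upper_sector)

text \<open>The primitive is normalised to vanish at infinity. Along the imaginary axis its values
  are Cauchy, with tail at most c exp(-y). The horizontal segment from the axis to z has length |Re
  z| < Im z and contributes the term with the factor Im z.\<close>

lemma upper_sector_primitive:
  assumes hol: "F holomorphic_on upper_sector M" and M: "M \<ge> 0"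
    and bound: "\<And>z. z \<in> upper_sector M \<Longrightarrow> norm (F z) \<le> c * exp (- Im z)"
  obtains \<Phi> where "\<And>z. z \<in> upper_sector M \<Longrightarrow> (\<Phi> has_field_derivative F z) (at z)"
    "\<And>z. z \<in> upper_sector M \<Longrightarrow> norm (\<Phi> z) \<le> c * (1 + Im z) * exp (- Im z)"
proof -
  obtain g where g: "\<And>z. z \<in> upper_sector M \<Longrightarrow> (g has_field_derivative F z) (at z)"
    using holomorphic_convex_primitive'[OF convex_upper_sector open_upper_sector hol]
      at_within_open[OF _ open_upper_sector] by (metis (no_types, lifting))
  have "\<i> * of_real (M + 1) \<in> upper_sector M" using M by (simp add: upper_sector_def)
  then have c0: "c \<ge> 0" using bound[of "\<i> * of_real (M + 1)"]
    by (metis exp_gt_zero norm_ge_zero order_trans zero_le_mult_iff not_less)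
  define h where "h y = g (\<i> * of_real y)" for y :: real
  have iy: "\<i> * of_real y \<in> upper_sector M" if "M < y" for y
    using that M by (simp add: upper_sector_def)
  have vert: "norm (h b - h a) \<le> c * exp (- a) - c * exp (- b)" if ab: "M < a" "a \<le> b" for a b
  proof (cases "a = b")
    case False
    have d: "(h has_vector_derivative \<i> * F (\<i> * of_real y)) (at y)" if "M < y" for y
    proof -
      have "((\<lambda>y. \<i> * complex_of_real y) has_vector_derivative \<i> * 1) (at y)"
        by (intro derivative_eq_intros) auto
      from field_vector_diff_chain_at[OF this g[OF iy[OF that]]]
      show ?thesis unfolding h_def by (simp add: o_def)
    qed
    have "norm (h b - h a) \<le> - c * exp (- b) - (- c * exp (- a))"
    proof (rule differentiable_bound_general[where \<phi> = "\<lambda>y. - c * exp (- y)" and f' = "\<lambda>y. \<i> * F (\<i> * of_real y)" and \<phi>' = "\<lambda>y. c * exp (- y)"])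
      show "a < b" using ab False by simp
      show "continuous_on {a..b} h"
        using ab by (intro continuous_at_imp_continuous_on ballI has_vector_derivative_continuous[OF d]) auto
      show "continuous_on {a..b} (\<lambda>y. - c * exp (- y))" by (intro continuous_intros)
      show "((\<lambda>y. - c * exp (- y)) has_vector_derivative c * exp (- y)) (at y)" for y
        by (auto intro!: derivative_eq_intros simp flip: has_real_derivative_iff_has_vector_derivative)
      show "norm (\<i> * F (\<i> * of_real y)) \<le> c * exp (- y)" if "a < y" for y
        using bound[OF iy[of y]] that ab by (simp add: norm_mult)
      show "(h has_vector_derivative \<i> * F (\<i> * of_real y)) (at y)" if "a < y" for y
        using that ab by (intro d) simp
    qed
    then show ?thesis by simp
  qed simp
  have tend0: "((\<lambda>a. c * exp (- a)) \<longlongrightarrow> 0) at_top"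
    by (rule tendsto_mult_right_zero) (rule filterlim_compose[OF exp_at_bot filterlim_uminus_at_bot_at_top])
  have "Cauchy (\<lambda>n. h (real n))"
  proof (rule CauchyI')
    fix e :: real assume "e > 0"
    then have "eventually (\<lambda>a. c * exp (- a) < e) at_top" using tend0 by (auto simp: order_tendsto_iff)
    then obtain a0 where a0: "\<And>a. a \<ge> a0 \<Longrightarrow> c * exp (- a) < e" by (auto simp: eventually_at_top_linorder)
    define n0 where "n0 = nat \<lceil>max a0 (M + 1)\<rceil>"
    have n0: "real n0 \<ge> a0" "real n0 > M" unfolding n0_def by linarith+
    show "\<exists>M. \<forall>m\<ge>M. \<forall>n>m. dist (h (real m)) (h (real n)) < e"
      unfolding dist_norm
    proof (intro exI allI impI)
      fix m n assume "m \<ge> n0" "n > m"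
      then have "norm (h (real n) - h (real m)) \<le> c * exp (- real m) - c * exp (- real n)"
        using n0 by (intro vert) auto
      also have "\<dots> \<le> c * exp (- real m)" using c0 by simp
      also have "\<dots> < e" using n0 \<open>m \<ge> n0\<close> by (intro a0) linarith
      finally show "norm (h (real m) - h (real n)) < e" by (simp add: norm_minus_commute)
    qed
  qed
  then obtain l where l: "(\<lambda>n. h (real n)) \<longlonglongrightarrow> l" by (auto simp: Cauchy_convergent_iff convergent_def)
  have hl: "norm (h y - l) \<le> c * exp (- y)" if "M < y" for y
  proof (rule tendsto_upperbound[where F = sequentially])
    show "(\<lambda>n. norm (h y - h (real n))) \<longlonglongrightarrow> norm (h y - l)" by (intro tendsto_intros l)
    have "norm (h y - h (real n)) \<le> c * exp (- y)" if "n \<ge> nat \<lceil>y\<rceil>" for n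
    proof -
      have "norm (h (real n) - h y) \<le> c * exp (- y) - c * exp (- real n)"
        using \<open>M < y\<close> that by (intro vert) linarith+
      also have "\<dots> \<le> c * exp (- y)" using c0 by simp
      finally show ?thesis by (simp add: norm_minus_commute)
    qed
    then show "\<forall>\<^sub>F n in sequentially. norm (h y - h (real n)) \<le> c * exp (- y)"
      unfolding eventually_sequentially by blast
  qed simp
  show ?thesis
  proof (rule that[of "\<lambda>z. g z - l"])
    fix z assume z: "z \<in> upper_sector M"
    show "((\<lambda>z. g z - l) has_field_derivative F z) (at z)"
      using g[OF z] by (auto intro!: derivative_eq_intros)
    have Mz: "M < Im z" "\<bar>Re z\<bar> < Im z" using z by (auto simp: upper_sector_def)
    let ?H = "upper_sector M \<inter> {w. Im w = Im z}"
    have "norm (g z - g (\<i> * of_real (Im z))) \<le> c * exp (- Im z) * norm (z - \<i> * of_real (Im z))"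
    proof (rule field_differentiable_bound[of ?H])
      have "convex {w. Im w = Im z}"
        using convex_hyperplane[of "\<i>" "Im z"] by (simp add: inner_complex_def)
      then show "convex ?H" by (intro convex_Int convex_upper_sector)
      show "(g has_field_derivative F w) (at w within ?H)" if "w \<in> ?H" for w
        using g that by (intro DERIV_subset[OF g]) auto
      show "norm (F w) \<le> c * exp (- Im z)" if "w \<in> ?H" for w
        using bound[of w] that by auto
    qed (use z iy[OF Mz(1)] in auto)
    also have "z - \<i> * of_real (Im z) = of_real (Re z)" by (simp add: complex_eq_iff)
    also have "c * exp (- Im z) * norm (complex_of_real (Re z)) \<le> c * exp (- Im z) * Im z"
      using Mz c0 by (intro mult_left_mono) auto
    finally have 1: "norm (g z - h (Im z)) \<le> c * exp (- Im z) * Im z" by (simp add: h_def)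
    have "norm (g z - l) \<le> norm (g z - h (Im z)) + norm (h (Im z) - l)"
      using norm_triangle_ineq[of "g z - h (Im z)" "h (Im z) - l"] by simp
    also have "\<dots> \<le> c * exp (- Im z) * Im z + c * exp (- Im z)" by (intro add_mono 1 hl Mz)
    finally show "norm (g z - l) \<le> c * (1 + Im z) * exp (- Im z)" by (simp add: algebra_simps)
  qed
qed

lemma lower_sector_primitive:
  assumes hol: "F holomorphic_on lower_sector M" and M: "M \<ge> 0"
    and bound: "\<And>z. z \<in> lower_sector M \<Longrightarrow> norm (F z) \<le> c * exp (Im z)"
  obtains \<Phi> where "\<And>z. z \<in> lower_sector M \<Longrightarrow> (\<Phi> has_field_derivative F z) (at z)"
    "\<And>z. z \<in> lower_sector M \<Longrightarrow> norm (\<Phi> z) \<le> c * (1 - Im z) * exp (Im z)"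
proof -
  have neg: "- z \<in> lower_sector M \<longleftrightarrow> z \<in> upper_sector M" for z
    by (auto simp: lower_sector_def upper_sector_def)
  obtain \<Phi> where \<Phi>: "\<And>z. z \<in> upper_sector M \<Longrightarrow> (\<Phi> has_field_derivative - F (- z)) (at z)"
    "\<And>z. z \<in> upper_sector M \<Longrightarrow> norm (\<Phi> z) \<le> c * (1 + Im z) * exp (- Im z)"
  proof (rule upper_sector_primitive[of "\<lambda>z. - F (- z)" M c])
    have "(F \<circ> uminus) holomorphic_on upper_sector M"
      by (rule holomorphic_on_compose_gen[OF _ hol]) (auto intro!: holomorphic_intros simp: neg)
    then show "(\<lambda>z. - F (- z)) holomorphic_on upper_sector M"
      by (auto intro!: holomorphic_intros simp: o_def)
    show "norm (- F (- z)) \<le> c * exp (- Im z)" if "z \<in> upper_sector M" for z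
      using bound[of "- z"] that by (simp add: neg)
  qed (use M in auto)
  show ?thesis
  proof (rule that[of "\<lambda>z. \<Phi> (- z)"])
    fix z assume z: "z \<in> lower_sector M"
    then have z': "- z \<in> upper_sector M" using neg[of "- z"] by simp
    have "((\<lambda>z. \<Phi> (- z)) has_field_derivative (- F (- (- z))) * (- 1)) (at z)"
      by (rule DERIV_chain2[of \<Phi> _ uminus, OF \<Phi>(1)[OF z']]) (auto intro!: derivative_eq_intros)
    then show "((\<lambda>z. \<Phi> (- z)) has_field_derivative F z) (at z)" by simp
    show "norm (\<Phi> (- z)) \<le> c * (1 - Im z) * exp (Im z)" using \<Phi>(2)[OF z'] by simp
  qed
qed

section \<open>The two ends of an imaginary contour\<close>

lemma imaginary_contour_top:
  assumes "imaginary_contour \<gamma>"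
  shows "\<forall>\<^sub>F t in at_top. \<gamma> t \<in> upper_sector M"
proof -
  have inf: "filterlim (\<lambda>t. norm (\<gamma> t)) at_top at_top"
    and s: "((\<lambda>t. sgn (\<gamma> t)) \<longlongrightarrow> \<i>) at_top"
    using assms filterlim_at_infinity_imp_norm_at_top by (auto simp: imaginary_contour_def)
  \<comment> \<open>A direction within 1/4 of i has real part below 1/4 in modulus and imaginary
    part above 3/4, hence lies in the cone; a norm of at least 2 M then lifts the point above height
    M.\<close>
  have 1: "\<forall>\<^sub>F t in at_top. dist (sgn (\<gamma> t)) \<i> < 1/4" by (rule tendstoD[OF s]) simp
  have 2: "\<forall>\<^sub>F t in at_top. max (2 * M) 1 \<le> norm (\<gamma> t)" using inf unfolding filterlim_at_top by blast
  show ?thesis using 1 2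
  proof eventually_elim
    case (elim t)
    let ?s = "sgn (\<gamma> t)" and ?n = "norm (\<gamma> t)"
    have n: "?n > 0" "2 * M \<le> ?n" using elim by linarith+
    have e: "\<gamma> t = of_real ?n * ?s" by (cases "\<gamma> t = 0") (simp_all add: sgn_eq)
    have a: "norm (?s - \<i>) < 1/4" using elim(1) by (simp only: dist_norm)
    have "\<bar>Re ?s - 0\<bar> < 1/4" "\<bar>Im ?s - 1\<bar> < 1/4"
      using le_less_trans[OF abs_Re_le_cmod a] le_less_trans[OF abs_Im_le_cmod a]
      by (simp_all only: minus_complex.sel imaginary_unit.sel)
    then have s: "\<bar>Re ?s\<bar> < 1/4" "Im ?s > 3/4" by linarith+
    have "Re (\<gamma> t) = ?n * Re ?s" "Im (\<gamma> t) = ?n * Im ?s" by (subst e, simp)+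
    moreover have "?n * Im ?s > ?n * (3/4)" "?n * \<bar>Re ?s\<bar> < ?n * (1/4)" using n s by (intro mult_strict_left_mono; simp)+
    ultimately show ?case using n by (auto simp: upper_sector_def abs_mult)
  qed
qed

lemma imaginary_contour_reflect:
  assumes "imaginary_contour \<gamma>"
  shows "imaginary_contour (\<lambda>t. - \<gamma> (- t))"
proof -
  have "(\<lambda>t. - \<gamma> (- t)) piecewise_C1_differentiable_on {a..b}" for a b
  proof -
    have "(\<gamma> \<circ> uminus) piecewise_C1_differentiable_on {a..b}"
    proof (rule piecewise_C1_differentiable_compose)
      show "uminus piecewise_C1_differentiable_on {a..b}"
        by (intro C1_differentiable_imp_piecewise C1_differentiable_on_minus) auto
      show "\<gamma> piecewise_C1_differentiable_on uminus ` {a..b}"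
        using assms by (simp add: imaginary_contour_def)
      have "{a..b} \<inter> uminus -` {x} \<subseteq> {- x}" for x by auto
      then show "finite ({a..b} \<inter> uminus -` {x})" for x by (rule finite_subset) simp
    qed
    then show ?thesis using piecewise_C1_differentiable_neg[of "\<gamma> \<circ> uminus"] by (simp add: o_def)
  qed
  moreover have "filterlim (\<lambda>t. - \<gamma> (- t)) at_infinity at_bot" "filterlim (\<lambda>t. - \<gamma> (- t)) at_infinity at_top"
  proof -
    have a: "filterlim (\<lambda>t. \<gamma> (- t)) at_infinity at_bot" "filterlim (\<lambda>t. \<gamma> (- t)) at_infinity at_top"
      using assms filterlim_compose[OF _ filterlim_uminus_at_bot_at_top, of \<gamma>]
        filterlim_compose[OF _ filterlim_uminus_at_top_at_bot, of \<gamma>] by (auto simp: imaginary_contour_def)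
    show "filterlim (\<lambda>t. - \<gamma> (- t)) at_infinity at_bot" "filterlim (\<lambda>t. - \<gamma> (- t)) at_infinity at_top"
      using a by (auto simp: filterlim_at_infinity_conv_norm_at_top)
  qed
  moreover have "((\<lambda>t. sgn (- \<gamma> (- t))) \<longlongrightarrow> - \<i>) at_bot" "((\<lambda>t. sgn (- \<gamma> (- t))) \<longlongrightarrow> \<i>) at_top"
  proof -
    have a: "((\<lambda>t. sgn (\<gamma> (- t))) \<longlongrightarrow> \<i>) at_bot" "((\<lambda>t. sgn (\<gamma> (- t))) \<longlongrightarrow> - \<i>) at_top"
      using assms filterlim_compose[OF _ filterlim_uminus_at_bot_at_top, of "\<lambda>t. sgn (\<gamma> t)"]
        filterlim_compose[OF _ filterlim_uminus_at_top_at_bot, of "\<lambda>t. sgn (\<gamma> t)"] by (auto simp: imaginary_contour_def)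
    show "((\<lambda>t. sgn (- \<gamma> (- t))) \<longlongrightarrow> - \<i>) at_bot" "((\<lambda>t. sgn (- \<gamma> (- t))) \<longlongrightarrow> \<i>) at_top"
      using tendsto_minus[OF a(1)] tendsto_minus[OF a(2)] by (auto simp: sgn_minus)
  qed
  ultimately show ?thesis by (simp add: imaginary_contour_def)
qed

lemma imaginary_contour_bot:
  assumes "imaginary_contour \<gamma>"
  shows "\<forall>\<^sub>F t in at_top. \<gamma> (- t) \<in> lower_sector M"
  using imaginary_contour_top[OF imaginary_contour_reflect[OF assms], of M]
  by eventually_elim (auto simp: lower_sector_def upper_sector_def)


section \<open>Pieces of a contour and their integrals\<close>

lemma valid_path_subpath_contour:
  assumes "imaginary_contour \<gamma>"
  shows "valid_path (subpath a b \<gamma>)"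
proof -
  have "(\<gamma> \<circ> (\<lambda>x. (b - a) * x + a)) piecewise_C1_differentiable_on {0..1}" if "a \<noteq> b"
  proof (rule piecewise_C1_differentiable_compose)
    show "(\<lambda>x. (b - a) * x + a) piecewise_C1_differentiable_on {0..1}"
      by (simp add: C1_differentiable_imp_piecewise)
    have "\<gamma> piecewise_C1_differentiable_on (if a \<le> b then {a..b} else {b..a})"
      using assms by (simp add: imaginary_contour_def)
    then show "\<gamma> piecewise_C1_differentiable_on (\<lambda>x. (b - a) * x + a) ` {0..1}"
      by (simp add: image_affinity_atLeastAtMost split: if_split_asm)
    have "{0..1} \<inter> (\<lambda>x. (b - a) * x + a) -` {x} \<subseteq> {(x - a) / (b - a)}" for x
      using that by (auto simp: field_simps)
    then show "finite ({0..1} \<inter> (\<lambda>x. (b - a) * x + a) -` {x})" for x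
      by (rule finite_subset) simp
  qed
  then show ?thesis
    by (cases "a = b") (auto simp: valid_path_def subpath_def o_def
        intro: C1_differentiable_imp_piecewise C1_differentiable_on_const)
qed

lemma contour_integral_subpath_split:
  assumes \<gamma>: "imaginary_contour \<gamma>" and F: "F contour_integrable_on subpath a c \<gamma>"
    and "a \<le> b" "b \<le> c"
  shows "contour_integral (subpath a c \<gamma>) F
       = contour_integral (subpath a b \<gamma>) F + contour_integral (subpath b c \<gamma>) F"
proof (cases "a = c")
  case True
  then show ?thesis using assms by simp
next
  case False
  \<comment> \<open>The parameter in [0,1] at which \<open>subpath a c \<gamma>\<close> passes the
    point \<open>\<gamma> b\<close>.\<close>
  define u where "u = (b - a) / (c - a)"
  have u: "u \<in> {0..1}" and ub: "(c - a) * u = b - a" using assms False by (auto simp: u_def field_simps)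
  have "subpath 0 u (subpath a c \<gamma>) = subpath a b \<gamma>"
    by (rule ext) (simp add: subpath_def ub[symmetric] algebra_simps)
  moreover have "subpath u 1 (subpath a c \<gamma>) = subpath b c \<gamma>"
  proof
    fix x
    have "(c - a) * ((1 - u) * x + u) + a = (c - b) * x + b"
    proof -
      have "(c - a) * ((1 - u) * x + u) + a = (c - a) * x - ((c - a) * u) * x + (c - a) * u + a"
        by (simp add: algebra_simps)
      then show ?thesis unfolding ub by (simp add: algebra_simps)
    qed
    then show "subpath u 1 (subpath a c \<gamma>) x = subpath b c \<gamma> x" by (simp add: subpath_def)
  qed
  ultimately show ?thesis
    using contour_integral_subpath_combine[OF F valid_path_subpath_contour[OF \<gamma>], of 0 u 1] u
    by simp
qed

lemma path_image_subpath_contour: "path_image (subpath a b \<gamma>) \<subseteq> range \<gamma>"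
  by (auto simp: path_image_subpath_gen)

lemma contour_integrable_subpath_contour:
  assumes "imaginary_contour \<gamma>" "open S" "F holomorphic_on S" "range \<gamma> \<subseteq> S"
  shows "F contour_integrable_on subpath a b \<gamma>"
  using assms path_image_subpath_contour[of a b \<gamma>]
  by (intro contour_integrable_holomorphic_simple[OF assms(3,2)] valid_path_subpath_contour) auto

text \<open>The range is not compact, but the contour leaves every ball at both ends, so near a
  given point only a compact arc counts.\<close>

lemma closed_range_contour:
  assumes \<gamma>: "imaginary_contour \<gamma>"
  shows "closed (range \<gamma>)"
proof -
  have cont: "continuous_on {a..b} \<gamma>" for a b
    using \<gamma> by (auto simp: imaginary_contour_def piecewise_C1_differentiable_on_def)
  have "open (- range \<gamma>)"
    unfolding open_contains_ball
  proof
    fix z assume z: "z \<in> - range \<gamma>"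
    have "\<forall>\<^sub>F t in at_top. norm z + 1 \<le> norm (\<gamma> t)" "\<forall>\<^sub>F t in at_bot. norm z + 1 \<le> norm (\<gamma> t)"
      using \<gamma> by (auto simp: imaginary_contour_def filterlim_at_infinity_conv_norm_at_top filterlim_at_top)
    then obtain a b where ab: "\<And>t. t \<ge> b \<Longrightarrow> norm z + 1 \<le> norm (\<gamma> t)" "\<And>t. t \<le> a \<Longrightarrow> norm z + 1 \<le> norm (\<gamma> t)"
      by (auto simp: eventually_at_top_linorder eventually_at_bot_linorder)
    have "closed (\<gamma> ` {a..b})" by (intro compact_imp_closed compact_continuous_image cont) auto
    then have "open (- \<gamma> ` {a..b})" by auto
    moreover have "z \<in> - \<gamma> ` {a..b}" using z by auto
    ultimately obtain e where e: "e > 0" "ball z e \<subseteq> - \<gamma> ` {a..b}" unfolding open_contains_ball by blast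
    have "ball z (min e 1) \<subseteq> - range \<gamma>"
    proof
      fix w assume w: "w \<in> ball z (min e 1)"
      have "w \<noteq> \<gamma> t" for t
      proof (cases "t \<in> {a..b}")
        case True
        then show ?thesis using w e by auto
      next
        case False
        then have "norm z + 1 \<le> norm (\<gamma> t)" using ab[of t] by fastforce
        moreover have "norm w < norm z + 1"
          using w norm_triangle_ineq2[of w z] by (simp add: dist_norm norm_minus_commute)
        ultimately show ?thesis by auto
      qed
      then show "w \<in> - range \<gamma>" by auto
    qed
    then show "\<exists>e>0. ball z e \<subseteq> - range \<gamma>" using e by (intro exI[of _ "min e 1"]) auto
  qed
  then show ?thesis by (simp add: closed_def)
qed

text \<open>\<open>\<sigma> = 1\<close> means the right-hand side of the contour, \<open>\<sigma> = -1\<close> the left-hand side.\<close>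

definition right_of :: "(real \<Rightarrow> complex) \<Rightarrow> real \<Rightarrow> complex \<Rightarrow> bool" where
  "right_of \<gamma> \<sigma> p \<longleftrightarrow>
     (\<forall>\<^sub>F x in at_top. connected_component (- range \<gamma>) p (complex_of_real (\<sigma> * x)))"

lemma separates_right_of:
  assumes "separates \<gamma> A B"
  shows "p \<in> A \<Longrightarrow> right_of \<gamma> 1 p" "p \<in> B \<Longrightarrow> right_of \<gamma> (- 1) p"
  using assms by (auto simp: separates_def right_of_def at_bot_mirror eventually_filtermap)

text \<open>The integral of the logarithmic derivative minus the difference of a logarithm cut along
  the ray on which \<open>p\<close> lies is continuous in \<open>p\<close>, takes values in a discrete set, and vanishes
  far out on the ray.\<close>

lemma contour_integral_inverse_right_of:
  assumes \<gamma>: "imaginary_contour \<gamma>" and \<sigma>: "\<sigma> \<in> {1, -1}" and p: "right_of \<gamma> \<sigma> p"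
  shows "\<forall>\<^sub>F T in at_top. contour_integral (subpath (- T) T \<gamma>) (\<lambda>w. 1 / (w - p))
     = Ln (of_real \<sigma> * (p - \<gamma> T)) - Ln (of_real \<sigma> * (p - \<gamma> (- T)))"
proof -
  obtain X where X: "\<And>x. x \<ge> X \<Longrightarrow> connected_component (- range \<gamma>) p (complex_of_real (\<sigma> * x))"
    using p by (auto simp: right_of_def eventually_at_top_linorder)
  have "path_component (- range \<gamma>) p (of_real (\<sigma> * X))"
    using X[of X] open_path_connected_component[of "- range \<gamma>" p] closed_range_contour[OF \<gamma>]
    by (simp add: open_Compl)
  then obtain K0 where K0: "path K0" "path_image K0 \<subseteq> - range \<gamma>" "pathstart K0 = p"
      "pathfinish K0 = of_real (\<sigma> * X)"
    by (auto simp: path_component_def)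
  \<comment> \<open>The connected set along which p is moved: a path off the contour to the real
    ray, then the ray itself.\<close>
  define K where "K = path_image K0 \<union> (\<lambda>x. complex_of_real (\<sigma> * x)) ` {X..}"
  have conK: "connected K"
    unfolding K_def
  proof (rule connected_Un)
    show "connected ((\<lambda>x. complex_of_real (\<sigma> * x)) ` {X..})"
      by (intro connected_continuous_image continuous_intros convex_connected convex_real_interval)
    show "path_image K0 \<inter> (\<lambda>x. complex_of_real (\<sigma> * x)) ` {X..} \<noteq> {}"
      using pathfinish_in_path_image[of K0] K0 by auto
  qed (use K0 in auto)
  have KC: "K \<inter> range \<gamma> = {}"
  proof -
    have "complex_of_real (\<sigma> * x) \<in> - range \<gamma>" if "x \<ge> X" for x
      using connected_component_in[OF X[OF that]] by blast
    then have "(\<lambda>x. complex_of_real (\<sigma> * x)) ` {X..} \<subseteq> - range \<gamma>"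
      by (intro image_subsetI) (simp only: atLeast_iff)
    with K0(2) have "K \<subseteq> - range \<gamma>" unfolding K_def by (rule Un_least)
    then show ?thesis by (simp only: disjoint_eq_subset_Compl)
  qed
  have pK: "p \<in> K" using K0 pathstart_in_path_image[of K0] by (auto simp: K_def)
  obtain B where B: "\<And>z. z \<in> path_image K0 \<Longrightarrow> norm z \<le> B"
    using compact_imp_bounded[OF compact_path_image[OF K0(1)]] by (auto simp: bounded_iff)
  have ImK: "\<bar>Im z\<bar> \<le> max B 0" if "z \<in> K" for z
    using that B[of z] abs_Im_le_cmod[of z] by (auto simp: K_def)
  have "\<forall>\<^sub>F T in at_top. \<gamma> T \<in> upper_sector (max B 0) \<and> \<gamma> (- T) \<in> lower_sector (max B 0) \<and> T > 0"
    using imaginary_contour_top[OF \<gamma>] imaginary_contour_bot[OF \<gamma>] eventually_gt_at_top by (intro eventually_conj)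
  then show ?thesis
  proof eventually_elim
    case (elim T)
    define g where "g = subpath (- T) T \<gamma>"
    have g: "valid_path g" "path g" "pathstart g = \<gamma> (- T)" "pathfinish g = \<gamma> T"
      using valid_path_subpath_contour[OF \<gamma>] valid_path_imp_path by (auto simp: g_def)
    have gK: "z \<notin> path_image g" if "z \<in> K" for z
      using KC path_image_subpath_contour that unfolding g_def by blast
    define n where "n z = winding_number g z
       - (Ln (of_real \<sigma> * (z - \<gamma> T)) - Ln (of_real \<sigma> * (z - \<gamma> (- T)))) / (2 * pi * \<i>)" for z
    have s2: "complex_of_real \<sigma> \<noteq> 0" using \<sigma> by auto
    \<comment> \<open>T was chosen so that the ends of the arc lie above and below all of K; hence
      the arguments of the logarithms stay off the cut while z runs through K.\<close>
    have nonreal: "of_real \<sigma> * (z - \<gamma> T) \<notin> \<real>\<^sub>\<le>\<^sub>0" "of_real \<sigma> * (z - \<gamma> (- T)) \<notin> \<real>\<^sub>\<le>\<^sub>0"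
      if "z \<in> K" for z
      using ImK[OF that] elim \<sigma> by (auto simp: upper_sector_def lower_sector_def complex_nonpos_Reals_iff)
    have nz: "of_real \<sigma> * (z - \<gamma> T) \<noteq> 0" "of_real \<sigma> * (z - \<gamma> (- T)) \<noteq> 0" if "z \<in> K" for z
      using nonreal[OF that] by auto
    have "continuous_on K n"
      unfolding n_def
      by (intro continuous_intros continuous_at_imp_continuous_on ballI continuous_at_winding_number)
         (use nonreal gK g in auto)
    moreover have int: "n z \<in> \<int>" if "z \<in> K" for z
    proof -
      \<comment> \<open>Both terms of \<open>n z\<close> are logarithms of (\<gamma> T - z) /
        (\<gamma> (-T) - z) divided by 2 pi i, so they differ by an integer.\<close>
      have 1: "\<gamma> T - z = exp (2 * pi * \<i> * winding_number g z) * (\<gamma> (- T) - z)"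
        using winding_number_exp_2pi[OF g(2) gK[OF that]] by (simp add: g)
      have "exp (2 * pi * \<i> * n z) = exp (2 * pi * \<i> * winding_number g z)
         * exp (Ln (of_real \<sigma> * (z - \<gamma> (- T)))) / exp (Ln (of_real \<sigma> * (z - \<gamma> T)))"
        unfolding exp_add[symmetric] exp_diff[symmetric]
        by (rule arg_cong[of _ _ exp]) (simp add: n_def field_simps)
      also have "\<dots> = exp (2 * pi * \<i> * winding_number g z) * (z - \<gamma> (- T)) / (z - \<gamma> T)"
        using nz[OF that] s2 by (simp add: exp_Ln)
      also have "\<dots> = exp (2 * pi * \<i> * winding_number g z) * (\<gamma> (- T) - z) / (\<gamma> T - z)"
        by (metis minus_diff_eq minus_divide_divide mult_minus_right)
      also have "\<dots> = 1" using 1 nz[OF that] s2 by auto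
      finally show ?thesis by (simp add: exp_eq_1 complex_is_Int_iff)
    qed
    ultimately have "n constant_on K"
    proof (intro continuous_discrete_range_constant[OF conK])
      fix x assume "x \<in> K"
      have "1 \<le> norm (n y - n x)" if "y \<in> K" "n y \<noteq> n x" for y
      proof -
        have "n y - n x \<in> \<int>" using int that \<open>x \<in> K\<close> by (intro Ints_diff)
        then obtain k where k: "n y - n x = of_int k" by (auto elim: Ints_cases)
        with that have "k \<noteq> 0" by auto
        then show ?thesis unfolding k norm_of_int by linarith
      qed
      then show "\<exists>e>0. \<forall>y. y \<in> K \<and> n y \<noteq> n x \<longrightarrow> e \<le> norm (n y - n x)"
        by (intro exI[of _ 1]) auto
    qed
    obtain R where R: "\<And>z. z \<in> path_image g \<Longrightarrow> norm z \<le> R"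
      using compact_imp_bounded[OF compact_path_image[OF g(2)]] by (auto simp: bounded_iff)
    \<comment> \<open>A point of the ray beyond the whole arc. There \<sigma> (x - w) has positive
      real part for all w on the arc, so the logarithm is a primitive along it and n
      vanishes.\<close>
    define x where "x = complex_of_real (\<sigma> * max X (R + 1))"
    have xK: "x \<in> K" by (auto simp: x_def K_def)
    have "((\<lambda>w. 1 / (w - x)) has_contour_integral
       (Ln (of_real \<sigma> * (x - pathfinish g)) - Ln (of_real \<sigma> * (x - pathstart g)))) g"
    proof (rule contour_integral_primitive)
      fix w assume w: "w \<in> path_image g"
      have "\<bar>Re w\<bar> \<le> R" using R[OF w] abs_Re_le_cmod[of w] by linarith
      then have "Re (of_real \<sigma> * (x - w)) > 0" using \<sigma> by (auto simp: x_def)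
      then have "of_real \<sigma> * (x - w) \<notin> \<real>\<^sub>\<le>\<^sub>0" "of_real \<sigma> * (x - w) \<noteq> 0"
        by (auto simp: complex_nonpos_Reals_iff)
      then show "((\<lambda>w. Ln (of_real \<sigma> * (x - w))) has_field_derivative 1 / (w - x)) (at w within path_image g)"
        by (auto intro!: derivative_eq_intros simp: divide_simps)
    qed (use g in auto)
    then have "n x = 0"
      using winding_number_valid_path[OF g(1) gK[OF xK]] g by (simp add: n_def contour_integral_unique)
    with \<open>n constant_on K\<close> xK pK have "n p = 0" by (auto simp: constant_on_def)
    then show ?case
      using winding_number_valid_path[OF g(1) gK[OF pK]] g by (simp add: n_def g_def)
  qed
qed


lemma contour_integral_subpath_primitive:
  assumes "imaginary_contour \<gamma>" and "\<And>z. z \<in> S \<Longrightarrow> (\<Phi> has_field_derivative F z) (at z)"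
    and "a \<le> b" "\<And>t. a \<le> t \<Longrightarrow> t \<le> b \<Longrightarrow> \<gamma> t \<in> S"
  shows "contour_integral (subpath a b \<gamma>) F = \<Phi> (\<gamma> b) - \<Phi> (\<gamma> a)"
proof -
  have "(F has_contour_integral (\<Phi> (pathfinish (subpath a b \<gamma>)) - \<Phi> (pathstart (subpath a b \<gamma>)))) (subpath a b \<gamma>)"
  proof (rule contour_integral_primitive)
    show "(\<Phi> has_field_derivative F z) (at z within S)" if "z \<in> S" for z
      using assms(2)[OF that] by (rule has_field_derivative_at_within)
    show "path_image (subpath a b \<gamma>) \<subseteq> S"
      using assms(3,4) by (auto simp: path_image_subpath)
  qed (use valid_path_subpath_contour assms in auto)
  then show ?thesis by (simp add: contour_integral_unique)
qed

text \<open>The integral up to a cutoff, corrected by the primitives at the two ends, does not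
  depend on the cutoff. If the primitives vanish at infinity, this regularised value is the improper
  integral; for 1 / (w - p) they are logarithms, and the value still makes sense.\<close>

lemma contour_integral_subpath_extend:
  assumes \<gamma>: "imaginary_contour \<gamma>" and F: "\<And>a b. F contour_integrable_on subpath a b \<gamma>"
    and U: "\<And>z. z \<in> U \<Longrightarrow> (\<Phi> has_field_derivative F z) (at z)" "\<And>t. t \<ge> T \<Longrightarrow> \<gamma> t \<in> U"
    and V: "\<And>z. z \<in> V \<Longrightarrow> (\<Psi> has_field_derivative F z) (at z)" "\<And>t. t \<ge> T \<Longrightarrow> \<gamma> (- t) \<in> V"
    and "T \<ge> 0" "T \<le> b" "a \<le> - T"
  shows "contour_integral (subpath a b \<gamma>) F - \<Phi> (\<gamma> b) + \<Psi> (\<gamma> a)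
       = contour_integral (subpath (- T) T \<gamma>) F - \<Phi> (\<gamma> T) + \<Psi> (\<gamma> (- T))"
proof -
  have "contour_integral (subpath T b \<gamma>) F = \<Phi> (\<gamma> b) - \<Phi> (\<gamma> T)"
    using assms by (intro contour_integral_subpath_primitive[OF \<gamma> U(1)]) auto
  moreover have "contour_integral (subpath a (- T) \<gamma>) F = \<Psi> (\<gamma> (- T)) - \<Psi> (\<gamma> a)"
  proof (rule contour_integral_subpath_primitive[OF \<gamma> V(1)])
    show "\<gamma> t \<in> V" if "t \<le> - T" for t using V(2)[of "- t"] that by simp
  qed (use assms in auto)
  moreover have "contour_integral (subpath a b \<gamma>) F = contour_integral (subpath a (- T) \<gamma>) F
      + (contour_integral (subpath (- T) T \<gamma>) F + contour_integral (subpath T b \<gamma>) F)"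
    using assms contour_integral_subpath_split[OF \<gamma> F, of a "- T" b]
      contour_integral_subpath_split[OF \<gamma> F, of "- T" T b] by simp
  ultimately show ?thesis by simp
qed

lemma has_improper_contour_integral_sectors:
  assumes \<gamma>: "imaginary_contour \<gamma>" and F: "\<And>a b. F contour_integrable_on subpath a b \<gamma>"
    and U: "\<And>z. z \<in> upper_sector M \<Longrightarrow> (\<Phi> has_field_derivative F z) (at z)"
      "\<And>z. z \<in> upper_sector M \<Longrightarrow> norm (\<Phi> z) \<le> c * (1 + Im z) * exp (- Im z)"
      "\<And>t. t \<ge> T \<Longrightarrow> \<gamma> t \<in> upper_sector M"
    and V: "\<And>z. z \<in> lower_sector M \<Longrightarrow> (\<Psi> has_field_derivative F z) (at z)"
      "\<And>z. z \<in> lower_sector M \<Longrightarrow> norm (\<Psi> z) \<le> c * (1 - Im z) * exp (Im z)"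
      "\<And>t. t \<ge> T \<Longrightarrow> \<gamma> (- t) \<in> lower_sector M"
    and T: "T \<ge> 0"
  shows "has_improper_contour_integral F
     (contour_integral (subpath (- T) T \<gamma>) F - \<Phi> (\<gamma> T) + \<Psi> (\<gamma> (- T))) \<gamma>"
proof -
  define I where "I = contour_integral (subpath (- T) T \<gamma>) F - \<Phi> (\<gamma> T) + \<Psi> (\<gamma> (- T))"
  have dec: "((\<lambda>y :: real. c * (1 + y) * exp (- y)) \<longlongrightarrow> 0) at_top" by real_asymp
  have top: "filterlim (\<lambda>t. Im (\<gamma> t)) at_top at_top"
    unfolding filterlim_at_top
  proof
    fix Z show "\<forall>\<^sub>F t in at_top. Z \<le> Im (\<gamma> t)"
      using imaginary_contour_top[OF \<gamma>, of Z] by eventually_elim (auto simp: upper_sector_def)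
  qed
  have top': "filterlim (\<lambda>t. - Im (\<gamma> (- t))) at_top at_top"
    unfolding filterlim_at_top
  proof
    fix Z show "\<forall>\<^sub>F t in at_top. Z \<le> - Im (\<gamma> (- t))"
      using imaginary_contour_bot[OF \<gamma>, of Z] by eventually_elim (auto simp: lower_sector_def)
  qed
  have \<Phi>: "((\<lambda>t. \<Phi> (\<gamma> t)) \<longlongrightarrow> 0) at_top"
  proof (rule Lim_null_comparison)
    show "\<forall>\<^sub>F t in at_top. norm (\<Phi> (\<gamma> t)) \<le> c * (1 + Im (\<gamma> t)) * exp (- Im (\<gamma> t))"
      using U by (intro eventually_at_top_linorderI[of T]) auto
    show "((\<lambda>t. c * (1 + Im (\<gamma> t)) * exp (- Im (\<gamma> t))) \<longlongrightarrow> 0) at_top"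
      by (rule filterlim_compose[OF dec top])
  qed
  have \<Psi>: "((\<lambda>t. \<Psi> (\<gamma> (- t))) \<longlongrightarrow> 0) at_top"
  proof (rule Lim_null_comparison)
    show "\<forall>\<^sub>F t in at_top. norm (\<Psi> (\<gamma> (- t))) \<le> c * (1 + - Im (\<gamma> (- t))) * exp (- (- Im (\<gamma> (- t))))"
      using V by (intro eventually_at_top_linorderI[of T]) auto
    show "((\<lambda>t. c * (1 + - Im (\<gamma> (- t))) * exp (- (- Im (\<gamma> (- t))))) \<longlongrightarrow> 0) at_top"
      by (rule filterlim_compose[OF dec top'])
  qed
  then have \<Psi>': "((\<lambda>t. \<Psi> (\<gamma> t)) \<longlongrightarrow> 0) at_bot"
    by (simp add: at_bot_mirror filterlim_filtermap)
  have ev: "\<forall>\<^sub>F (a, b) in at_bot \<times>\<^sub>F at_top.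
      contour_integral (subpath a b \<gamma>) F = I + \<Phi> (\<gamma> b) - \<Psi> (\<gamma> a)"
    unfolding eventually_prod_filter
  proof (intro exI conjI allI impI)
    show "eventually (\<lambda>a. a \<le> - T) at_bot" by (rule eventually_le_at_bot)
    show "eventually (\<lambda>b. b \<ge> T) at_top" by (rule eventually_ge_at_top)
    show "case (a, b) of (a, b) \<Rightarrow> contour_integral (subpath a b \<gamma>) F = I + \<Phi> (\<gamma> b) - \<Psi> (\<gamma> a)"
      if "a \<le> - T" "T \<le> b" for a b
      using contour_integral_subpath_extend[OF \<gamma> F U(1,3) V(1,3) T that(2,1)]
      by (simp add: I_def algebra_simps)
  qed
  have "((\<lambda>(a, b). I + \<Phi> (\<gamma> b) - \<Psi> (\<gamma> a)) \<longlongrightarrow> I + 0 - 0) (at_bot \<times>\<^sub>F at_top)"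
    unfolding case_prod_unfold
    by (intro tendsto_intros filterlim_compose[OF \<Phi> filterlim_snd] filterlim_compose[OF \<Psi>' filterlim_fst])
  then have "((\<lambda>(a, b). contour_integral (subpath a b \<gamma>) F) \<longlongrightarrow> I) (at_bot \<times>\<^sub>F at_top)"
    by (simp only: add_0_right diff_zero)
       (erule Lim_transform_eventually, use ev in \<open>auto elim!: eventually_mono simp: case_prod_unfold\<close>)
  then show ?thesis
    using F by (simp add: has_improper_contour_integral_def I_def)
qed

text \<open>The segments lie in convex sets with primitives, so the closed path measures the
  difference of two regularised integrals. It serves both for the integrand, with decaying
  primitives, and for 1 / (w - p), with logarithms.\<close>

lemma contour_integral_closed_up:
  assumes \<gamma>: "imaginary_contour \<gamma>1" "imaginary_contour \<gamma>2"
    and F: "F contour_integrable_on subpath (- T) T \<gamma>1" "F contour_integrable_on subpath (- T) T \<gamma>2"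
    and U: "\<And>z. z \<in> U \<Longrightarrow> (\<Phi> has_field_derivative F z) (at z)" "convex U" "\<gamma>1 T \<in> U" "\<gamma>2 T \<in> U"
    and V: "\<And>z. z \<in> V \<Longrightarrow> (\<Psi> has_field_derivative F z) (at z)" "convex V" "\<gamma>1 (- T) \<in> V" "\<gamma>2 (- T) \<in> V"
  shows "contour_integral (subpath (- T) T \<gamma>1 +++ linepath (\<gamma>1 T) (\<gamma>2 T)
      +++ reversepath (subpath (- T) T \<gamma>2) +++ linepath (\<gamma>2 (- T)) (\<gamma>1 (- T))) F
    = (contour_integral (subpath (- T) T \<gamma>1) F - \<Phi> (\<gamma>1 T) + \<Psi> (\<gamma>1 (- T)))
     - (contour_integral (subpath (- T) T \<gamma>2) F - \<Phi> (\<gamma>2 T) + \<Psi> (\<gamma>2 (- T)))"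
proof -
  have 1: "(F has_contour_integral (\<Phi> (pathfinish (linepath (\<gamma>1 T) (\<gamma>2 T))) - \<Phi> (pathstart (linepath (\<gamma>1 T) (\<gamma>2 T)))))
     (linepath (\<gamma>1 T) (\<gamma>2 T))"
    using U by (intro contour_integral_primitive[of U]) (auto intro: has_field_derivative_at_within dest: closed_segment_subset)
  have 2: "(F has_contour_integral (\<Psi> (pathfinish (linepath (\<gamma>2 (- T)) (\<gamma>1 (- T)))) - \<Psi> (pathstart (linepath (\<gamma>2 (- T)) (\<gamma>1 (- T))))))
     (linepath (\<gamma>2 (- T)) (\<gamma>1 (- T)))"
    using V by (intro contour_integral_primitive[of V]) (auto intro: has_field_derivative_at_within dest: closed_segment_subset)
  note v = valid_path_subpath_contour[OF \<gamma>(1)] valid_path_subpath_contour[OF \<gamma>(2)]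
  have i: "F contour_integrable_on linepath (\<gamma>1 T) (\<gamma>2 T)" "F contour_integrable_on linepath (\<gamma>2 (- T)) (\<gamma>1 (- T))"
    "F contour_integrable_on reversepath (subpath (- T) T \<gamma>2)"
    using 1 2 F v by (auto intro: has_contour_integral_integrable contour_integrable_reversepath)
  show ?thesis
    using i F v 1 2 by (simp add: contour_integrable_joinI valid_path_join contour_integral_unique
        contour_integral_reversepath)
qed


lemma right_of_notin_range: "right_of \<gamma> \<sigma> p \<Longrightarrow> p \<notin> range \<gamma>"
proof -
  assume "right_of \<gamma> \<sigma> p"
  then obtain x where "connected_component (- range \<gamma>) p (complex_of_real (\<sigma> * x))"
    unfolding right_of_def by (blast dest: eventually_happens'[OF trivial_limit_at_top_linorder])
  then show ?thesis using connected_component_in by blast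
qed

lemma has_field_derivative_Ln_sector:
  assumes "\<bar>Im p\<bar> \<le> M" "\<sigma> \<in> {1, -1}" "w \<in> upper_sector M \<union> lower_sector M"
  shows "((\<lambda>w. Ln (of_real \<sigma> * (p - w))) has_field_derivative 1 / (w - p)) (at w)"
proof -
  have "Im (of_real \<sigma> * (p - w)) \<noteq> 0"
    using assms by (auto simp: upper_sector_def lower_sector_def)
  then have "of_real \<sigma> * (p - w) \<notin> \<real>\<^sub>\<le>\<^sub>0" "of_real \<sigma> * (p - w) \<noteq> 0"
    by (auto simp: complex_nonpos_Reals_iff)
  then show ?thesis
    by (auto intro!: derivative_eq_intros simp: divide_simps)
qed

text \<open>\<open>contour_integral_inverse_right_of\<close> gives this for all large cutoffs;
  independence of the cutoff brings it back to T.\<close>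

lemma contour_integral_inverse_right_of_eq_0:
  assumes \<gamma>: "imaginary_contour \<gamma>" and \<sigma>: "\<sigma> \<in> {1, -1}" and p: "right_of \<gamma> \<sigma> p" "\<bar>Im p\<bar> \<le> M"
    and T: "\<And>t. t \<ge> T \<Longrightarrow> \<gamma> t \<in> upper_sector M" "\<And>t. t \<ge> T \<Longrightarrow> \<gamma> (- t) \<in> lower_sector M" "T \<ge> 0"
  shows "contour_integral (subpath (- T) T \<gamma>) (\<lambda>w. 1 / (w - p))
     - Ln (of_real \<sigma> * (p - \<gamma> T)) + Ln (of_real \<sigma> * (p - \<gamma> (- T))) = 0"
proof -
  have "\<forall>\<^sub>F t in at_top. t \<ge> T \<and> contour_integral (subpath (- t) t \<gamma>) (\<lambda>w. 1 / (w - p))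
     = Ln (of_real \<sigma> * (p - \<gamma> t)) - Ln (of_real \<sigma> * (p - \<gamma> (- t)))"
    by (intro eventually_conj contour_integral_inverse_right_of \<gamma> \<sigma> p eventually_ge_at_top)
  then obtain t where t: "t \<ge> T" "contour_integral (subpath (- t) t \<gamma>) (\<lambda>w. 1 / (w - p))
     = Ln (of_real \<sigma> * (p - \<gamma> t)) - Ln (of_real \<sigma> * (p - \<gamma> (- t)))"
    by (blast dest: eventually_happens'[OF trivial_limit_at_top_linorder])
  have "(\<lambda>w. 1 / (w - p)) contour_integrable_on subpath a b \<gamma>" for a b
    using right_of_notin_range[OF p(1)] path_image_subpath_contour[of a b \<gamma>]
    by (intro contour_integrable_inversediff valid_path_subpath_contour \<gamma>) auto
  from contour_integral_subpath_extend[OF \<gamma> this has_field_derivative_Ln_sector[OF p(2) \<sigma>] _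
      has_field_derivative_Ln_sector[OF p(2) \<sigma>], of "upper_sector M" T "lower_sector M" t "- t"]
  show ?thesis using T t by auto
qed

text \<open>Both contours are joined by segments in the two sectors. The resulting closed path has winding
  number zero about every singularity, because the two contours pass it on the same side.\<close>

lemma improper_contour_integral_eq:
  assumes \<gamma>: "imaginary_contour \<gamma>1" "imaginary_contour \<gamma>2"
    and P: "closed P" "\<And>p. p \<in> P \<Longrightarrow> \<bar>Im p\<bar> \<le> M"
    and F: "F holomorphic_on - P" and M: "M \<ge> 0"
    and bound: "\<And>z. z \<in> upper_sector M \<union> lower_sector M \<Longrightarrow> norm (F z) \<le> c * exp (- \<bar>Im z\<bar>)"
    and sep: "\<And>p. p \<in> P \<Longrightarrow> \<exists>\<sigma>\<in>{1, -1}. right_of \<gamma>1 \<sigma> p \<and> right_of \<gamma>2 \<sigma> p"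
  shows "\<exists>I. has_improper_contour_integral F I \<gamma>1 \<and> has_improper_contour_integral F I \<gamma>2"
proof -
  have secP: "upper_sector M \<subseteq> - P" "lower_sector M \<subseteq> - P"
    using P(2) by (fastforce simp: upper_sector_def lower_sector_def)+
  obtain \<Phi> where \<Phi>: "\<And>z. z \<in> upper_sector M \<Longrightarrow> (\<Phi> has_field_derivative F z) (at z)"
    "\<And>z. z \<in> upper_sector M \<Longrightarrow> norm (\<Phi> z) \<le> c * (1 + Im z) * exp (- Im z)"
  proof (rule upper_sector_primitive[of F M c])
    show "norm (F z) \<le> c * exp (- Im z)" if "z \<in> upper_sector M" for z
      using bound[of z] that M by (auto simp: upper_sector_def)
  qed (use secP F M in \<open>auto intro: holomorphic_on_subset\<close>)
  obtain \<Psi> where \<Psi>: "\<And>z. z \<in> lower_sector M \<Longrightarrow> (\<Psi> has_field_derivative F z) (at z)"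
    "\<And>z. z \<in> lower_sector M \<Longrightarrow> norm (\<Psi> z) \<le> c * (1 - Im z) * exp (Im z)"
  proof (rule lower_sector_primitive[of F M c])
    show "norm (F z) \<le> c * exp (Im z)" if "z \<in> lower_sector M" for z
      using bound[of z] that M by (auto simp: lower_sector_def)
  qed (use secP F M in \<open>auto intro: holomorphic_on_subset\<close>)
  have "\<forall>\<^sub>F t in at_top. \<gamma>1 t \<in> upper_sector M \<and> \<gamma>2 t \<in> upper_sector M
      \<and> \<gamma>1 (- t) \<in> lower_sector M \<and> \<gamma>2 (- t) \<in> lower_sector M"
    by (intro eventually_conj imaginary_contour_top imaginary_contour_bot \<gamma>)
  then obtain T0 where T0: "\<And>t. t \<ge> T0 \<Longrightarrow> \<gamma>1 t \<in> upper_sector M \<and> \<gamma>2 t \<in> upper_sector M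
      \<and> \<gamma>1 (- t) \<in> lower_sector M \<and> \<gamma>2 (- t) \<in> lower_sector M"
    by (auto simp: eventually_at_top_linorder)
  define T where "T = max T0 0"
  have T: "\<gamma>1 t \<in> upper_sector M" "\<gamma>2 t \<in> upper_sector M"
    "\<gamma>1 (- t) \<in> lower_sector M" "\<gamma>2 (- t) \<in> lower_sector M" if "t \<ge> T" for t
    using T0[of t] that by (auto simp: T_def)
  have T': "T \<ge> 0" by (simp add: T_def)
  have range: "range \<gamma>1 \<subseteq> - P" "range \<gamma>2 \<subseteq> - P"
    using sep right_of_notin_range by blast+
  have oP: "open (- P)" using P(1) by (simp add: open_Compl)
  have int: "F contour_integrable_on subpath a b \<gamma>1" "F contour_integrable_on subpath a b \<gamma>2" for a b
    using contour_integrable_subpath_contour \<gamma> oP F range by blast+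
  define g where "g = subpath (- T) T \<gamma>1 +++ linepath (\<gamma>1 T) (\<gamma>2 T)
      +++ reversepath (subpath (- T) T \<gamma>2) +++ linepath (\<gamma>2 (- T)) (\<gamma>1 (- T))"
  have "closed_segment (\<gamma>1 T) (\<gamma>2 T) \<subseteq> upper_sector M"
    "closed_segment (\<gamma>2 (- T)) (\<gamma>1 (- T)) \<subseteq> lower_sector M"
    using T[of T] by (intro closed_segment_subset convex_upper_sector convex_lower_sector; simp)+
  note seg = subset_trans[OF this(1) secP(1)] subset_trans[OF this(2) secP(2)]
  have pg: "path_image g \<subseteq> - P"
    unfolding g_def
    by (intro subset_path_image_join)
       (simp_all only: path_image_reversepath path_image_linepath seg
         subset_trans[OF path_image_subpath_contour range(1)] subset_trans[OF path_image_subpath_contour range(2)])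
  have vg: "valid_path g" "pathfinish g = pathstart g"
    using valid_path_subpath_contour \<gamma> by (auto simp: g_def intro!: valid_path_join)
  have "(F has_contour_integral 0) g"
  proof (rule Cauchy_theorem_global[OF oP F vg pg])
    fix p assume "p \<notin> - P"
    then have p: "p \<in> P" by simp
    then obtain \<sigma> where \<sigma>: "\<sigma> \<in> {1, -1}" "right_of \<gamma>1 \<sigma> p" "right_of \<gamma>2 \<sigma> p" using sep by blast
    have i: "(\<lambda>w. 1 / (w - p)) contour_integrable_on subpath a b \<gamma>1"
       "(\<lambda>w. 1 / (w - p)) contour_integrable_on subpath a b \<gamma>2" for a b
      using right_of_notin_range[OF \<sigma>(2)] right_of_notin_range[OF \<sigma>(3)] path_image_subpath_contour[of a b]
      by (intro contour_integrable_inversediff valid_path_subpath_contour \<gamma>; blast)+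
    note Ln = has_field_derivative_Ln_sector[OF P(2)[OF p] \<sigma>(1)]
    \<comment> \<open>Each 0 is the regularised integral of 1 / (w - p) along one contour. Both use
      the same logarithm because \<sigma> is common to the two contours.\<close>
    have "contour_integral g (\<lambda>w. 1 / (w - p)) = 0 - 0"
      unfolding g_def
      by (subst contour_integral_closed_up[OF \<gamma> i Ln convex_upper_sector _ _ Ln convex_lower_sector])
         (use T in \<open>auto simp: contour_integral_inverse_right_of_eq_0[OF \<gamma>(1) \<sigma>(1,2) P(2)[OF p] _ _ T']
            contour_integral_inverse_right_of_eq_0[OF \<gamma>(2) \<sigma>(1,3) P(2)[OF p] _ _ T']\<close>)
    then show "winding_number g p = 0"
      using winding_number_valid_path[OF vg(1), of p] pg p by auto
  qed
  then have "contour_integral g F = 0" by (rule contour_integral_unique)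
  then have "contour_integral (subpath (- T) T \<gamma>1) F - \<Phi> (\<gamma>1 T) + \<Psi> (\<gamma>1 (- T))
     = contour_integral (subpath (- T) T \<gamma>2) F - \<Phi> (\<gamma>2 T) + \<Psi> (\<gamma>2 (- T))"
    unfolding g_def
    using contour_integral_closed_up[where U = "upper_sector M" and V = "lower_sector M",
        OF \<gamma> int \<Phi>(1) convex_upper_sector _ _ \<Psi>(1) convex_lower_sector, of T] T[of T]
    by simp
  then show ?thesis
    using has_improper_contour_integral_sectors[OF \<gamma>(1) int(1) \<Phi> T(1) \<Psi> T(3) T']
      has_improper_contour_integral_sectors[OF \<gamma>(2) int(2) \<Phi> T(2) \<Psi> T(4) T'] by auto
qed

section \<open>Decay of the weight\<close>

text \<open>|z + k| \<ge> Re z + k for every k, so the approximants in Euler's limit formula satisfy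
  the inequality already.\<close>

lemma norm_Gamma_complex_le:
  assumes "Re z > 0"
  shows "norm (Gamma z) \<le> Gamma (Re z)"
proof (rule LIMSEQ_le)
  show "(\<lambda>n. norm (Gamma_series z n)) \<longlonglongrightarrow> norm (Gamma z)"
    by (intro tendsto_norm Gamma_series_LIMSEQ)
  show "Gamma_series (Re z) \<longlonglongrightarrow> Gamma (Re z)" by (rule Gamma_series_LIMSEQ)
  show "\<exists>N. \<forall>n\<ge>N. norm (Gamma_series z n) \<le> Gamma_series (Re z) n"
  proof (intro exI allI impI)
    fix n :: nat
    have poch: "pochhammer (Re z) k \<le> norm (pochhammer z k) \<and> pochhammer (Re z) k > 0" for k
    proof (induction k)
      case (Suc k)
      have "Re z + real k \<le> norm (z + of_nat k)" using complex_Re_le_cmod[of "z + of_nat k"] by simp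
      then have "pochhammer (Re z) k * (Re z + real k) \<le> norm (pochhammer z k) * norm (z + of_nat k)"
        using Suc assms by (intro mult_mono) auto
      then show ?case using Suc assms by (simp add: pochhammer_Suc norm_mult)
    qed simp
    have "norm (Gamma_series z n) = fact n * exp (Re z * ln (real n)) / norm (pochhammer z (n + 1))"
      by (simp add: Gamma_series_def norm_divide norm_mult)
    also have "\<dots> \<le> fact n * exp (Re z * ln (real n)) / pochhammer (Re z) (n + 1)"
      using poch[of "n + 1"] by (intro divide_left_mono mult_pos_pos) auto
    finally show "norm (Gamma_series z n) \<le> Gamma_series (Re z) n" by (simp add: Gamma_series_def)
  qed
qed

lemma norm_pochhammer_ge_1:
  assumes "\<bar>Im z\<bar> \<ge> 1"
  shows "norm (pochhammer z k) \<ge> 1"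
proof (induction k)
  case (Suc k)
  have "1 \<le> norm (z + of_nat k)" using abs_Im_le_cmod[of "z + of_nat k"] assms by simp
  then have "1 * 1 \<le> norm (pochhammer z k) * norm (z + of_nat k)" using Suc by (intro mult_mono) auto
  then show ?case by (simp add: pochhammer_Suc norm_mult)
qed simp

lemma not_nonpos_Ints_Im: "Im z \<noteq> 0 \<Longrightarrow> z \<notin> \<int>\<^sub>\<le>\<^sub>0"
  by (auto elim!: nonpos_Ints_cases)

text \<open>Shifting by k reaches real parts of at least 1, where the real Gamma function on a
  compact interval is a bound. Shifting back divides by a product of modulus at least 1, since the
  imaginary part has modulus at least 1.\<close>

lemma Gamma_bounded_strip:
  "\<exists>K>0. \<forall>z. 0 \<le> Re z \<and> Re z \<le> 1 \<and> 1 \<le> \<bar>Im (c + z)\<bar> \<longrightarrow> norm (Gamma (c + z)) \<le> K"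
proof -
  define k where "k = nat \<lceil>1 - Re c\<rceil>"
  have k: "Re c + real k \<ge> 1" unfolding k_def by linarith
  have "continuous_on {Re c + real k..Re c + real k + 1} (Gamma :: real \<Rightarrow> real)"
  proof (intro continuous_on_Gamma)
    show "{Re c + real k..Re c + real k + 1} \<inter> \<int>\<^sub>\<le>\<^sub>0 = {}" using k by (auto elim!: nonpos_Ints_cases)
  qed
  then have "bounded (Gamma ` {Re c + real k..Re c + real k + 1})"
    by (intro compact_imp_bounded compact_continuous_image) auto
  then obtain K where "\<forall>x\<in>Gamma ` {Re c + real k..Re c + real k + 1}. norm x \<le> K"
    unfolding bounded_iff by blast
  then have K: "\<bar>Gamma x\<bar> \<le> K" if "x \<in> {Re c + real k..Re c + real k + 1}" for x
    using that by simp
  have "norm (Gamma (c + z)) \<le> max K 1" if "0 \<le> Re z" "Re z \<le> 1" "1 \<le> \<bar>Im (c + z)\<bar>" for z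
  proof -
    have nz: "c + z \<notin> \<int>\<^sub>\<le>\<^sub>0" using that by (intro not_nonpos_Ints_Im) auto
    have "pochhammer (c + z) k * Gamma (c + z) = Gamma (c + z + of_nat k)"
      using pochhammer_Gamma[OF nz, of k] Gamma_nonzero[OF nz] by simp
    then have "norm (pochhammer (c + z) k) * norm (Gamma (c + z)) = norm (Gamma (c + z + of_nat k))"
      by (metis norm_mult)
    also have "\<dots> \<le> Gamma (Re (c + z + of_nat k))"
      using that k by (intro norm_Gamma_complex_le) auto
    also have "\<dots> \<le> K" using K[of "Re (c + z + of_nat k)"] that by auto
    finally have "norm (pochhammer (c + z) k) * norm (Gamma (c + z)) \<le> K" .
    moreover have "1 * norm (Gamma (c + z)) \<le> norm (pochhammer (c + z) k) * norm (Gamma (c + z))"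
      using norm_pochhammer_ge_1[OF that(3)] by (intro mult_right_mono) auto
    ultimately show ?thesis by simp
  qed
  then show ?thesis by (intro exI[of _ "max K 1"]) auto
qed

text \<open>A shift by \<open>1\<close> changes the product by a factor \<open>1 + O(1 / \<bar>Im z\<bar>)\<close>, and a point of a sector
  is at most \<open>2 * \<bar>Im z\<bar>\<close> such shifts away from a vertical strip.\<close>

lemma Gamma_product_bounded_sector:
  "\<exists>K>0. \<exists>M. \<forall>z. M \<le> \<bar>Im z\<bar> \<and> \<bar>Re z\<bar> \<le> \<bar>Im z\<bar> \<longrightarrow> norm (Gamma (b + z) * Gamma (d - z)) \<le> K"
proof -
  define h where "h z = Gamma (b + z) * Gamma (d - z)" for z
  define \<kappa> where "\<kappa> = norm (b + d - 1)"
  obtain K1 where K1: "K1 > 0" "\<And>z. 0 \<le> Re z \<Longrightarrow> Re z \<le> 1 \<Longrightarrow> 1 \<le> \<bar>Im (b + z)\<bar> \<Longrightarrow> norm (Gamma (b + z)) \<le> K1"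
    using Gamma_bounded_strip[of b] by auto
  \<comment> \<open>Gamma (d - w) will be read as Gamma (d - 1 + (1 - w)), where 1 - w lies in the
    strip again.\<close>
  obtain K2 where K2: "K2 > 0" "\<And>z. 0 \<le> Re z \<Longrightarrow> Re z \<le> 1 \<Longrightarrow> 1 \<le> \<bar>Im (d - 1 + z)\<bar> \<Longrightarrow> norm (Gamma (d - 1 + z)) \<le> K2"
    using Gamma_bounded_strip[of "d - 1"] by auto
  \<comment> \<open>From this height on, |z + b| and |z + 1 - d| are at least |Im z| / 2, and the
    Gamma arguments are at distance at least 1 from the real axis.\<close>
  define M where "M = 2 * (1 + \<bar>Im b\<bar> + \<bar>Im d\<bar>)"
  have step: "norm (h (z + 1)) \<le> norm (h z) * (1 + 2 * \<kappa> / \<bar>Im z\<bar>) \<and> norm (h z) \<le> norm (h (z + 1)) * (1 + 2 * \<kappa> / \<bar>Im z\<bar>)"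
    if "M \<le> \<bar>Im z\<bar>" for z
  proof -
    have "M > 0" by (simp add: M_def add_pos_nonneg)
    then have y: "\<bar>Im z\<bar> > 0" using that by (rule less_le_trans)
    have zb: "\<bar>Im z\<bar> / 2 \<le> norm (z + b)"
      using abs_Im_le_cmod[of "z + b"] that unfolding M_def plus_complex.sel
      by (smt (verit) field_sum_of_halves)
    have zd: "\<bar>Im z\<bar> / 2 \<le> norm (z + 1 - d)"
      using abs_Im_le_cmod[of "z + 1 - d"] that unfolding M_def plus_complex.sel minus_complex.sel one_complex.sel
      by (smt (verit) field_sum_of_halves)
    have 0: "Im (b + z) \<noteq> 0" "Im (d - z - 1) \<noteq> 0" using that by (auto simp: M_def)
    have 1: "Gamma (b + z + 1) = (b + z) * Gamma (b + z)" "Gamma (d - z - 1 + 1) = (d - z - 1) * Gamma (d - z - 1)"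
      by (rule Gamma_plus1[OF not_nonpos_Ints_Im[OF 0(1)]], rule Gamma_plus1[OF not_nonpos_Ints_Im[OF 0(2)]])
    \<comment> \<open>So one shift multiplies the modulus of h by the ratio of |z + b| and |z + 1 -
      d|, which differ by at most \<kappa>.\<close>
    have "(d - z - 1) * h (z + 1) = (b + z) * h z"
    proof -
      have e: "b + (z + 1) = b + z + 1" "d - (z + 1) = d - z - 1" by simp_all
      have 2: "Gamma (d - z) = (d - z - 1) * Gamma (d - z - 1)" using 1(2) by simp
      show ?thesis unfolding h_def e 1(1) 2 by (simp only: mult_ac)
    qed
    then have eq: "norm (z + 1 - d) * norm (h (z + 1)) = norm (z + b) * norm (h z)"
      by (metis (no_types, opaque_lifting) norm_mult norm_minus_commute add.commute diff_diff_add)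
    have gen: "x \<le> y * (1 + 2 * \<kappa> / \<bar>Im z\<bar>)"
      if "u * x = v * y" "\<bar>Im z\<bar> / 2 \<le> u" "v \<le> u + \<kappa>" "y \<ge> 0" for u v x y :: real
    proof -
      have u: "u > 0" using that(2) \<open>\<bar>Im z\<bar> > 0\<close> by linarith
      have "x = y * (v / u)" using that(1) u by (simp add: field_simps)
      also have "v / u \<le> 1 + \<kappa> / u" using that(3) u by (simp add: field_simps)
      also have "\<kappa> / u \<le> \<kappa> / (\<bar>Im z\<bar> / 2)"
        using that(2) \<open>\<bar>Im z\<bar> > 0\<close> by (intro divide_left_mono) (auto simp: \<kappa>_def)
      finally show ?thesis using that(4) by (simp add: mult_left_mono mult.commute[of \<kappa> 2])
    qed
    have e: "\<kappa> = norm ((z + b) - (z + 1 - d))" by (simp add: \<kappa>_def algebra_simps)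
    have "norm (z + b) \<le> norm (z + 1 - d) + \<kappa>" "norm (z + 1 - d) \<le> norm (z + b) + \<kappa>"
      using norm_triangle_ineq3[of "z + b" "z + 1 - d"] unfolding e[symmetric] by linarith+
    then show ?thesis
      using gen[OF eq zd] gen[OF eq[symmetric] zb] by auto
  qed
  have iter: "norm (h (z + of_nat m)) \<le> norm (h z) * (1 + 2 * \<kappa> / \<bar>Im z\<bar>) ^ m \<and>
       norm (h z) \<le> norm (h (z + of_nat m)) * (1 + 2 * \<kappa> / \<bar>Im z\<bar>) ^ m"
    if "M \<le> \<bar>Im z\<bar>" for z m
  proof (induction m)
    case (Suc m)
    define r where "r = 1 + 2 * \<kappa> / \<bar>Im z\<bar>"
    have r: "r \<ge> 0" by (simp add: r_def \<kappa>_def)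
    have s: "norm (h (z + of_nat (Suc m))) \<le> norm (h (z + of_nat m)) * r"
       "norm (h (z + of_nat m)) \<le> norm (h (z + of_nat (Suc m))) * r"
      using step[of "z + of_nat m"] that by (simp_all add: r_def add_ac)
    have "norm (h (z + of_nat m)) * r \<le> norm (h z) * r ^ m * r"
      using Suc r by (intro mult_right_mono) (auto simp: r_def)
    moreover have "norm (h (z + of_nat m)) * r ^ m \<le> norm (h (z + of_nat (Suc m))) * r * r ^ m"
      using s r by (intro mult_right_mono) auto
    moreover have "norm (h z) \<le> norm (h (z + of_nat m)) * r ^ m" using Suc by (simp add: r_def)
    ultimately show ?case using s unfolding r_def[symmetric] by (simp add: mult_ac)
  qed simp
  have "norm (h z) \<le> K1 * K2 * exp (4 * \<kappa>)" if z: "M \<le> \<bar>Im z\<bar>" "\<bar>Re z\<bar> \<le> \<bar>Im z\<bar>" for z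
  proof -
    define y where "y = \<bar>Im z\<bar>"
    have y: "y \<ge> 2" using z(1) by (simp add: y_def M_def)
    define k where "k = \<lfloor>Re z\<rfloor>"
    define w where "w = z - of_int k"
    have w: "0 \<le> Re w" "Re w \<le> 1" "Im w = Im z" unfolding w_def k_def by (auto; linarith)+
    have "norm (Gamma (b + w)) \<le> K1" using w z by (intro K1) (auto simp: M_def)
    moreover have "norm (Gamma (d - w)) \<le> K2"
      using K2(2)[of "1 - w"] w z by (auto simp: M_def)
    ultimately have hw: "norm (h w) \<le> K1 * K2" using K1 K2 by (auto simp: h_def norm_mult intro!: mult_mono)
    define m where "m = nat \<bar>k\<bar>"
    \<comment> \<open>Rounding costs at most 1 \<le> y, whence m \<le> 2 y; this makes (1 + 2
      \<kappa> / y)^m at most exp (4 \<kappa>), uniformly in z.\<close>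
    have m: "real m \<le> 2 * y" using z(2) y unfolding m_def k_def y_def by linarith
    have "norm (h z) \<le> norm (h w) * (1 + 2 * \<kappa> / y) ^ m"
    proof (cases "k \<ge> 0")
      case True
      then have e: "w + of_nat m = z" by (simp add: w_def m_def)
      show ?thesis using iter[of w m] z(1) unfolding e w(3) y_def by blast
    next
      case False
      then have "complex_of_nat m = - of_int k" by (simp add: m_def)
      then have e: "z + of_nat m = w" by (simp add: w_def)
      show ?thesis using iter[of z m] z(1) unfolding e y_def by blast
    qed
    also have "(1 + 2 * \<kappa> / y) ^ m \<le> exp (2 * \<kappa> / y) ^ m"
      using y by (intro power_mono exp_ge_add_one_self) (auto simp: \<kappa>_def)
    also have "exp (2 * \<kappa> / y) ^ m = exp (real m * (2 * \<kappa> / y))" by (rule exp_of_nat_mult[symmetric])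
    also have "\<dots> \<le> exp (2 * y * (2 * \<kappa> / y))"
      using m y by (subst exp_le_cancel_iff, intro mult_right_mono) (auto simp: \<kappa>_def)
    also have "2 * y * (2 * \<kappa> / y) = 4 * \<kappa>" using y by simp
    also have "norm (h w) * exp (4 * \<kappa>) \<le> K1 * K2 * exp (4 * \<kappa>)" using hw by (intro mult_right_mono) auto
    finally show ?thesis by (simp add: mult_left_mono)
  qed
  then show ?thesis
    using K1 K2 by (intro exI[of _ "K1 * K2 * exp (4 * \<kappa>)"] conjI exI[of _ M]) (auto simp: h_def)
qed

lemma norm_sin_ge:
  "(exp \<bar>Im z\<bar> - exp (- \<bar>Im z\<bar>)) / 2 \<le> norm (sin z)"
proof -
  have "sin z = (exp (\<i> * z) - exp (- (\<i> * z))) / (2 * \<i>)" by (rule sin_exp_eq)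
  then have "norm (sin z) = norm (exp (\<i> * z) - exp (- (\<i> * z))) / 2" by (simp add: norm_divide norm_mult)
  moreover have "norm (exp (\<i> * z)) = exp (- Im z)" "norm (exp (- (\<i> * z))) = exp (Im z)" by simp_all
  ultimately show ?thesis
    using norm_triangle_ineq3[of "exp (\<i> * z)" "exp (- (\<i> * z))"] by (auto simp: abs_if split: if_splits)
qed

text \<open>By reflection the product is -pi / sin (pi z). This pair supplies all the decay of the
  weight; the other pair of Gamma factors is merely bounded on the cones.\<close>

lemma Gamma_reflected_bound:
  assumes "\<bar>Im z\<bar> \<ge> 1"
  shows "norm (Gamma (- z) * Gamma (1 + z)) \<le> 4 * pi * exp (- pi * \<bar>Im z\<bar>)"
proof -
  define y where "y = pi * \<bar>Im z\<bar>"
  have "pi * 1 \<le> y" unfolding y_def using assms by (intro mult_left_mono) auto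
  then have y: "y \<ge> 1" using pi_gt3 by linarith
  have "Gamma (- z) * Gamma (1 + z) = of_real pi / sin (of_real pi * (- z))"
    using Gamma_reflection_complex[of "- z"] by simp
  then have "norm (Gamma (- z) * Gamma (1 + z)) = pi / norm (sin (of_real pi * z))"
    by (simp add: norm_divide)
  also have s: "exp y / 4 \<le> norm (sin (of_real pi * z))"
  proof -
    have "exp (- y) \<le> 1" using y by simp
    moreover have "2 \<le> exp y" using exp_ge_add_one_self[of y] y by linarith
    moreover have "a \<le> 1 \<Longrightarrow> 2 \<le> b \<Longrightarrow> b / 4 \<le> (b - a) / 2" for a b :: real by (simp add: field_simps)
    ultimately have "exp y / 4 \<le> (exp y - exp (- y)) / 2" by blast
    also have "\<dots> \<le> norm (sin (of_real pi * z))"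
      using norm_sin_ge[of "of_real pi * z"] by (simp add: y_def abs_mult)
    finally show ?thesis .
  qed
  then have "pi / norm (sin (of_real pi * z)) \<le> pi / (exp y / 4)"
    by (intro divide_left_mono mult_pos_pos) (auto intro: less_le_trans[OF _ s])
  also have "\<dots> = 4 * pi * exp (- y)" by (simp add: exp_minus field_simps)
  finally show ?thesis by (simp add: y_def)
qed

text \<open>At each coefficient half of the rate bounds the remaining polynomial and the other half
  absorbs the factor z.\<close>

lemma poly_le_exp:
  fixes q :: "complex poly"
  shows "e > 0 \<Longrightarrow> \<exists>C>0. \<forall>z. norm (poly q z) \<le> C * exp (e * norm z)"
proof (induction q arbitrary: e)
  case 0
  then show ?case by (intro exI[of _ 1]) auto
next
  case (pCons a q)
  then obtain C where C: "C > 0" "\<And>z. norm (poly q z) \<le> C * exp (e / 2 * norm z)"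
    using pCons.IH[of "e / 2"] by auto
  have "norm (poly (pCons a q) z) \<le> (norm a + 2 * C / e) * exp (e * norm z)" for z
  proof -
    have "e / 2 * norm z \<le> exp (e / 2 * norm z)" using exp_ge_add_one_self[of "e / 2 * norm z"] by linarith
    then have z: "norm z \<le> 2 / e * exp (e / 2 * norm z)" using pCons.prems by (simp add: field_simps)
    have "norm (poly (pCons a q) z) \<le> norm a + norm z * norm (poly q z)"
      using norm_triangle_ineq[of a "z * poly q z"] by (simp add: norm_mult)
    also have "norm z * norm (poly q z) \<le> (2 / e * exp (e / 2 * norm z)) * (C * exp (e / 2 * norm z))"
      using z C pCons.prems by (intro mult_mono) auto
    also have "\<dots> = 2 * C / e * (exp (e / 2 * norm z) * exp (e / 2 * norm z))" by simp
    also have "exp (e / 2 * norm z) * exp (e / 2 * norm z) = exp (e * norm z)"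
      by (simp flip: exp_add)
    also have "norm a \<le> norm a * exp (e * norm z)"
      using pCons.prems by (simp add: mult_le_cancel_left1)
    finally show ?thesis by (simp add: distrib_right)
  qed
  moreover have "norm a + 2 * C / e > 0" using C pCons.prems by (intro add_nonneg_pos) auto
  ultimately show ?case by blast
qed

text \<open>The weight of continuous Hahn polynomials with two of the four parameters fixed at 0 and
  1; \<open>hahn_omega\<close> is the case b = \<alpha> + N + 2, d = \<beta> + N + 1.\<close>

definition gamma_weight :: "complex \<Rightarrow> complex \<Rightarrow> complex \<Rightarrow> complex" where
  "gamma_weight b d z = Gamma (- z) * Gamma (d - z) * Gamma (1 + z) * Gamma (b + z)"

text \<open>On the cones |z| \<le> 2 |Im z|, so the polynomial costs exp (2 |Im z|) against the
  factor exp (-pi |Im z|); as pi > 3, a rate of 1 is left.\<close>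

lemma gamma_weight_bound:
  "\<exists>c M. \<forall>z. M \<le> \<bar>Im z\<bar> \<and> \<bar>Re z\<bar> \<le> \<bar>Im z\<bar> \<longrightarrow>
      norm (poly q z * gamma_weight b d z) \<le> c * exp (- \<bar>Im z\<bar>)"
proof -
  obtain K M where K: "K > 0" "\<And>z. M \<le> \<bar>Im z\<bar> \<Longrightarrow> \<bar>Re z\<bar> \<le> \<bar>Im z\<bar> \<Longrightarrow> norm (Gamma (b + z) * Gamma (d - z)) \<le> K"
    using Gamma_product_bounded_sector[of b d] by auto
  obtain C where C: "C > 0" "\<And>z. norm (poly q z) \<le> C * exp (1 * norm z)"
    using poly_le_exp[of 1 q] by auto
  have "norm (poly q z * gamma_weight b d z) \<le> (4 * pi * C * K) * exp (- \<bar>Im z\<bar>)"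
    if z: "max M 1 \<le> \<bar>Im z\<bar>" "\<bar>Re z\<bar> \<le> \<bar>Im z\<bar>" for z
  proof -
    have nz: "norm z \<le> 2 * \<bar>Im z\<bar>" using cmod_le[of z] z by linarith
    have "norm (poly q z * gamma_weight b d z)
       = norm (poly q z) * (norm (Gamma (- z) * Gamma (1 + z)) * norm (Gamma (b + z) * Gamma (d - z)))"
      by (simp add: gamma_weight_def norm_mult)
    also have "\<dots> \<le> (C * exp (2 * \<bar>Im z\<bar>)) * ((4 * pi * exp (- pi * \<bar>Im z\<bar>)) * K)"
    proof (intro mult_mono)
      show "norm (poly q z) \<le> C * exp (2 * \<bar>Im z\<bar>)"
        using C(1) nz by (intro order_trans[OF C(2)] mult_left_mono) auto
    qed (use Gamma_reflected_bound[of z] K C z in auto)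
    also have "\<dots> = 4 * pi * C * K * exp (2 * \<bar>Im z\<bar> - pi * \<bar>Im z\<bar>)"
      by (simp add: exp_diff exp_minus field_simps)
    also have "\<dots> \<le> 4 * pi * C * K * exp (- \<bar>Im z\<bar>)"
    proof -
      have "3 * \<bar>Im z\<bar> \<le> pi * \<bar>Im z\<bar>" using pi_gt3 by (intro mult_right_mono) auto
      then show ?thesis using C K by (intro mult_left_mono) auto
    qed
    finally show ?thesis .
  qed
  then show ?thesis by blast
qed

section \<open>The Pearson equation of the integral\<close>

text \<open>The direction of c + \<gamma> is that of c / |\<gamma>| + sgn \<gamma>, whose first
  summand tends to 0.\<close>

lemma tendsto_sgn_translate:
  fixes \<gamma> :: "real \<Rightarrow> complex"
  assumes inf: "filterlim \<gamma> at_infinity F" and lim: "((\<lambda>t. sgn (\<gamma> t)) \<longlongrightarrow> l) F" and l: "norm l = 1"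
  shows "((\<lambda>t. sgn (c + \<gamma> t)) \<longlongrightarrow> l) F"
proof -
  have n: "filterlim (\<lambda>t. norm (\<gamma> t)) at_top F" using inf by (rule filterlim_at_infinity_imp_norm_at_top)
  have "((\<lambda>t. inverse (norm (\<gamma> t)) *\<^sub>R c + sgn (\<gamma> t)) \<longlongrightarrow> 0 *\<^sub>R c + l) F"
    by (intro tendsto_intros lim tendsto_inverse_0_at_top n)
  then have "((\<lambda>t. sgn (inverse (norm (\<gamma> t)) *\<^sub>R c + sgn (\<gamma> t))) \<longlongrightarrow> sgn l) F"
    using l by (intro tendsto_sgn) auto
  then have 1: "((\<lambda>t. sgn (inverse (norm (\<gamma> t)) *\<^sub>R c + sgn (\<gamma> t))) \<longlongrightarrow> l) F"
    using l by (simp add: sgn_div_norm[of l])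
  have "\<forall>\<^sub>F t in F. 0 < norm (\<gamma> t)" using n unfolding filterlim_at_top_dense by blast
  then have "\<forall>\<^sub>F t in F. sgn (inverse (norm (\<gamma> t)) *\<^sub>R c + sgn (\<gamma> t)) = sgn (c + \<gamma> t)"
  proof eventually_elim
    case (elim t)
    have "inverse (norm (\<gamma> t)) *\<^sub>R c + sgn (\<gamma> t) = inverse (norm (\<gamma> t)) *\<^sub>R (c + \<gamma> t)"
      by (simp add: sgn_div_norm scaleR_add_right)
    then show ?case using elim by (simp add: sgn_scaleR)
  qed
  with 1 show ?thesis by (rule Lim_transform_eventually)
qed

lemma imaginary_contour_translate:
  assumes "imaginary_contour \<gamma>"
  shows "imaginary_contour ((+) c \<circ> \<gamma>)"
proof -
  have \<gamma>: "filterlim \<gamma> at_infinity at_bot" "((\<lambda>t. sgn (\<gamma> t)) \<longlongrightarrow> - \<i>) at_bot"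
    "filterlim \<gamma> at_infinity at_top" "((\<lambda>t. sgn (\<gamma> t)) \<longlongrightarrow> \<i>) at_top"
    using assms by (simp_all add: imaginary_contour_def)
  have "((+) c \<circ> \<gamma>) piecewise_C1_differentiable_on {a..b}" for a b
    using assms by (simp add: imaginary_contour_def piecewise_C1_differentiable_on_translation_eq)
  moreover have "filterlim ((+) c \<circ> \<gamma>) at_infinity at_bot" "filterlim ((+) c \<circ> \<gamma>) at_infinity at_top"
    unfolding o_def by (intro tendsto_add_filterlim_at_infinity[OF tendsto_const] \<gamma>)+
  moreover have "((\<lambda>t. sgn (((+) c \<circ> \<gamma>) t)) \<longlongrightarrow> - \<i>) at_bot" "((\<lambda>t. sgn (((+) c \<circ> \<gamma>) t)) \<longlongrightarrow> \<i>) at_top"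
    unfolding o_def by (rule tendsto_sgn_translate[OF \<gamma>(1,2)] tendsto_sgn_translate[OF \<gamma>(3,4)], simp)+
  ultimately show ?thesis unfolding imaginary_contour_def by blast
qed

lemma imaginary_contour_vertical_line: "imaginary_contour (\<lambda>t. c + \<i> * of_real t)"
proof -
  have "imaginary_contour (\<lambda>t. \<i> * of_real t)"
    unfolding imaginary_contour_def
  proof (intro conjI allI)
    show "(\<lambda>t. \<i> * complex_of_real t) piecewise_C1_differentiable_on {a..b}" for a b
    proof (rule C1_differentiable_imp_piecewise)
      have "((\<lambda>t. \<i> * complex_of_real t) has_vector_derivative \<i> * 1) (at t)" for t
        by (intro derivative_eq_intros) auto
      then show "(\<lambda>t. \<i> * complex_of_real t) C1_differentiable_on {a..b}"
        unfolding C1_differentiable_on_def by (intro exI[of _ "\<lambda>_. \<i>"]) auto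
    qed
    show "filterlim (\<lambda>t. \<i> * complex_of_real t) at_infinity at_bot"
      "filterlim (\<lambda>t. \<i> * complex_of_real t) at_infinity at_top"
      by (auto simp: filterlim_at_infinity_conv_norm_at_top norm_mult
          intro: filterlim_abs_real filterlim_at_top_mirror[THEN iffD2])
         (auto simp: filterlim_at_bot_mirror abs_minus_cancel intro!: filterlim_abs_real)
    have sgn_i: "sgn \<i> = \<i>" by (simp add: sgn_div_norm)
    have "\<forall>\<^sub>F t in at_top. \<i> = sgn (\<i> * complex_of_real t)"
      using eventually_gt_at_top[of 0] by eventually_elim (simp add: sgn_mult sgn_of_real sgn_i)
    then show "((\<lambda>t. sgn (\<i> * complex_of_real t)) \<longlongrightarrow> \<i>) at_top"
      by (rule Lim_transform_eventually[OF tendsto_const])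
    have "\<forall>\<^sub>F t in at_bot. - \<i> = sgn (\<i> * complex_of_real t)"
      using eventually_gt_at_bot[of 0] by eventually_elim (simp add: sgn_mult sgn_of_real sgn_i)
    then show "((\<lambda>t. sgn (\<i> * complex_of_real t)) \<longlongrightarrow> - \<i>) at_bot"
      by (rule Lim_transform_eventually[OF tendsto_const])
  qed
  from imaginary_contour_translate[OF this, of c] show ?thesis by (simp add: o_def)
qed

text \<open>A real translation moves the real ray along itself, so only the point from which the ray
  is used changes, by at most |r|.\<close>

lemma right_of_translate:
  assumes "right_of \<gamma> \<sigma> p" "\<sigma> \<in> {1, -1}"
  shows "right_of ((+) (of_real r) \<circ> \<gamma>) \<sigma> (of_real r + p)"
proof -
  obtain X where X: "\<And>x. x \<ge> X \<Longrightarrow> connected_component (- range \<gamma>) p (complex_of_real (\<sigma> * x))"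
    using assms by (auto simp: right_of_def eventually_at_top_linorder)
  have "connected_component (- range ((+) (of_real r) \<circ> \<gamma>)) (of_real r + p) (of_real (\<sigma> * x))"
    if "x \<ge> X + \<bar>r\<bar>" for x
  proof -
    have "x - \<sigma> * r \<ge> X" using that assms(2) by auto
    from X[OF this] obtain T where T: "connected T" "T \<subseteq> - range \<gamma>" "p \<in> T" "of_real (\<sigma> * (x - \<sigma> * r)) \<in> T"
      by (auto simp: connected_component_def)
    have e: "of_real r + of_real (\<sigma> * (x - \<sigma> * r)) = complex_of_real (\<sigma> * x)"
      using assms(2) by (auto simp: algebra_simps)
    show ?thesis unfolding connected_component_def
    proof (intro exI[of _ "(+) (of_real r) ` T"] conjI)
      show "connected ((+) (of_real r) ` T)" using T(1)
        by (intro connected_continuous_image continuous_intros)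
      show "(+) (of_real r) ` T \<subseteq> - range ((+) (of_real r) \<circ> \<gamma>)" using T(2) by auto
      show "of_real r + p \<in> (+) (of_real r) ` T" using T(3) by auto
      show "of_real (\<sigma> * x) \<in> (+) (of_real r) ` T" using imageI[OF T(4), of "(+) (of_real r)"] unfolding e .
    qed
  qed
  then show ?thesis unfolding right_of_def by (rule eventually_at_top_linorderI)
qed

section \<open>Translation, uniqueness and linearity of improper contour integrals\<close>

lemma has_improper_contour_integral_translate:
  assumes "has_improper_contour_integral F I ((+) c \<circ> \<gamma>)"
  shows "has_improper_contour_integral (\<lambda>z. F (z + c)) I \<gamma>"
proof -
  have "subpath a b ((+) c \<circ> \<gamma>) = (+) c \<circ> subpath a b \<gamma>" for a b by (simp add: subpath_def o_def)
  then show ?thesis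
    using assms by (simp add: has_improper_contour_integral_def contour_integrable_translate contour_integral_translate)
qed

lemma has_improper_contour_integral_cong:
  assumes "has_improper_contour_integral F I \<gamma>" "\<And>z. z \<in> range \<gamma> \<Longrightarrow> F z = G z"
  shows "has_improper_contour_integral G I \<gamma>"
proof -
  have eq: "F z = G z" if "z \<in> path_image (subpath a b \<gamma>)" for z a b
    using that path_image_subpath_contour assms(2) by blast
  have "contour_integral (subpath a b \<gamma>) F = contour_integral (subpath a b \<gamma>) G" for a b
    by (rule contour_integral_eq) (rule eq)
  moreover have "F contour_integrable_on subpath a b \<gamma> \<Longrightarrow> G contour_integrable_on subpath a b \<gamma>" for a b
    by (erule contour_integrable_eq) (rule eq)
  ultimately show ?thesis using assms(1) by (simp add: has_improper_contour_integral_def)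
qed

lemma has_improper_contour_integral_unique:
  assumes "has_improper_contour_integral F I \<gamma>" "has_improper_contour_integral F J \<gamma>"
  shows "I = J"
  using assms unfolding has_improper_contour_integral_def
  by (auto intro: tendsto_unique[rotated] simp: prod_filter_eq_bot)

lemma improper_contour_integral_unique:
  "has_improper_contour_integral F I \<gamma> \<Longrightarrow> improper_contour_integral \<gamma> F = I"
  unfolding improper_contour_integral_def
  by (rule the_equality) (auto intro: has_improper_contour_integral_unique)

lemma has_improper_contour_integral_add:
  assumes "has_improper_contour_integral F I \<gamma>" "has_improper_contour_integral G J \<gamma>"
  shows "has_improper_contour_integral (\<lambda>z. F z + G z) (I + J) \<gamma>"
proof -
  have "((\<lambda>x. (case x of (a, b) \<Rightarrow> contour_integral (subpath a b \<gamma>) F)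
      + (case x of (a, b) \<Rightarrow> contour_integral (subpath a b \<gamma>) G)) \<longlongrightarrow> I + J) (at_bot \<times>\<^sub>F at_top)"
    using assms by (intro tendsto_add) (auto simp: has_improper_contour_integral_def)
  moreover have "\<forall>\<^sub>F x in at_bot \<times>\<^sub>F at_top. (case x of (a, b) \<Rightarrow> contour_integral (subpath a b \<gamma>) F)
      + (case x of (a, b) \<Rightarrow> contour_integral (subpath a b \<gamma>) G)
     = (case x of (a, b) \<Rightarrow> contour_integral (subpath a b \<gamma>) (\<lambda>z. F z + G z))"
    unfolding eventually_prod_filter
  proof (intro exI conjI allI impI)
    show "eventually (\<lambda>a. a \<le> (0::real)) at_bot" by (rule eventually_le_at_bot)
    show "eventually (\<lambda>b. b \<ge> (0::real)) at_top" by (rule eventually_ge_at_top)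
  qed (use assms in \<open>simp add: has_improper_contour_integral_def contour_integral_add\<close>)
  ultimately have "((\<lambda>x. (case x of (a, b) \<Rightarrow> contour_integral (subpath a b \<gamma>) (\<lambda>z. F z + G z))) \<longlongrightarrow> I + J) (at_bot \<times>\<^sub>F at_top)"
    by (rule Lim_transform_eventually)
  then show ?thesis
    using assms by (auto simp: has_improper_contour_integral_def intro: contour_integrable_add)
qed

lemma has_improper_contour_integral_lmul:
  assumes "has_improper_contour_integral F I \<gamma>"
  shows "has_improper_contour_integral (\<lambda>z. c * F z) (c * I) \<gamma>"
proof -
  have "((\<lambda>x. c * (case x of (a, b) \<Rightarrow> contour_integral (subpath a b \<gamma>) F)) \<longlongrightarrow> c * I) (at_bot \<times>\<^sub>F at_top)"
    using assms by (intro tendsto_mult tendsto_const) (auto simp: has_improper_contour_integral_def)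
  moreover have "\<forall>\<^sub>F x in at_bot \<times>\<^sub>F at_top. c * (case x of (a, b) \<Rightarrow> contour_integral (subpath a b \<gamma>) F)
     = (case x of (a, b) \<Rightarrow> contour_integral (subpath a b \<gamma>) (\<lambda>z. c * F z))"
    unfolding eventually_prod_filter
  proof (intro exI conjI allI impI)
    show "eventually (\<lambda>a. a \<le> (0::real)) at_bot" by (rule eventually_le_at_bot)
    show "eventually (\<lambda>b. b \<ge> (0::real)) at_top" by (rule eventually_ge_at_top)
  qed (use assms in \<open>simp add: has_improper_contour_integral_def contour_integral_lmul\<close>)
  ultimately have "((\<lambda>x. (case x of (a, b) \<Rightarrow> contour_integral (subpath a b \<gamma>) (\<lambda>z. c * F z))) \<longlongrightarrow> c * I) (at_bot \<times>\<^sub>F at_top)"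
    by (rule Lim_transform_eventually)
  then show ?thesis
    using assms by (auto simp: has_improper_contour_integral_def intro: contour_integrable_lmul)
qed

text \<open>The poles are described through the arguments of the Gamma factors rather than by
  \<open>is_pole\<close>, so that the effect of shifting z, b or d is an implication between
  memberships.\<close>

definition separating :: "complex \<Rightarrow> complex \<Rightarrow> (real \<Rightarrow> complex) \<Rightarrow> bool" where
  "separating b d \<gamma> \<longleftrightarrow> imaginary_contour \<gamma> \<and>
     (\<forall>z. - z \<in> \<int>\<^sub>\<le>\<^sub>0 \<or> d - z \<in> \<int>\<^sub>\<le>\<^sub>0 \<longrightarrow> right_of \<gamma> 1 z) \<and>
     (\<forall>z. 1 + z \<in> \<int>\<^sub>\<le>\<^sub>0 \<or> b + z \<in> \<int>\<^sub>\<le>\<^sub>0 \<longrightarrow> right_of \<gamma> (- 1) z)"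

lemma separating_range:
  assumes "separating b d \<gamma>" "z \<in> range \<gamma>"
  shows "- z \<notin> \<int>\<^sub>\<le>\<^sub>0" "d - z \<notin> \<int>\<^sub>\<le>\<^sub>0" "1 + z \<notin> \<int>\<^sub>\<le>\<^sub>0" "b + z \<notin> \<int>\<^sub>\<le>\<^sub>0"
  using assms right_of_notin_range unfolding separating_def by blast+

text \<open>The four parameters are free so that it also covers the integrand behind the Pearson
  equation, whose poles are not those of the weight. Far from the real axis that integrand is a
  polynomial times the weight, which yields the decay.\<close>

lemma gamma_contour_integral_eq:
  assumes \<gamma>: "imaginary_contour \<gamma>1" "imaginary_contour \<gamma>2"
    and F: "\<And>z. M1 \<le> \<bar>Im z\<bar> \<Longrightarrow>
       poly q z * (Gamma (a - z) * Gamma (a' - z) * Gamma (c + z) * Gamma (c' + z)) = poly r z * gamma_weight b d z"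
    and right: "\<And>z. a - z \<in> \<int>\<^sub>\<le>\<^sub>0 \<or> a' - z \<in> \<int>\<^sub>\<le>\<^sub>0 \<Longrightarrow> right_of \<gamma>1 1 z \<and> right_of \<gamma>2 1 z"
    and left: "\<And>z. c + z \<in> \<int>\<^sub>\<le>\<^sub>0 \<or> c' + z \<in> \<int>\<^sub>\<le>\<^sub>0 \<Longrightarrow> right_of \<gamma>1 (- 1) z \<and> right_of \<gamma>2 (- 1) z"
  defines "G \<equiv> \<lambda>z. poly q z * (Gamma (a - z) * Gamma (a' - z) * Gamma (c + z) * Gamma (c' + z))"
  shows "\<exists>I. has_improper_contour_integral G I \<gamma>1 \<and> has_improper_contour_integral G I \<gamma>2"
proof -
  define P where "P = (\<lambda>z. a - z) -` \<int>\<^sub>\<le>\<^sub>0 \<union> (\<lambda>z. a' - z) -` \<int>\<^sub>\<le>\<^sub>0 \<union> (\<lambda>z. c + z) -` \<int>\<^sub>\<le>\<^sub>0 \<union> (\<lambda>z. c' + z) -` \<int>\<^sub>\<le>\<^sub>0"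
  obtain k M0 where M0: "\<And>z. M0 \<le> \<bar>Im z\<bar> \<Longrightarrow> \<bar>Re z\<bar> \<le> \<bar>Im z\<bar> \<Longrightarrow> norm (poly r z * gamma_weight b d z) \<le> k * exp (- \<bar>Im z\<bar>)"
    using gamma_weight_bound[of r b d] by blast
  define M where "M = Max {0, M0, M1, \<bar>Im a\<bar>, \<bar>Im a'\<bar>, \<bar>Im c\<bar>, \<bar>Im c'\<bar>}"
  have M: "0 \<le> M" "M0 \<le> M" "M1 \<le> M" "\<bar>Im a\<bar> \<le> M" "\<bar>Im a'\<bar> \<le> M" "\<bar>Im c\<bar> \<le> M" "\<bar>Im c'\<bar> \<le> M"
    unfolding M_def by (rule Max_ge; simp)+
  have ImP: "\<bar>Im p\<bar> \<le> M" if "p \<in> P" for p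
  proof -
    have "Im (a - p) = 0 \<or> Im (a' - p) = 0 \<or> Im (c + p) = 0 \<or> Im (c' + p) = 0"
      using that not_nonpos_Ints_Im unfolding P_def by blast
    then show ?thesis using M by auto
  qed
  show ?thesis
  proof (rule improper_contour_integral_eq[OF \<gamma>, of P M G k])
    show "closed P"
      unfolding P_def by (intro closed_Un closed_vimage closed_nonpos_Ints continuous_intros)
    show "G holomorphic_on - P"
      unfolding G_def P_def by (intro holomorphic_intros) auto
    show "norm (G z) \<le> k * exp (- \<bar>Im z\<bar>)" if z: "z \<in> upper_sector M \<union> lower_sector M" for z
    proof -
      have z: "M < \<bar>Im z\<bar>" "\<bar>Re z\<bar> \<le> \<bar>Im z\<bar>" using that M(1) by (auto simp: upper_sector_def lower_sector_def)
      then have "G z = poly r z * gamma_weight b d z"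
        unfolding G_def using M by (intro F) auto
      then show ?thesis using M0[of z] z M(2) by simp
    qed
    show "\<exists>\<sigma>\<in>{1, -1}. right_of \<gamma>1 \<sigma> p \<and> right_of \<gamma>2 \<sigma> p" if "p \<in> P" for p
      using that right[of p] left[of p] unfolding P_def by blast
  qed (use ImP M in auto)
qed

lemma weight_integral_eq:
  assumes "separating b d \<gamma>1" "separating b d \<gamma>2"
  shows "\<exists>I. has_improper_contour_integral (\<lambda>z. poly q z * gamma_weight b d z) I \<gamma>1
           \<and> has_improper_contour_integral (\<lambda>z. poly q z * gamma_weight b d z) I \<gamma>2"
proof -
  have "\<exists>I. has_improper_contour_integral (\<lambda>z. poly q z * (Gamma (0 - z) * Gamma (d - z) * Gamma (1 + z) * Gamma (b + z))) I \<gamma>1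
     \<and> has_improper_contour_integral (\<lambda>z. poly q z * (Gamma (0 - z) * Gamma (d - z) * Gamma (1 + z) * Gamma (b + z))) I \<gamma>2"
    by (rule gamma_contour_integral_eq[where r = q and b = b and d = d and ?M1.0 = 0])
       (use assms in \<open>auto simp: separating_def gamma_weight_def\<close>)
  then show ?thesis by (simp add: gamma_weight_def mult_ac)
qed

lemma nonpos_Ints_diff_1: "(z :: complex) \<in> \<int>\<^sub>\<le>\<^sub>0 \<Longrightarrow> z - 1 \<in> \<int>\<^sub>\<le>\<^sub>0"
  using nonpos_Ints_diff_Nats[of z 1] by simp

text \<open>Both sides are integrals of one function, over the contour and over its translate by \<open>1\<close>;
  the factors \<open>z\<close> and \<open>z - d\<close> cancel the only poles between the two.\<close>

lemma weight_integral_pearson: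
  assumes sep: "separating b d \<gamma>"
  shows "\<exists>I. has_improper_contour_integral
      (\<lambda>z. poly (pcompose q [:1, 1:] * [:b, 1:] * [:1, 1:]) z * gamma_weight b d z) I \<gamma>
    \<and> has_improper_contour_integral (\<lambda>z. poly (q * [:0, 1:] * [:- d, 1:]) z * gamma_weight b d z) I \<gamma>"
proof -
  define G where "G = (\<lambda>z. poly q z * (Gamma (1 - z) * Gamma (d + 1 - z) * Gamma (1 + z) * Gamma (b + z)))"
  have \<gamma>: "imaginary_contour \<gamma>" using sep by (simp add: separating_def)
  have r: "right_of \<gamma> 1 z" if "- z \<in> \<int>\<^sub>\<le>\<^sub>0 \<or> d - z \<in> \<int>\<^sub>\<le>\<^sub>0" for z using sep that by (auto simp: separating_def)
  have l: "right_of \<gamma> (- 1) z" if "1 + z \<in> \<int>\<^sub>\<le>\<^sub>0 \<or> b + z \<in> \<int>\<^sub>\<le>\<^sub>0" for z using sep that by (auto simp: separating_def)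
  have trans: "right_of ((+) 1 \<circ> \<gamma>) \<sigma> z" if "right_of \<gamma> \<sigma> (z - 1)" "\<sigma> \<in> {1, -1}" for \<sigma> z
    using right_of_translate[OF that, of 1] by simp
  have eq: "G z = poly (q * [:0, 1:] * [:- d, 1:]) z * gamma_weight b d z" if "- z \<notin> \<int>\<^sub>\<le>\<^sub>0" "d - z \<notin> \<int>\<^sub>\<le>\<^sub>0" for z
  proof -
    have e: "1 - z = - z + 1" "d + 1 - z = d - z + 1" by simp_all
    show ?thesis
      unfolding G_def gamma_weight_def e Gamma_plus1[OF that(1)] Gamma_plus1[OF that(2)]
      by (simp add: algebra_simps)
  qed
  have "\<exists>I. has_improper_contour_integral G I \<gamma> \<and> has_improper_contour_integral G I ((+) 1 \<circ> \<gamma>)"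
    unfolding G_def
  proof (rule gamma_contour_integral_eq[where r = "q * [:0, 1:] * [:- d, 1:]" and b = b and d = d
        and ?M1.0 = "\<bar>Im d\<bar> + 1"])
    show "imaginary_contour \<gamma>" "imaginary_contour ((+) 1 \<circ> \<gamma>)" using \<gamma> by (auto intro: imaginary_contour_translate)
    show "right_of \<gamma> 1 z \<and> right_of ((+) 1 \<circ> \<gamma>) 1 z" if "1 - z \<in> \<int>\<^sub>\<le>\<^sub>0 \<or> d + 1 - z \<in> \<int>\<^sub>\<le>\<^sub>0" for z
    proof
      show "right_of \<gamma> 1 z" using that nonpos_Ints_diff_1[of "1 - z"] nonpos_Ints_diff_1[of "d + 1 - z"]
        by (intro r) auto
      show "right_of ((+) 1 \<circ> \<gamma>) 1 z" using that by (intro trans r) (auto simp: algebra_simps)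
    qed
    show "right_of \<gamma> (- 1) z \<and> right_of ((+) 1 \<circ> \<gamma>) (- 1) z" if "1 + z \<in> \<int>\<^sub>\<le>\<^sub>0 \<or> b + z \<in> \<int>\<^sub>\<le>\<^sub>0" for z
    proof
      show "right_of \<gamma> (- 1) z" using that by (rule l)
      show "right_of ((+) 1 \<circ> \<gamma>) (- 1) z" using that nonpos_Ints_diff_1[of "1 + z"] nonpos_Ints_diff_1[of "b + z"]
        by (intro trans l) (auto simp: algebra_simps)
    qed
    show "poly q z * (Gamma (1 - z) * Gamma (d + 1 - z) * Gamma (1 + z) * Gamma (b + z))
        = poly (q * [:0, 1:] * [:- d, 1:]) z * gamma_weight b d z"
      if "\<bar>Im d\<bar> + 1 \<le> \<bar>Im z\<bar>" for z
    proof -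
      have "Im (- z) \<noteq> 0" "Im (d - z) \<noteq> 0" using that by auto
      then show ?thesis using eq[of z] not_nonpos_Ints_Im unfolding G_def by blast
    qed
  qed
  then obtain I where I: "has_improper_contour_integral G I \<gamma>" "has_improper_contour_integral G I ((+) 1 \<circ> \<gamma>)"
    by blast
  have "has_improper_contour_integral (\<lambda>z. poly (q * [:0, 1:] * [:- d, 1:]) z * gamma_weight b d z) I \<gamma>"
  proof (rule has_improper_contour_integral_cong[OF I(1)])
    fix z assume "z \<in> range \<gamma>"
    from separating_range[OF sep this] show "G z = poly (q * [:0, 1:] * [:- d, 1:]) z * gamma_weight b d z"
      by (intro eq) auto
  qed
  moreover have "has_improper_contour_integral
      (\<lambda>z. poly (pcompose q [:1, 1:] * [:b, 1:] * [:1, 1:]) z * gamma_weight b d z) I \<gamma>"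
  proof (rule has_improper_contour_integral_cong[OF has_improper_contour_integral_translate[OF I(2)]])
    fix z assume "z \<in> range \<gamma>"
    note nonpos = separating_range[OF sep this]
    have e: "1 - (z + 1) = - z" "d + 1 - (z + 1) = d - z" "1 + (z + 1) = 1 + z + 1" "b + (z + 1) = b + z + 1"
      by simp_all
    show "G (z + 1) = poly (pcompose q [:1, 1:] * [:b, 1:] * [:1, 1:]) z * gamma_weight b d z"
      unfolding G_def gamma_weight_def e Gamma_plus1[OF nonpos(3)] Gamma_plus1[OF nonpos(4)]
      by (simp add: poly_pcompose algebra_simps)
  qed
  ultimately show ?thesis by blast
qed

section \<open>Non-vanishing of the integral\<close>

definition weight_functional :: "complex \<Rightarrow> complex \<Rightarrow> (real \<Rightarrow> complex) \<Rightarrow> complex poly \<Rightarrow> complex" where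
  "weight_functional b d \<gamma> q = improper_contour_integral \<gamma> (\<lambda>z. poly q z * gamma_weight b d z)"

lemma has_integral_weight_functional:
  assumes "separating b d \<gamma>"
  shows "has_improper_contour_integral (\<lambda>z. poly q z * gamma_weight b d z) (weight_functional b d \<gamma> q) \<gamma>"
proof -
  obtain I where I: "has_improper_contour_integral (\<lambda>z. poly q z * gamma_weight b d z) I \<gamma>"
    using weight_integral_eq[OF assms assms, of q] by blast
  then show ?thesis
    unfolding weight_functional_def improper_contour_integral_unique[OF I] .
qed

lemma weight_functional_eqI:
  "has_improper_contour_integral (\<lambda>z. poly q z * gamma_weight b d z) I \<gamma> \<Longrightarrow> weight_functional b d \<gamma> q = I"
  unfolding weight_functional_def by (rule improper_contour_integral_unique)

lemma pearson_functional_weight_functional: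
  assumes "separating b d \<gamma>"
  shows "pearson_functional (weight_functional b d \<gamma>) b 1 d"
proof
  note has = has_integral_weight_functional[OF assms]
  show "weight_functional b d \<gamma> (p + q) = weight_functional b d \<gamma> p + weight_functional b d \<gamma> q" for p q
    using has_improper_contour_integral_add[OF has has, of p q]
    by (intro weight_functional_eqI) (simp add: distrib_right)
  show "weight_functional b d \<gamma> (smult c p) = c * weight_functional b d \<gamma> p" for c p
    using has_improper_contour_integral_lmul[OF has, of c p]
    by (intro weight_functional_eqI) (simp add: mult.assoc)
  show "weight_functional b d \<gamma> (q \<circ>\<^sub>p [:1, 1:] * [:b, 1:] * [:1, 1:]) =
         weight_functional b d \<gamma> (q * [:0, 1:] * [:- d, 1:])" for q
    using weight_integral_pearson[OF assms, of q] weight_functional_eqI by metis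
qed

text \<open>Raising a parameter creates no new poles, so the same contour keeps separating.\<close>

lemma separating_shift:
  assumes "separating b d \<gamma>"
  shows "separating (b + 1) d \<gamma>" "separating b (d + 1) \<gamma>"
proof -
  have "b + z \<in> \<int>\<^sub>\<le>\<^sub>0" if "b + 1 + z \<in> \<int>\<^sub>\<le>\<^sub>0" for z
    using nonpos_Ints_diff_1[OF that] by (simp add: algebra_simps)
  moreover have "d - z \<in> \<int>\<^sub>\<le>\<^sub>0" if "d + 1 - z \<in> \<int>\<^sub>\<le>\<^sub>0" for z
    using nonpos_Ints_diff_1[OF that] by (simp add: algebra_simps)
  ultimately show "separating (b + 1) d \<gamma>" "separating b (d + 1) \<gamma>"
    using assms unfolding separating_def by blast+
qed

lemma weight_functional_shift:
  assumes "separating b d \<gamma>"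
  shows "weight_functional (b + 1) d \<gamma> 1 = weight_functional b d \<gamma> [:b, 1:]"
    "weight_functional b (d + 1) \<gamma> 1 = weight_functional b d \<gamma> [:d, -1:]"
proof -
  note nonpos = separating_range[OF assms]
  show "weight_functional (b + 1) d \<gamma> 1 = weight_functional b d \<gamma> [:b, 1:]"
  proof (rule weight_functional_eqI, rule has_improper_contour_integral_cong[OF has_integral_weight_functional[OF assms]])
    fix z assume z: "z \<in> range \<gamma>"
    have e: "b + 1 + z = b + z + 1" by simp
    show "poly [:b, 1:] z * gamma_weight b d z = poly 1 z * gamma_weight (b + 1) d z"
      unfolding gamma_weight_def e Gamma_plus1[OF nonpos(4)[OF z]] by simp
  qed
  show "weight_functional b (d + 1) \<gamma> 1 = weight_functional b d \<gamma> [:d, -1:]"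
  proof (rule weight_functional_eqI, rule has_improper_contour_integral_cong[OF has_integral_weight_functional[OF assms]])
    fix z assume z: "z \<in> range \<gamma>"
    have e: "d + 1 - z = d - z + 1" by simp
    show "poly [:d, -1:] z * gamma_weight b d z = poly 1 z * gamma_weight b (d + 1) z"
      unfolding gamma_weight_def e Gamma_plus1[OF nonpos(2)[OF z]] by simp
  qed
qed

text \<open>If the mass vanished at (b, d), the moment recurrence would make the functional vanish
  on b + z and d - z, whose values are the masses at raised parameters. Raising first b and then d
  uses the recurrence with the factors b + d + 1 and b + d + 2.\<close>

lemma weight_functional_shift_nonzero:
  assumes "separating b d \<gamma>" and nz: "b + d + 1 \<noteq> 0" "b + d + 2 \<noteq> 0"
    and "weight_functional (b + 1) (d + 1) \<gamma> 1 \<noteq> 0"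
  shows "weight_functional b d \<gamma> 1 \<noteq> 0"
proof
  have lin0: "weight_functional b' d' \<gamma> [:b', 1:] = 0 \<and> weight_functional b' d' \<gamma> [:d', -1:] = 0"
    if "separating b' d' \<gamma>" "b' + d' + 1 \<noteq> 0" and z: "weight_functional b' d' \<gamma> 1 = 0" for b' d'
  proof -
    interpret pearson_functional "weight_functional b' d' \<gamma>" b' 1 d'
      using that(1) by (rule pearson_functional_weight_functional)
    have "M 0 1 = weight_functional b' d' \<gamma> [:b', 1:]" by (simp add: M_def)
    moreover have "(b' + 1 + d' - 1 + 1) * M 0 1 = 0"
      using M_right[of 1] that(2) z by (simp add: add_ac)
    moreover have "b' + 1 + d' - 1 + 1 \<noteq> 0" using that(2) by (simp add: add_ac)
    ultimately have 1: "weight_functional b' d' \<gamma> [:b', 1:] = 0" by simp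
    have "[:d', -1:] = smult (b' + d') 1 - [:b', 1:]" by (simp add: one_pCons)
    then have "weight_functional b' d' \<gamma> [:d', -1:] = (b' + d') * weight_functional b' d' \<gamma> 1 - weight_functional b' d' \<gamma> [:b', 1:]"
      by (simp only: L_diff L_smult)
    with 1 z show ?thesis by simp
  qed
  assume "weight_functional b d \<gamma> 1 = 0"
  then have "weight_functional (b + 1) d \<gamma> 1 = 0"
    using lin0[OF assms(1) nz(1)] weight_functional_shift[OF assms(1)] by simp
  then have "weight_functional (b + 1) (d + 1) \<gamma> 1 = 0"
    using lin0[OF separating_shift(1)[OF assms(1)]] weight_functional_shift(2)[OF separating_shift(1)[OF assms(1)]] nz(2)
    by (simp add: add_ac)
  with assms(4) show False by simp
qed

lemma separating_shift_of_nat: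
  "separating b d \<gamma> \<Longrightarrow> separating (b + of_nat n) (d + of_nat n) \<gamma>"
proof (induction n)
  case (Suc n)
  then show ?case using separating_shift(1)[OF separating_shift(2)[OF Suc.IH]] by (simp add: add_ac)
qed simp

lemma weight_functional_shift_of_nat_nonzero:
  assumes "separating b d \<gamma>" and nz: "\<And>m. m \<ge> 1 \<Longrightarrow> b + d + of_nat m \<noteq> 0"
    and "weight_functional (b + of_nat n) (d + of_nat n) \<gamma> 1 \<noteq> 0"
  shows "weight_functional b d \<gamma> 1 \<noteq> 0"
  using assms(3)
proof (induction n)
  case (Suc n)
  have e: "b + of_nat n + (d + of_nat n) + 1 = b + d + of_nat (2 * n + 1)"
    "b + of_nat n + (d + of_nat n) + 2 = b + d + of_nat (2 * n + 2)"
    "b + of_nat n + 1 = b + of_nat (Suc n)" "d + of_nat n + 1 = d + of_nat (Suc n)"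
    by simp_all
  have "weight_functional (b + of_nat n) (d + of_nat n) \<gamma> 1 \<noteq> 0"
  proof (rule weight_functional_shift_nonzero[OF separating_shift_of_nat[OF assms(1)]])
    show "weight_functional (b + of_nat n + 1) (d + of_nat n + 1) \<gamma> 1 \<noteq> 0"
      unfolding e by (rule Suc.prems)
  qed (unfold e, (rule nz, simp)+)
  then show ?case by (rule Suc.IH)
qed simp

lemma Re_nonpos_Ints: "(w :: complex) \<in> \<int>\<^sub>\<le>\<^sub>0 \<Longrightarrow> Re w \<le> 0"
  by (auto elim!: nonpos_Ints_cases)

text \<open>The line lies between the poles 0, 1, ... of Gamma (-z) and -1, -2, ... of Gamma (1 +
  z); the bounds on b and d put the poles -b - k and d + k on the proper sides. The open half-planes
  serve as connecting sets.\<close>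

lemma separating_vertical_line:
  assumes "Re b > 1 / 2" "Re d > - (1 / 2)"
  shows "separating b d (\<lambda>t. of_real (- (1 / 2)) + \<i> * of_real t)" (is "separating _ _ ?\<gamma>")
proof -
  have right: "right_of ?\<gamma> 1 z" if "Re z > - (1 / 2)" for z
    unfolding right_of_def
  proof (rule eventually_at_top_linorderI[of 0])
    fix x :: real assume "0 \<le> x"
    then show "connected_component (- range ?\<gamma>) z (of_real (1 * x))"
      using that unfolding connected_component_def
      by (intro exI[of _ "{z. Re z > - (1 / 2)}"])
         (auto intro: convex_connected convex_halfspace_Re_gt)
  qed
  have left: "right_of ?\<gamma> (- 1) z" if "Re z < - (1 / 2)" for z
    unfolding right_of_def
  proof (rule eventually_at_top_linorderI[of 1])
    fix x :: real assume "1 \<le> x"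
    then show "connected_component (- range ?\<gamma>) z (of_real ((- 1) * x))"
      using that unfolding connected_component_def
      by (intro exI[of _ "{z. Re z < - (1 / 2)}"])
         (auto intro: convex_connected convex_halfspace_Re_lt)
  qed
  show ?thesis unfolding separating_def
  proof (intro conjI allI impI imaginary_contour_vertical_line)
    fix z
    show "- z \<in> \<int>\<^sub>\<le>\<^sub>0 \<or> d - z \<in> \<int>\<^sub>\<le>\<^sub>0 \<Longrightarrow> right_of ?\<gamma> 1 z"
      using Re_nonpos_Ints[of "- z"] Re_nonpos_Ints[of "d - z"] assms by (intro right) auto
    show "1 + z \<in> \<int>\<^sub>\<le>\<^sub>0 \<or> b + z \<in> \<int>\<^sub>\<le>\<^sub>0 \<Longrightarrow> right_of ?\<gamma> (- 1) z"
      using Re_nonpos_Ints[of "1 + z"] Re_nonpos_Ints[of "b + z"] assms by (intro left) auto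
  qed
qed

section \<open>Integrals over the line Re z = -1/2\<close>

lemma integrable_exp_minus_abs: "(\<lambda>t :: real. exp (- \<bar>t\<bar>)) integrable_on UNIV"
proof -
  have 1: "(\<lambda>t :: real. exp (- t)) integrable_on {0..}"
    using integrable_on_exp_minus_to_infinity[of 1 0] by simp
  then have "(\<lambda>t :: real. exp (- t)) absolutely_integrable_on {0..}"
    by (intro nonnegative_absolutely_integrable_1) auto
  then have "(\<lambda>t :: real. exp t) absolutely_integrable_on {..0}"
    using has_absolute_integral_reflect_real[of "{0..}" "{..0}" exp] by auto
  then have 2: "(\<lambda>t :: real. exp t) integrable_on {..0}" by (simp add: absolutely_integrable_on_def)
  have "(\<lambda>t :: real. exp (- \<bar>t\<bar>)) integrable_on {0..}"
    by (rule integrable_eq[OF 1]) simp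
  moreover have "(\<lambda>t :: real. exp (- \<bar>t\<bar>)) integrable_on {..0}"
    by (rule integrable_eq[OF 2]) simp
  moreover have "negligible ({0..} \<inter> {..0 :: real})"
    by (rule negligible_subset[of "{0}"]) auto
  ultimately show ?thesis
    by (rule integrable_Un') auto
qed

text \<open>The limit is taken along symmetric cutoffs, where dominated convergence applies; the
  factor i is dz/dt.\<close>

lemma improper_contour_integral_vertical_line:
  assumes I: "has_improper_contour_integral F I (\<lambda>t. of_real c + \<i> * of_real t)"
    and cont: "continuous_on UNIV (\<lambda>t. F (Complex c t))"
    and bound: "\<And>t. norm (F (Complex c t)) \<le> K * exp (- \<bar>t\<bar>)"
  shows "I = \<i> * integral UNIV (\<lambda>t. F (Complex c t))"
proof -
  let ?\<phi> = "\<lambda>t. F (Complex c t)"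
  define f where "f k t = (if t \<in> {- real k..real k} then ?\<phi> t else 0)" for k t
  have int: "f k integrable_on UNIV" for k
    unfolding f_def integrable_restrict_UNIV
    by (intro integrable_continuous_real continuous_on_subset[OF cont]) auto
  have h: "(\<lambda>t. K * exp (- \<bar>t\<bar>)) integrable_on UNIV"
    using integrable_cmul[OF integrable_exp_minus_abs, of K] by simp
  have "K * exp (- \<bar>0\<bar>) \<ge> 0" by (rule order_trans[OF norm_ge_zero bound])
  then have le: "norm (f k t) \<le> K * exp (- \<bar>t\<bar>)" for k t
    using bound[of t] by (auto simp: f_def)
  have conv: "(\<lambda>k. f k t) \<longlonglongrightarrow> ?\<phi> t" for t
  proof (rule tendsto_eventually)
    have "f k t = ?\<phi> t" if "k \<ge> nat \<lceil>\<bar>t\<bar>\<rceil>" for k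
    proof -
      have "\<bar>t\<bar> \<le> real k" using that by linarith
      then show ?thesis by (auto simp: f_def)
    qed
    then show "\<forall>\<^sub>F k in sequentially. f k t = ?\<phi> t" unfolding eventually_sequentially by blast
  qed
  note dc = dominated_convergence[OF int h le conv]
  have lim: "(\<lambda>k. \<i> * integral UNIV (f k)) \<longlonglongrightarrow> \<i> * integral UNIV ?\<phi>"
    by (intro tendsto_intros dc(2))
  have "((\<lambda>k. case (- real k, real k) of (a, b) \<Rightarrow>
      contour_integral (subpath a b (\<lambda>t. of_real c + \<i> * of_real t)) F) \<longlongrightarrow> I) sequentially"
    using I unfolding has_improper_contour_integral_def
    by (elim conjE filterlim_compose)
       (intro filterlim_Pair filterlim_real_sequentially
         filterlim_compose[OF filterlim_uminus_at_bot_at_top filterlim_real_sequentially])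
  moreover have "\<forall>\<^sub>F k in sequentially. (case (- real k, real k) of (a, b) \<Rightarrow>
      contour_integral (subpath a b (\<lambda>t. of_real c + \<i> * of_real t)) F) = \<i> * integral UNIV (f k)"
    using eventually_gt_at_top[of 0]
  proof eventually_elim
    case (elim k)
    have "subpath (- real k) (real k) (\<lambda>t. of_real c + \<i> * of_real t) = linepath (Complex c (- real k)) (Complex c (real k))"
      by (rule ext) (simp add: subpath_def linepath_def complex_eq_iff algebra_simps)
    moreover have "f k = (\<lambda>t. if t \<in> {- real k..real k} then ?\<phi> t else 0)"
      by (rule ext) (simp only: f_def)
    then have "integral UNIV (f k) = integral {- real k..real k} ?\<phi>"
      by (simp only: integral_restrict_UNIV)
    ultimately show ?case
      using elim by (simp add: contour_integral_linepath_same_Re[of _ c _ "- real k" "real k"])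
  qed
  ultimately have "(\<lambda>k. \<i> * integral UNIV (f k)) \<longlonglongrightarrow> I" by (rule Lim_transform_eventually)
  with lim show "I = \<i> * integral UNIV ?\<phi>" by (rule LIMSEQ_unique[rotated])
qed

text \<open>This is Gamma (z + n + 1) / (n! n^z), which equals
  \<open>Gamma z / Gamma_series z n\<close> where z is no pole. It is polymorphic because the real
  version bounds the complex one.\<close>

definition gamma_ratio :: "'a :: Gamma \<Rightarrow> nat \<Rightarrow> 'a" where
  "gamma_ratio z n = Gamma (z + of_nat (Suc n)) / (fact n * exp (z * of_real (ln (of_nat n))))"

lemma gamma_ratio_tendsto_1:
  assumes "z \<notin> \<int>\<^sub>\<le>\<^sub>0"
  shows "gamma_ratio z \<longlonglongrightarrow> 1"
proof -
  have "(\<lambda>n. Gamma z / Gamma_series z n) \<longlonglongrightarrow> Gamma z / Gamma z"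
    using Gamma_nonzero[OF assms] by (intro tendsto_intros Gamma_series_LIMSEQ)
  moreover have "Gamma z / Gamma_series z n = gamma_ratio z n" for n
    using pochhammer_Gamma[OF assms, of "Suc n"] Gamma_nonzero[OF assms]
    by (simp add: Gamma_series_def gamma_ratio_def)
  ultimately show ?thesis using Gamma_nonzero[OF assms] by (simp add: fun_eq_iff)
qed

lemma norm_gamma_ratio_le:
  fixes z :: complex
  assumes "Re z > 0"
  shows "norm (gamma_ratio z n) \<le> gamma_ratio (Re z) n"
proof -
  have "norm (gamma_ratio z n) = norm (Gamma (z + of_nat (Suc n))) / (fact n * exp (Re z * ln (real n)))"
    by (simp add: gamma_ratio_def norm_divide norm_mult)
  also have "\<dots> \<le> Gamma (Re (z + of_nat (Suc n))) / (fact n * exp (Re z * ln (real n)))"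
    using assms by (intro divide_right_mono norm_Gamma_complex_le) auto
  finally show ?thesis by (simp add: gamma_ratio_def)
qed

text \<open>On a vertical line the ratio is dominated by its value at the real point, where the
  sequence converges. One bound thus serves all heights and all n, as dominated convergence
  requires.\<close>

lemma gamma_ratio_bounded:
  assumes "x > (0 :: real)"
  shows "\<exists>B>0. \<forall>z n. Re z = x \<longrightarrow> norm (gamma_ratio z n) \<le> B"
proof -
  have "x \<notin> \<int>\<^sub>\<le>\<^sub>0" using assms by (auto elim!: nonpos_Ints_cases)
  from convergent_imp_Bseq[OF convergentI[OF gamma_ratio_tendsto_1[OF this]]]
  obtain B where B: "B > 0" "\<And>n. norm (gamma_ratio x n) \<le> B" by (auto simp: Bseq_def)
  have "norm (gamma_ratio z n) \<le> B" if "Re z = x" for z n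
    using norm_gamma_ratio_le[of z n] B(2)[of n] that assms by auto
  with B show ?thesis by blast
qed


lemma gamma_reflected_critical_line:
  "Gamma (1 / 2 - \<i> * of_real t) * Gamma (1 / 2 + \<i> * of_real t)
     = of_real ((norm (Gamma (1 / 2 + \<i> * of_real t)))\<^sup>2)"
proof -
  have "1 / 2 - \<i> * of_real t = cnj (1 / 2 + \<i> * of_real t)" by (simp add: complex_eq_iff)
  then have "Gamma (1 / 2 - \<i> * of_real t) = cnj (Gamma (1 / 2 + \<i> * of_real t))"
    by (simp only: cnj_Gamma)
  then show ?thesis by (simp only: complex_norm_square mult.commute)
qed

lemma gamma_reflected_critical_line_bound:
  "\<exists>K>0. \<forall>t :: real. (norm (Gamma (1 / 2 + \<i> * of_real t)))\<^sup>2 \<le> K * exp (- \<bar>t\<bar>)"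
proof -
  define g where "g = (Gamma (1 / 2 :: real))\<^sup>2"
  have "(norm (Gamma (1 / 2 + \<i> * of_real t)))\<^sup>2 \<le> (4 * pi + g * exp 1) * exp (- \<bar>t\<bar>)" for t :: real
  proof (cases "\<bar>t\<bar> \<ge> 1")
    case True
    define z where "z = - (1 / 2) + \<i> * complex_of_real t"
    have z: "- z = 1 / 2 - \<i> * of_real t" "1 + z = 1 / 2 + \<i> * of_real t" "Im z = t"
      by (simp_all add: z_def complex_eq_iff)
    have "(norm (Gamma (1 / 2 + \<i> * of_real t)))\<^sup>2 = norm (Gamma (- z) * Gamma (1 + z))"
      unfolding z gamma_reflected_critical_line norm_of_real by simp
    also have "\<dots> \<le> 4 * pi * exp (- pi * \<bar>t\<bar>)" using Gamma_reflected_bound[of z] True by (simp add: z)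
    also have "\<dots> \<le> 4 * pi * exp (- \<bar>t\<bar>)"
    proof -
      have "1 * \<bar>t\<bar> \<le> pi * \<bar>t\<bar>" using pi_gt3 by (intro mult_right_mono) auto
      then show ?thesis by simp
    qed
    also have "\<dots> \<le> (4 * pi + g * exp 1) * exp (- \<bar>t\<bar>)"
      by (intro mult_right_mono) (auto simp: g_def)
    finally show ?thesis .
  next
    case False
    have "norm (Gamma (1 / 2 + \<i> * of_real t)) \<le> Gamma (1 / 2)"
      using norm_Gamma_complex_le[of "1 / 2 + \<i> * of_real t"] by simp
    then have "(norm (Gamma (1 / 2 + \<i> * of_real t)))\<^sup>2 \<le> g * 1"
      by (simp add: g_def power_mono)
    also have "1 \<le> exp (1 + - \<bar>t\<bar>)" using False by simp
    then have "g * 1 \<le> g * exp (1 + - \<bar>t\<bar>)" by (intro mult_left_mono) (auto simp: g_def)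
    also have "\<dots> = g * exp 1 * exp (- \<bar>t\<bar>)" by (simp only: exp_add mult.assoc)
    also have "\<dots> \<le> (4 * pi + g * exp 1) * exp (- \<bar>t\<bar>)"
      by (intro mult_right_mono) auto
    finally show ?thesis .
  qed
  moreover have "4 * pi + g * exp 1 > 0" by (intro add_pos_nonneg) (auto simp: g_def)
  ultimately show ?thesis by blast
qed

text \<open>The powers of n in the two ratios have exponents b - 1/2 + i t and d + 1/2 - i t, whose
  sum is free of t. So (n!)^2 n^(b+d) comes out of the integral.\<close>

lemma gamma_weight_critical_line:
  assumes "Re b > 1 / 2" "Re d > - (1 / 2)"
  shows "gamma_weight (b + of_nat (Suc n)) (d + of_nat (Suc n)) (Complex (- (1 / 2)) t)
     = (fact n)\<^sup>2 * exp ((b + d) * of_real (ln (of_nat n))) *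
       (of_real ((norm (Gamma (1 / 2 + \<i> * of_real t)))\<^sup>2)
         * gamma_ratio (b - 1 / 2 + \<i> * of_real t) n * gamma_ratio (d + 1 / 2 - \<i> * of_real t) n)"
proof -
  define z where "z = Complex (- (1 / 2)) t"
  have z: "- z = 1 / 2 - \<i> * of_real t" "1 + z = 1 / 2 + \<i> * of_real t"
    by (simp_all add: z_def complex_eq_iff)
  have e: "b + of_nat (Suc n) + z = (b - 1 / 2 + \<i> * of_real t) + of_nat (Suc n)"
    "d + of_nat (Suc n) - z = (d + 1 / 2 - \<i> * of_real t) + of_nat (Suc n)"
    by (simp_all add: z_def complex_eq_iff)
  have G: "Gamma (w + of_nat (Suc n)) = fact n * exp (w * of_real (ln (of_nat n))) * gamma_ratio w n" for w :: complex
    by (simp add: gamma_ratio_def)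
  have "exp ((b + d) * of_real (ln (of_nat n))) = exp ((b - 1 / 2 + \<i> * of_real t) * of_real (ln (of_nat n)))
      * exp ((d + 1 / 2 - \<i> * of_real t) * of_real (ln (of_nat n)))"
    unfolding exp_add[symmetric] distrib_right[symmetric] by simp
  moreover have "gamma_weight (b + of_nat (Suc n)) (d + of_nat (Suc n)) z
     = (Gamma (- z) * Gamma (1 + z)) * Gamma (b + of_nat (Suc n) + z) * Gamma (d + of_nat (Suc n) - z)"
    unfolding gamma_weight_def by (simp only: mult_ac)
  ultimately show ?thesis
    unfolding z_def[symmetric] e G by (simp only: z gamma_reflected_critical_line power2_eq_square mult_ac)
qed

text \<open>After normalisation the integrands on the line \<open>Re z = -1/2\<close> tend to
  \<open>\<bar>\<Gamma>(1/2 + i t)\<bar>\<^sup>2 = \<pi> / cosh (\<pi> t)\<close>, whose integral is positive.\<close>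

lemma critical_line_integral:
  assumes "Re b > 1 / 2" "Re d > - (1 / 2)"
  shows "\<forall>\<^sub>F n in sequentially.
     integral UNIV (\<lambda>t. gamma_weight (b + of_nat (Suc n)) (d + of_nat (Suc n)) (Complex (- (1 / 2)) t)) \<noteq> 0"
    (is "\<forall>\<^sub>F n in _. integral UNIV (?g n) \<noteq> 0")
    "\<exists>K. \<forall>t. norm (gamma_weight (b + of_nat (Suc n)) (d + of_nat (Suc n)) (Complex (- (1 / 2)) t)) \<le> K * exp (- \<bar>t\<bar>)"
    "continuous_on UNIV (\<lambda>t. gamma_weight (b + of_nat (Suc n)) (d + of_nat (Suc n)) (Complex (- (1 / 2)) t))"
proof -
  define w where "w t = (norm (Gamma (1 / 2 + \<i> * of_real t)))\<^sup>2" for t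
  define D where "D n = (fact n)\<^sup>2 * exp ((b + d) * complex_of_real (ln (of_nat n)))" for n
  define f where "f n t = of_real (w t) * gamma_ratio (b - 1 / 2 + \<i> * of_real t) n
      * gamma_ratio (d + 1 / 2 - \<i> * of_real t) n" for n t
  have D: "D n \<noteq> 0" for n by (simp add: D_def)
  have g: "?g n = (\<lambda>t. D n * f n t)" for n
    unfolding gamma_weight_critical_line[OF assms] D_def f_def w_def ..
  obtain K where K: "K > 0" "\<And>t. w t \<le> K * exp (- \<bar>t\<bar>)"
    using gamma_reflected_critical_line_bound unfolding w_def by blast
  obtain B1 where B1: "B1 > 0" "\<And>z n. Re z = Re b - 1 / 2 \<Longrightarrow> norm (gamma_ratio z n) \<le> B1"
    using gamma_ratio_bounded[of "Re b - 1 / 2"] assms by auto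
  obtain B2 where B2: "B2 > 0" "\<And>z n. Re z = Re d + 1 / 2 \<Longrightarrow> norm (gamma_ratio z n) \<le> B2"
    using gamma_ratio_bounded[of "Re d + 1 / 2"] assms by auto
  have f_le: "norm (f n t) \<le> K * B1 * B2 * exp (- \<bar>t\<bar>)" for n t
  proof -
    have "norm (f n t) = w t * norm (gamma_ratio (b - 1 / 2 + \<i> * of_real t) n)
        * norm (gamma_ratio (d + 1 / 2 - \<i> * of_real t) n)"
      by (simp add: f_def norm_mult w_def norm_power)
    also have "\<dots> \<le> (K * exp (- \<bar>t\<bar>)) * B1 * B2"
      using K B1 B2 by (intro mult_mono B1 B2 K) (auto simp: w_def)
    finally show ?thesis by (simp add: mult_ac)
  qed
  have Gcont: "continuous_on UNIV (\<lambda>t. Gamma (a + s * \<i> * complex_of_real t))"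
    if "Re a > 0" "Im s = 0" for a s
  proof (rule continuous_on_compose2[of "- \<int>\<^sub>\<le>\<^sub>0" Gamma])
    show "continuous_on (- \<int>\<^sub>\<le>\<^sub>0) (Gamma :: complex \<Rightarrow> complex)" by (intro continuous_on_Gamma) auto
    show "continuous_on UNIV (\<lambda>t. a + s * \<i> * complex_of_real t)" by (intro continuous_intros)
    have "a + s * \<i> * complex_of_real t \<notin> \<int>\<^sub>\<le>\<^sub>0" for t
    proof
      assume "a + s * \<i> * complex_of_real t \<in> \<int>\<^sub>\<le>\<^sub>0"
      then have "Re (a + s * \<i> * complex_of_real t) \<le> 0" by (rule Re_nonpos_Ints)
      then show False using that by simp
    qed
    then show "(\<lambda>t. a + s * \<i> * complex_of_real t) ` UNIV \<subseteq> - \<int>\<^sub>\<le>\<^sub>0" by blast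
  qed
  have cont: "continuous_on UNIV (f n)" for n
  proof -
    have 1: "continuous_on UNIV (\<lambda>t. Gamma (1 / 2 + \<i> * complex_of_real t))"
      using Gcont[of "1 / 2" 1] by simp
    have 2: "continuous_on UNIV (\<lambda>t. Gamma (b - 1 / 2 + \<i> * complex_of_real t + of_nat (Suc n)))"
      using Gcont[of "b - 1 / 2 + of_nat (Suc n)" 1] assms by (simp add: add_ac)
    have 3: "continuous_on UNIV (\<lambda>t. Gamma (d + 1 / 2 - \<i> * complex_of_real t + of_nat (Suc n)))"
      using Gcont[of "d + 1 / 2 + of_nat (Suc n)" "-1"] assms by (simp add: algebra_simps)
    show ?thesis unfolding f_def w_def gamma_ratio_def
      by (intro continuous_intros 1 2 3) auto
  qed
  show "continuous_on UNIV (?g n)" unfolding g by (intro continuous_intros cont)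
  show "\<exists>K. \<forall>t. norm (?g n t) \<le> K * exp (- \<bar>t\<bar>)"
  proof (intro exI allI)
    fix t
    have "norm (?g n t) = norm (D n) * norm (f n t)"
      using fun_cong[OF g[of n], of t] by (simp only: norm_mult)
    also have "\<dots> \<le> norm (D n) * (K * B1 * B2 * exp (- \<bar>t\<bar>))" by (intro mult_left_mono f_le) auto
    finally show "norm (?g n t) \<le> (norm (D n) * (K * B1 * B2)) * exp (- \<bar>t\<bar>)" by (simp add: mult_ac)
  qed
  have h: "(\<lambda>t. C * exp (- \<bar>t\<bar>)) integrable_on UNIV" for C :: real
    using integrable_cmul[OF integrable_exp_minus_abs, of C] by simp
  have int: "f n integrable_on UNIV" for n
  proof (rule integrable_on_all_intervals_integrable_bound[OF _ _ h])
    show "(\<lambda>t. if t \<in> UNIV then f n t else 0) integrable_on cbox a c" for a c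
      using integrable_continuous[OF continuous_on_subset[OF cont[of n] subset_UNIV], of a c] by simp
    show "norm (f n t) \<le> K * B1 * B2 * exp (- \<bar>t\<bar>)" for t by (rule f_le)
  qed
  have conv: "(\<lambda>n. f n t) \<longlonglongrightarrow> complex_of_real (w t)" for t
  proof -
    have "z \<notin> \<int>\<^sub>\<le>\<^sub>0" if "Re z > 0" for z :: complex using that Re_nonpos_Ints[of z] by auto
    then have "(\<lambda>n. f n t) \<longlonglongrightarrow> of_real (w t) * 1 * 1"
      unfolding f_def using assms by (intro tendsto_intros gamma_ratio_tendsto_1) auto
    then show ?thesis by simp
  qed
  note dc = dominated_convergence[OF int h f_le conv]
  have wcont: "continuous_on UNIV w"
    unfolding w_def using Gcont[of "1 / 2" 1] by (intro continuous_intros) simp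
  have wpos: "w t > 0" for t
  proof -
    have "1 / 2 + \<i> * complex_of_real t \<notin> \<int>\<^sub>\<le>\<^sub>0"
      using Re_nonpos_Ints[of "1 / 2 + \<i> * complex_of_real t"] by auto
    then show ?thesis using Gamma_nonzero by (simp add: w_def)
  qed
  have wint: "w integrable_on UNIV"
  proof (rule integrable_on_all_intervals_integrable_bound[OF _ _ h[of K]])
    show "(\<lambda>t. if t \<in> UNIV then w t else 0) integrable_on cbox a c" for a c
      using integrable_continuous[OF continuous_on_subset[OF wcont subset_UNIV], of a c] by simp
    show "norm (w t) \<le> K * exp (- \<bar>t\<bar>)" for t using K(2)[of t] wpos[of t] by simp
  qed
  have "integral UNIV (\<lambda>t. complex_of_real (w t)) = of_real (integral UNIV w)"
    using integral_linear[OF wint bounded_linear_of_real] by (simp add: o_def)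
  moreover have "0 < integral UNIV w"
  proof -
    have w01: "w integrable_on {0..1}"
      using integrable_continuous_real[OF continuous_on_subset[OF wcont subset_UNIV]] .
    have "0 < integral {0..1} w"
      using integral_eq_0_iff[OF continuous_on_subset[OF wcont subset_UNIV], of 0 1] wpos
        integral_nonneg[OF w01] by (force simp: less_le)
    also have "\<dots> \<le> integral UNIV w"
      by (rule integral_subset_le) (use wpos wint w01 in \<open>auto intro: less_imp_le\<close>)
    finally show ?thesis .
  qed
  ultimately have "integral UNIV (\<lambda>t. complex_of_real (w t)) \<noteq> 0" by simp
  then have "\<forall>\<^sub>F n in sequentially. integral UNIV (f n) \<noteq> 0"
    using tendsto_imp_eventually_ne[OF dc(2)] by blast
  then show "\<forall>\<^sub>F n in sequentially. integral UNIV (?g n) \<noteq> 0"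
    unfolding g by (rule eventually_mono) (use D in simp)
qed

text \<open>Both parameters are raised by m until the line Re z = -1/2 separates, then by n + 1
  until the asymptotics force a nonzero integral. Only at these large parameters is the given
  contour exchanged for the line, since for the original ones the line may pass poles on the wrong
  side.\<close>

lemma weight_functional_1_nonzero:
  assumes sep: "separating b d \<gamma>" and nz: "\<And>m. m \<ge> 1 \<Longrightarrow> b + d + of_nat m \<noteq> 0"
  shows "weight_functional b d \<gamma> 1 \<noteq> 0"
proof -
  define m where "m = nat \<lceil>max (1 - Re b) (1 - Re d)\<rceil>"
  define b' where "b' = b + of_nat m"
  define d' where "d' = d + of_nat m"
  have re: "Re b' > 1 / 2" "Re d' > - (1 / 2)" unfolding b'_def d'_def m_def by simp_all linarith+
  obtain n where n: "integral UNIV (\<lambda>t. gamma_weight (b' + of_nat (Suc n)) (d' + of_nat (Suc n)) (Complex (- (1 / 2)) t)) \<noteq> 0"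
    using eventually_happens'[OF sequentially_bot critical_line_integral(1)[OF re]] by blast
  define b2 where "b2 = b' + of_nat (Suc n)"
  define d2 where "d2 = d' + of_nat (Suc n)"
  have b2: "b2 = b + of_nat (m + Suc n)" "d2 = d + of_nat (m + Suc n)"
    by (simp_all add: b2_def d2_def b'_def d'_def)
  have sep2: "separating b2 d2 \<gamma>" unfolding b2 by (rule separating_shift_of_nat[OF sep])
  have line: "separating b2 d2 (\<lambda>t. of_real (- (1 / 2)) + \<i> * of_real t)"
    using re by (intro separating_vertical_line) (auto simp: b2_def d2_def)
  obtain I where I: "has_improper_contour_integral (\<lambda>z. poly 1 z * gamma_weight b2 d2 z) I \<gamma>"
    "has_improper_contour_integral (\<lambda>z. poly 1 z * gamma_weight b2 d2 z) I (\<lambda>t. of_real (- (1 / 2)) + \<i> * of_real t)"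
    using weight_integral_eq[OF sep2 line, of 1] by blast
  obtain K where K: "\<And>t. norm (gamma_weight b2 d2 (Complex (- (1 / 2)) t)) \<le> K * exp (- \<bar>t\<bar>)"
    using critical_line_integral(2)[OF re, of n] unfolding b2_def d2_def by blast
  have "I = \<i> * integral UNIV (\<lambda>t. poly 1 (Complex (- (1 / 2)) t) * gamma_weight b2 d2 (Complex (- (1 / 2)) t))"
    using I(2)
  proof (rule improper_contour_integral_vertical_line)
    show "continuous_on UNIV (\<lambda>t. poly 1 (Complex (- (1 / 2)) t) * gamma_weight b2 d2 (Complex (- (1 / 2)) t))"
      using critical_line_integral(3)[OF re, of n] by (simp add: b2_def d2_def)
    show "norm (poly 1 (Complex (- (1 / 2)) t) * gamma_weight b2 d2 (Complex (- (1 / 2)) t)) \<le> K * exp (- \<bar>t\<bar>)" for t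
      using K by simp
  qed
  then have "I \<noteq> 0" using n unfolding b2_def d2_def by simp
  then have "weight_functional b2 d2 \<gamma> 1 \<noteq> 0" using weight_functional_eqI[OF I(1)] by simp
  then show ?thesis
    unfolding b2 using weight_functional_shift_of_nat_nonzero[OF sep nz, of "m + Suc n"] by blast
qed

section \<open>The Sobolev form\<close>

text \<open>For j = 0 this says that k differences annihilate every polynomial of degree below k.
  The alternative q = 0 is carried along because the zero polynomial has degree 0.\<close>

lemma poly_diff_funpow_degree:
  "q = 0 \<or> degree q < k + j \<Longrightarrow> (poly_diff ^^ k) q = 0 \<or> degree ((poly_diff ^^ k) q) < j"
proof (induction k arbitrary: q)
  case (Suc k)
  have "poly_diff q = 0 \<or> degree (poly_diff q) < k + j"
  proof (cases "degree q = 0")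
    case True
    then obtain a where "q = [:a:]" by (rule degree_eq_zeroE)
    then show ?thesis by (simp add: poly_diff_def)
  next
    case False
    then show ?thesis using degree_poly_diff_less[of q] Suc.prems by auto
  qed
  then have "(poly_diff ^^ k) (poly_diff q) = 0 \<or> degree ((poly_diff ^^ k) (poly_diff q)) < j"
    by (rule Suc.IH)
  then show ?case by (simp only: funpow_Suc_right o_apply)
qed simp

section \<open>Orthogonal sequences of a symmetric bilinear form\<close>

lemma degree_diff_monic_less:
  assumes "monic_of_degree n p" "monic_of_degree n q"
  shows "p - q = 0 \<or> degree (p - q) < n"
proof -
  have "degree (p - q) \<le> n" using assms by (intro degree_diff_le) (auto simp: monic_of_degree_def)
  moreover have "coeff (p - q) n = 0" using assms by (auto simp: monic_of_degree_def)
  ultimately show ?thesis by (metis leading_coeff_0_iff le_neq_implies_less)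
qed

lemma symmetric_bilinear_sum:
  assumes "symmetric_bilinear B"
  shows "B f (\<Sum>i\<in>I. smult (c i) (g i)) = (\<Sum>i\<in>I. c i * B f (g i))"
proof -
  have *: "B x y = B y x" "B (x + y) z = B x z + B y z" "B (smult a x) z = a * B x z" for x y z a
    using assms by (auto simp: symmetric_bilinear_def)
  have "B 0 f = 0" using *(3)[of 0 0 f] by simp
  then have "B (\<Sum>i\<in>I. smult (c i) (g i)) f = (\<Sum>i\<in>I. c i * B (g i) f)"
    by (induction I rule: infinite_finite_induct) (simp_all add: *(2,3))
  then show ?thesis by (simp only: *(1)[of f])
qed

text \<open>The form need not be definite, so uniqueness cannot come from \<open>B R R\<close>.
  Instead a nonzero R = P - p n, of degree r < n, would be orthogonal to p r, while its leading term
  makes \<open>B R (p r)\<close> a nonzero multiple of \<open>B (p r) (p r)\<close>.\<close>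

lemma monic_OPS_characterization:
  assumes B: "symmetric_bilinear B"
    and monic: "\<And>n. monic_of_degree n (p n)"
    and orth: "\<And>n q. q = 0 \<or> degree q < n \<Longrightarrow> B (p n) q = 0"
    and norm: "\<And>n. B (p n) (p n) \<noteq> 0"
  shows "monic_OPS B p"
    "monic_of_degree n P \<and> (\<forall>m<n. B P (monom 1 m) = 0) \<longleftrightarrow> P = p n"
proof -
  have lin: "B x y = B y x" "B (x + y) z = B x z + B y z" "B (smult a x) z = a * B x z" for x y z a
    using B by (auto simp: symmetric_bilinear_def)
  have deg: "degree (p n) = n" for n using monic by (auto simp: monic_of_degree_def)
  have "B (p n) (p m) = 0" if "m \<noteq> n" for n m
  proof (cases "m < n")
    case True
    then show ?thesis by (intro orth) (simp add: deg)
  next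
    case False
    then have "B (p m) (p n) = 0" using that by (intro orth) (simp add: deg)
    then show ?thesis using lin(1) by metis
  qed
  then show "monic_OPS B p" using monic norm by (simp add: monic_OPS_def)
  show "monic_of_degree n P \<and> (\<forall>m<n. B P (monom 1 m) = 0) \<longleftrightarrow> P = p n"
  proof
    assume "P = p n"
    then show "monic_of_degree n P \<and> (\<forall>m<n. B P (monom 1 m) = 0)"
      using monic orth by (simp add: degree_monom_eq)
  next
    assume P: "monic_of_degree n P \<and> (\<forall>m<n. B P (monom 1 m) = 0)"
    define R where "R = P - p n"
    have R: "R = 0 \<or> degree R < n"
      unfolding R_def using P monic by (intro degree_diff_monic_less) auto
    have "B R (monom 1 m) = 0" if "m < n" for m
    proof -
      have "B P (monom 1 m) = B (R + p n) (monom 1 m)" by (simp add: R_def)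
      also have "\<dots> = B R (monom 1 m)" using orth[of "monom 1 m" n] that by (simp add: lin(2) degree_monom_eq)
      finally show ?thesis using P that by simp
    qed
    then have BR: "B R q = 0" if "degree q < n" for q
    proof -
      have "(\<Sum>i\<le>degree q. smult (coeff q i) (monom 1 i)) = q"
        using poly_as_sum_of_monoms[of q] by (simp add: smult_monom)
      then have "B R q = B R (\<Sum>i\<le>degree q. smult (coeff q i) (monom 1 i))" by (simp only:)
      also have "\<dots> = (\<Sum>i\<le>degree q. coeff q i * B R (monom 1 i))"
        by (rule symmetric_bilinear_sum[OF B])
      also have "\<dots> = 0" using that \<open>\<And>m. m < n \<Longrightarrow> B R (monom 1 m) = 0\<close> by (intro sum.neutral) auto
      finally show ?thesis .
    qed
    have "R = 0"
    proof (rule ccontr)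
      assume "R \<noteq> 0"
      define r where "r = degree R"
      define a where "a = lead_coeff R"
      have a: "a \<noteq> 0" using \<open>R \<noteq> 0\<close> by (simp add: a_def)
      define Q where "Q = smult (inverse a) R"
      have "monic_of_degree r Q" using a by (simp add: monic_of_degree_def Q_def r_def a_def)
      then have "Q - p r = 0 \<or> degree (Q - p r) < r"
        by (rule degree_diff_monic_less) (rule monic)
      then have "B (p r) (Q - p r) = 0" by (rule orth)
      moreover have "B Q (p r) = B (Q - p r) (p r) + B (p r) (p r)"
        using lin(2)[of "Q - p r" "p r" "p r"] by simp
      moreover have "B Q (p r) = inverse a * B R (p r)" by (simp only: Q_def lin(3))
      moreover have "B R (p r) = 0" using R \<open>R \<noteq> 0\<close> by (intro BR) (simp add: deg r_def)
      ultimately show False using norm[of r] lin(1)[of "p r" "Q - p r"] by simp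
    qed
    then show "P = p n" by (simp add: R_def)
  qed
qed

section \<open>The discrete functional\<close>

lemma Gamma_lead_minus_of_nat: "Gamma_lead (- of_nat n) = (-1) ^ n / fact n"
  by (simp add: Gamma_lead_def Gamma_residue)

lemma Gamma_lead_nonzero: "Gamma_lead z \<noteq> 0"
proof (cases "z \<in> \<int>\<^sub>\<le>\<^sub>0")
  case True
  then obtain n where "z = - of_nat n" by (auto elim: nonpos_Ints_cases')
  then show ?thesis by (simp add: Gamma_lead_minus_of_nat)
qed (simp add: Gamma_lead_def Gamma_nonzero)

text \<open>The residues (-1)^m / m! obey the functional equation of Gamma among themselves. At z =
  0 the step would lead from a residue to an ordinary value, and the equation fails.\<close>

lemma Gamma_lead_plus1:
  assumes "z \<noteq> 0"
  shows "Gamma_lead (z + 1) = z * Gamma_lead z"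
proof (cases "z \<in> \<int>\<^sub>\<le>\<^sub>0")
  case True
  then obtain n where n: "z = - of_nat n" by (auto elim: nonpos_Ints_cases')
  with assms obtain m where m: "n = Suc m" by (cases n) auto
  have e: "z + 1 = - of_nat m" by (simp add: n m)
  show ?thesis unfolding e unfolding n Gamma_lead_minus_of_nat m
    by (simp add: field_simps del: of_nat_Suc)
next
  case False
  then have "z + 1 \<notin> \<int>\<^sub>\<le>\<^sub>0" using nonpos_Ints_diff_1[of "z + 1"] by auto
  with False show ?thesis by (simp add: Gamma_lead_def Gamma_plus1)
qed

definition discrete_functional :: "nat \<Rightarrow> complex \<Rightarrow> complex \<Rightarrow> complex poly \<Rightarrow> complex" where
  "discrete_functional N \<alpha> \<beta> q = (\<Sum>x = 0..N. poly q (of_nat x) * hahn_rho N \<alpha> \<beta> x)"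

text \<open>The first two conditions keep the steps of both Gamma factors away from the argument 0.
  They admit \<alpha> = -N-1 and \<beta> = -N-1, where all values of the corresponding factor are
  residues.\<close>

lemma hahn_rho_pearson:
  assumes "\<alpha> + of_nat (Suc x) \<noteq> 0" "\<beta> + of_nat (N - x) \<noteq> 0" "x < N"
  shows "(\<alpha> + of_nat (Suc x)) * of_nat (N - x) * hahn_rho N \<alpha> \<beta> x
       = (\<beta> + of_nat (N - x)) * of_nat (Suc x) * hahn_rho N \<alpha> \<beta> (Suc x)"
proof -
  have Nx: "complex_of_nat (N - x) = of_nat N - of_nat x" using assms by (simp add: of_nat_diff)
  have e: "\<beta> + of_nat N + 1 - of_nat x = (\<beta> + of_nat (N - x)) + 1"
    "\<alpha> + of_nat x + 1 = \<alpha> + of_nat (Suc x)"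
    "of_nat N + 1 - of_nat x = complex_of_nat (N - x) + 1"
    "\<beta> + of_nat N + 1 - of_nat (Suc x) = \<beta> + of_nat (N - x)"
    "of_nat N + 1 - of_nat (Suc x) = complex_of_nat (N - x)"
    "complex_of_nat x + 1 = of_nat (Suc x)"
    unfolding Nx by simp_all
  have np: "complex_of_nat (N - x) \<notin> \<int>\<^sub>\<le>\<^sub>0" "complex_of_nat (Suc x) \<notin> \<int>\<^sub>\<le>\<^sub>0"
    using assms Re_nonpos_Ints[of "of_nat (N - x)"] Re_nonpos_Ints[of "of_nat (Suc x)"] by auto
  have G: "Gamma (complex_of_nat (N - x) + 1) = of_nat (N - x) * Gamma (of_nat (N - x))"
    "Gamma (complex_of_nat (Suc x) + 1) = of_nat (Suc x) * Gamma (of_nat (Suc x))"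
    by (rule Gamma_plus1[OF np(1)], rule Gamma_plus1[OF np(2)])
  have nz: "Gamma (complex_of_nat (N - x)) \<noteq> 0" "Gamma (complex_of_nat (Suc x)) \<noteq> 0"
    "complex_of_nat (N - x) \<noteq> 0" "complex_of_nat (Suc x) \<noteq> 0"
    using np assms by (auto simp: Gamma_nonzero simp del: of_nat_Suc)
  have gen: "A * n * (b * gb * ga / (n * Gn * Gx)) = b * s * (gb * (A * ga) / (Gn * (s * Gx)))"
    if "n \<noteq> 0" "s \<noteq> 0" "Gn \<noteq> 0" "Gx \<noteq> 0" for A n b gb ga Gn Gx s :: complex
    using that by (simp add: field_simps)
  show ?thesis
    unfolding hahn_rho_def e Gamma_lead_plus1[OF assms(1)] Gamma_lead_plus1[OF assms(2)] G
    by (rule gen) (use nz in auto)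
qed

text \<open>The sum shifts without boundary terms: on the left the factor z - N vanishes at x = N,
  on the right the factor z vanishes at x = 0.\<close>

lemma pearson_functional_discrete:
  assumes a: "\<And>m. 1 \<le> m \<Longrightarrow> m \<le> N \<Longrightarrow> \<alpha> + of_nat m \<noteq> 0"
    and b: "\<And>m. 1 \<le> m \<Longrightarrow> m \<le> N \<Longrightarrow> \<beta> + of_nat m \<noteq> 0"
  shows "pearson_functional (discrete_functional N \<alpha> \<beta>) (\<alpha> + 1) (- of_nat N) (\<beta> + of_nat N + 1)"
proof
  fix p q :: "complex poly" and c
  show "discrete_functional N \<alpha> \<beta> (p + q) = discrete_functional N \<alpha> \<beta> p + discrete_functional N \<alpha> \<beta> q"
    by (simp add: discrete_functional_def sum.distrib distrib_right)
  show "discrete_functional N \<alpha> \<beta> (smult c p) = c * discrete_functional N \<alpha> \<beta> p"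
    by (simp add: discrete_functional_def sum_distrib_left mult.assoc)
  let ?\<rho> = "hahn_rho N \<alpha> \<beta>"
  let ?l = "q \<circ>\<^sub>p [:1, 1:] * [:\<alpha> + 1, 1:] * [:- of_nat N, 1:]"
  let ?r = "q * [:0, 1:] * [:- (\<beta> + of_nat N + 1), 1:]"
  have step: "poly ?l (of_nat x) * ?\<rho> x = poly ?r (of_nat (Suc x)) * ?\<rho> (Suc x)" if "x < N" for x
  proof -
    have Nx: "complex_of_nat (N - x) = of_nat N - of_nat x" using that by (simp add: of_nat_diff)
    have "poly ?l (of_nat x) * ?\<rho> x = - poly q (of_nat (Suc x)) * ((\<alpha> + of_nat (Suc x)) * of_nat (N - x) * ?\<rho> x)"
      unfolding Nx by (simp add: poly_pcompose algebra_simps)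
    also have "\<dots> = - poly q (of_nat (Suc x)) * ((\<beta> + of_nat (N - x)) * of_nat (Suc x) * ?\<rho> (Suc x))"
      using that a[of "Suc x"] b[of "N - x"] by (subst hahn_rho_pearson) auto
    also have "\<dots> = poly ?r (of_nat (Suc x)) * ?\<rho> (Suc x)"
      unfolding Nx by (simp add: algebra_simps)
    finally show ?thesis .
  qed
  have "discrete_functional N \<alpha> \<beta> ?l = (\<Sum>x<N. poly ?l (of_nat x) * ?\<rho> x) + poly ?l (of_nat N) * ?\<rho> N"
    unfolding discrete_functional_def atLeast0AtMost lessThan_Suc_atMost[symmetric] by (rule sum.lessThan_Suc)
  also have "\<dots> = (\<Sum>x<N. poly ?r (of_nat (Suc x)) * ?\<rho> (Suc x))"
    using step by simp
  also have "\<dots> = poly ?r (of_nat 0) * ?\<rho> 0 + (\<Sum>x<N. poly ?r (of_nat (Suc x)) * ?\<rho> (Suc x))"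
    by simp
  also have "\<dots> = discrete_functional N \<alpha> \<beta> ?r"
    unfolding discrete_functional_def atLeast0AtMost lessThan_Suc_atMost[symmetric]
    by (rule sum.lessThan_Suc_shift[symmetric])
  finally show "discrete_functional N \<alpha> \<beta> ?l = discrete_functional N \<alpha> \<beta> ?r" .
qed

lemma hahn_rho_self_nonzero: "hahn_rho N \<alpha> \<beta> N \<noteq> 0"
proof -
  have "Gamma (of_nat N + 1 - of_nat N :: complex) \<noteq> 0" by simp
  moreover have "Gamma (of_nat N + 1 :: complex) \<noteq> 0"
    using Re_nonpos_Ints[of "of_nat N + 1"] by (intro Gamma_nonzero) auto
  ultimately show ?thesis by (simp add: hahn_rho_def Gamma_lead_nonzero)
qed

text \<open>(-x)_N vanishes at x = 0, ..., N - 1, so the moment \<open>M N 0\<close> is the single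
  term at x = N and is nonzero. By \<open>M_left\<close> a vanishing mass would make it
  zero.\<close>

lemma discrete_functional_1_nonzero:
  assumes "pearson_functional (discrete_functional N \<alpha> \<beta>) (\<alpha> + 1) (- of_nat N) (\<beta> + of_nat N + 1)"
    and s: "\<And>m. 1 \<le> m \<Longrightarrow> m \<le> N + 1 \<Longrightarrow> \<alpha> + \<beta> + of_nat m \<noteq> 0"
  shows "discrete_functional N \<alpha> \<beta> 1 \<noteq> 0"
proof
  assume 0: "discrete_functional N \<alpha> \<beta> 1 = 0"
  interpret pearson_functional "discrete_functional N \<alpha> \<beta>" "\<alpha> + 1" "- of_nat N" "\<beta> + of_nat N + 1" by fact
  have S: "S + 1 + of_nat i + of_nat 0 = \<alpha> + \<beta> + of_nat (i + 2)" for i by simp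
  have "pochhammer (S + 1 + of_nat 0) N * M N 0 = 0"
    using 0 s by (subst M_left) (simp_all only: S, simp_all add: M_def)
  moreover have "pochhammer (S + 1 + of_nat 0) N \<noteq> 0"
  proof
    assume "pochhammer (S + 1 + of_nat 0) N = 0"
    then obtain i where "i < N" "S + 1 + of_nat 0 = - of_nat i" by (auto simp: pochhammer_eq_0_iff)
    then have "S + 1 + of_nat i + of_nat 0 = 0" "i < N" by (auto simp: algebra_simps)
    then show False unfolding S using s[of "i + 2"] by auto
  qed
  moreover have "M N 0 = pochhammer (- of_nat N) N * hahn_rho N \<alpha> \<beta> N"
  proof -
    have "M N 0 = (\<Sum>x<N. pochhammer (- of_nat x) N * hahn_rho N \<alpha> \<beta> x) + pochhammer (- of_nat N) N * hahn_rho N \<alpha> \<beta> N"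
      unfolding M_def discrete_functional_def atLeast0AtMost lessThan_Suc_atMost[symmetric] sum.lessThan_Suc
      by (simp add: poly_pochhammer)
    also have "(\<Sum>x<N. pochhammer (- of_nat x) N * hahn_rho N \<alpha> \<beta> x) = 0"
      by (intro sum.neutral) (auto simp: pochhammer_of_nat_eq_0_lemma)
    finally show ?thesis by simp
  qed
  ultimately show False
    using hahn_rho_self_nonzero[of N \<alpha> \<beta>] by (simp add: pochhammer_same)
qed

text \<open>Gamma has no zeros, so a pole of one factor cannot be cancelled by the other.\<close>

lemma is_pole_Gamma_product:
  fixes u v :: "complex \<Rightarrow> complex"
  assumes u: "u = (\<lambda>w. a + s * w)" and v: "v = (\<lambda>w. c + s * w)" "s \<noteq> 0"
    and z: "u z \<in> \<int>\<^sub>\<le>\<^sub>0 \<or> v z \<in> \<int>\<^sub>\<le>\<^sub>0"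
  shows "is_pole (\<lambda>w. Gamma (u w) * Gamma (v w)) z"
proof -
  have pole: "filterlim (\<lambda>w. Gamma (e + s * w)) at_infinity (at z)" if "e + s * z \<in> \<int>\<^sub>\<le>\<^sub>0" for e
  proof -
    note nonpos = that
    obtain n where n: "e + s * z = - of_nat n" using nonpos by (rule nonpos_Ints_cases')
    have "filterlim (\<lambda>w. e + s * w) (at (- of_nat n)) (at z)"
    proof (rule filterlim_atI)
      show "((\<lambda>w. e + s * w) \<longlongrightarrow> - of_nat n) (at z)" unfolding n[symmetric] by (intro tendsto_intros)
      have "\<forall>\<^sub>F w in at z. w \<noteq> z" by (simp add: eventually_at_filter)
      then show "\<forall>\<^sub>F w in at z. e + s * w \<noteq> - of_nat n"
        by (rule eventually_mono) (use v n in \<open>metis add_left_cancel mult_left_cancel\<close>)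
    qed
    then show ?thesis by (rule filterlim_compose[OF Gamma_poles])
  qed
  have lim: "((\<lambda>w. Gamma (e + s * w)) \<longlongrightarrow> Gamma (e + s * z)) (at z)" "Gamma (e + s * z) \<noteq> 0"
    if "e + s * z \<notin> \<int>\<^sub>\<le>\<^sub>0" for e
    using that by (auto intro!: tendsto_Gamma tendsto_intros Gamma_nonzero)
  have "is_pole (\<lambda>w. Gamma (a + s * w) * Gamma (c + s * w)) z"
  proof (cases "a + s * z \<in> \<int>\<^sub>\<le>\<^sub>0")
    case a: True
    show ?thesis
    proof (cases "c + s * z \<in> \<int>\<^sub>\<le>\<^sub>0")
      case True
      then show ?thesis unfolding is_pole_def by (intro filterlim_at_infinity_times pole a)
    next
      case False
      have "filterlim (\<lambda>w. Gamma (c + s * w) * Gamma (a + s * w)) at_infinity (at z)"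
        by (rule tendsto_mult_filterlim_at_infinity[OF lim[OF False] pole[OF a]])
      then show ?thesis unfolding is_pole_def by (simp only: mult.commute)
    qed
  next
    case False
    then have "c + s * z \<in> \<int>\<^sub>\<le>\<^sub>0" using z by (simp add: u v)
    then show ?thesis unfolding is_pole_def
      by (intro tendsto_mult_filterlim_at_infinity[OF lim[OF False]] pole)
  qed
  then show ?thesis by (simp only: u v)
qed

lemma separates_imp_separating:
  assumes "imaginary_contour \<gamma>"
    and "separates \<gamma> {z. is_pole (\<lambda>z. Gamma (- z) * Gamma (d - z)) z}
           {z. is_pole (\<lambda>z. Gamma (1 + z) * Gamma (b + z)) z}"
  shows "separating b d \<gamma>"
proof -
  have "is_pole (\<lambda>z. Gamma (- z) * Gamma (d - z)) z" if "- z \<in> \<int>\<^sub>\<le>\<^sub>0 \<or> d - z \<in> \<int>\<^sub>\<le>\<^sub>0" for z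
    by (rule is_pole_Gamma_product[of uminus 0 "-1" "\<lambda>z. d - z" d]) (use that in auto)
  moreover have "is_pole (\<lambda>z. Gamma (1 + z) * Gamma (b + z)) z" if "1 + z \<in> \<int>\<^sub>\<le>\<^sub>0 \<or> b + z \<in> \<int>\<^sub>\<le>\<^sub>0" for z
    by (rule is_pole_Gamma_product[of "\<lambda>z. 1 + z" 1 1 "\<lambda>z. b + z" b]) (use that in auto)
  ultimately show ?thesis
    using assms separates_right_of[OF assms(2)] by (simp add: separating_def)
qed

section \<open>Assembling the Sobolev form\<close>

lemma sobolev_integrand_eq:
  "sobolev_integrand N \<alpha> \<beta> f g = (\<lambda>z. poly ((poly_diff ^^ (N + 1)) f * (poly_diff ^^ (N + 1)) g) z
     * gamma_weight (\<alpha> + of_nat N + 2) (\<beta> + of_nat N + 1) z)"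
  by (rule ext)
     (simp add: sobolev_integrand_def hahn_omega_def gamma_weight_def poly_poly_diff_funpow del: funpow.simps)

lemma sobolev_form_eq:
  "sobolev_form N \<alpha> \<beta> \<gamma> f g = discrete_functional N \<alpha> \<beta> (f * g)
     + weight_functional (\<alpha> + of_nat N + 2) (\<beta> + of_nat N + 1) \<gamma>
         ((poly_diff ^^ (N + 1)) f * (poly_diff ^^ (N + 1)) g)"
  by (simp only: sobolev_form_def discrete_functional_def weight_functional_def sobolev_integrand_eq poly_mult)

text \<open>For k \<le> N the coefficient contains (-N+k)_(n-k) = 0; for k > N the factor (-x)_k
  vanishes at the points 0, ..., N.\<close>

lemma hahn_poly_root:
  assumes "N < n" "x \<le> N"
  shows "poly (hahn_poly N \<alpha> \<beta> n) (of_nat x) = 0"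
  unfolding hahn_poly_eq ghahn_def poly_sum
proof (intro sum.neutral ballI)
  fix k assume "k \<in> {..n}"
  show "poly (smult (pochhammer (- of_nat n) k * pochhammer (\<alpha> + 1 + of_nat k) (n - k)
          * pochhammer (- of_nat N + of_nat k) (n - k)
        / (pochhammer (\<alpha> + \<beta> + 1 + of_nat n + of_nat k) (n - k) * fact k))
       (pochhammer (- [:0, 1:]) k)) (of_nat x) = 0"
  proof (cases "k \<le> N")
    case True
    then have "- of_nat N + of_nat k = - complex_of_nat (N - k)" "N - k < n - k"
      using assms by (auto simp: of_nat_diff)
    then have "pochhammer (- of_nat N + of_nat k :: complex) (n - k) = 0"
      by (simp only: pochhammer_of_nat_eq_0_lemma)
    then show ?thesis by simp
  next
    case False
    then have "pochhammer (- of_nat x :: complex) k = 0"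
      using assms by (intro pochhammer_of_nat_eq_0_lemma) simp
    then show ?thesis by (simp add: poly_pochhammer)
  qed
qed

lemma pochhammer_nonzero:
  fixes a :: complex
  assumes "\<And>k. k < n \<Longrightarrow> a + of_nat k \<noteq> 0"
  shows "pochhammer a n \<noteq> 0"
proof
  assume "pochhammer a n = 0"
  then obtain k where "k < n" "a = - of_nat k" by (auto simp: pochhammer_eq_0_iff)
  then show False using assms[of k] by simp
qed

theorem theorem5:
  fixes N :: nat and \<alpha> \<beta> :: complex and C :: "real \<Rightarrow> complex"
  assumes "- \<alpha> \<notin> of_nat ` ({1..N} \<union> {N + 2..})"
    and "- \<beta> \<notin> of_nat ` ({1..N} \<union> {N + 2..})"
    and "- \<alpha> - \<beta> \<notin> of_nat ` ({1..2 * N + 1} \<union> {2 * N + 3..})"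
    and "imaginary_contour C"
    and "separates C
           {z. is_pole (\<lambda>z. Gamma (- z) * Gamma (\<beta> + of_nat N + 1 - z)) z}
           {z. is_pole (\<lambda>z. Gamma (1 + z) * Gamma (\<alpha> + of_nat N + 2 + z)) z}"
  shows "(\<forall>f g. \<exists>I. has_improper_contour_integral (sobolev_integrand N \<alpha> \<beta> f g) I C)
    \<and> symmetric_bilinear (sobolev_form N \<alpha> \<beta> C)
    \<and> monic_OPS (sobolev_form N \<alpha> \<beta> C) (hahn_poly N \<alpha> \<beta>)
    \<and> (\<forall>n P. monic_of_degree n P \<and> (\<forall>m<n. sobolev_form N \<alpha> \<beta> C P (monom 1 m) = 0)
              \<longleftrightarrow> P = hahn_poly N \<alpha> \<beta> n)"
proof -
  define b where "b = \<alpha> + of_nat N + 2"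
  define d where "d = \<beta> + of_nat N + 1"
  have sep: "separating b d C"
    unfolding b_def d_def using assms(4,5) by (rule separates_imp_separating)
  have \<alpha>: "\<alpha> + of_nat m \<noteq> 0" if "m \<in> {1..N} \<union> {N + 2..}" for m
  proof
    assume "\<alpha> + of_nat m = 0"
    then have "- \<alpha> = of_nat m" by (simp add: add_eq_0_iff)
    with assms(1) that show False by blast
  qed
  have \<beta>: "\<beta> + of_nat m \<noteq> 0" if "m \<in> {1..N} \<union> {N + 2..}" for m
  proof
    assume "\<beta> + of_nat m = 0"
    then have "- \<beta> = of_nat m" by (simp add: add_eq_0_iff)
    with assms(2) that show False by blast
  qed
  have \<alpha>\<beta>: "\<alpha> + \<beta> + of_nat m \<noteq> 0" if "m \<in> {1..2 * N + 1} \<union> {2 * N + 3..}" for m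
  proof
    assume "\<alpha> + \<beta> + of_nat m = 0"
    then have "- \<alpha> - \<beta> = of_nat m" by (simp add: add_eq_0_iff algebra_simps)
    with assms(3) that show False by blast
  qed
  let ?D = "discrete_functional N \<alpha> \<beta>" and ?W = "weight_functional b d C" and ?h = "hahn_poly N \<alpha> \<beta>"
  let ?B = "sobolev_form N \<alpha> \<beta> C" and ?\<Delta> = "poly_diff ^^ (N + 1)"
  have B: "?B f g = ?D (f * g) + ?W (?\<Delta> f * ?\<Delta> g)" for f g
    unfolding b_def d_def by (rule sobolev_form_eq)
  interpret D: pearson_functional ?D "\<alpha> + 1" "- of_nat N" "\<beta> + of_nat N + 1"
    by (rule pearson_functional_discrete) (use \<alpha> \<beta> in auto)
  interpret W: pearson_functional ?W b 1 d
    by (rule pearson_functional_weight_functional[OF sep])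
  have D1: "?D 1 \<noteq> 0"
    using D.pearson_functional_axioms by (rule discrete_functional_1_nonzero) (use \<alpha>\<beta> in auto)
  have bd: "b + d + of_nat m = \<alpha> + \<beta> + of_nat (2 * N + 3 + m)" for m
    by (simp add: b_def d_def)
  have W1: "?W 1 \<noteq> 0"
    by (rule weight_functional_1_nonzero[OF sep]) (unfold bd, rule \<alpha>\<beta>, simp)
  have bil: "symmetric_bilinear ?B"
    unfolding symmetric_bilinear_def B
    by (simp only: poly_diff_funpow_add poly_diff_funpow_smult distrib_right mult_smult_left
         D.L_add W.L_add D.L_smult W.L_smult)
       (simp add: mult.commute distrib_left add_ac)
  \<comment> \<open>The gaps in the hypotheses fit the two functionals. The sum calls for the
    indices 1 to N of \<alpha> and \<beta> and for indices up to 2N+1 of \<alpha> + \<beta>; the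
    integral calls for those from N+2 and from 2N+3 on. The indices N+1 and 2N+2 never
    occur.\<close>
  have DS: "\<alpha> + 1 + - of_nat N + (\<beta> + of_nat N + 1) - 1 = \<alpha> + \<beta> + 1" by simp
  have WS: "b + 1 + d - 1 = \<alpha> + \<beta> + 1 + 2 * of_nat (N + 1)" by (simp add: b_def d_def)
  have D_small: "\<alpha> + \<beta> + 1 + of_nat m \<noteq> 0" if "1 \<le> m" "m \<le> 2 * n" "n \<le> N" for m n
    using \<alpha>\<beta>[of "Suc m"] that by (simp add: add_ac)
  have W_S: "\<alpha> + \<beta> + 1 + 2 * of_nat (N + 1) + of_nat m \<noteq> 0" for m
    using \<alpha>\<beta>[of "2 * N + 3 + m"] by (simp add: algebra_simps)
  have D_A: "pochhammer (\<alpha> + 1) n \<noteq> 0" if "n \<le> N" for n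
    by (rule pochhammer_nonzero) (use \<alpha>[of "Suc k" for k] that in \<open>simp add: add_ac\<close>)
  \<comment> \<open>The factor -N + k first vanishes at k = N, so (-N)_n is nonzero exactly for n
    \<le> N. Beyond that the sum gives no norm and the integral takes over.\<close>
  have D_B: "pochhammer (- of_nat N :: complex) n \<noteq> 0" if "n \<le> N" for n
    using that by (auto simp: pochhammer_eq_0_iff)
  have D_EA: "pochhammer (\<beta> + of_nat N + 1 + (\<alpha> + 1)) n \<noteq> 0" if "n \<le> N" for n
    by (rule pochhammer_nonzero) (use \<alpha>\<beta>[of "N + 2 + k" for k] that in \<open>simp add: add_ac\<close>)
  have D_EB: "pochhammer (\<beta> + of_nat N + 1 + - of_nat N) n \<noteq> 0" if "n \<le> N" for n
    by (rule pochhammer_nonzero) (use \<beta>[of "Suc k" for k] that in \<open>simp add: add_ac\<close>)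
  have W_A: "pochhammer b j \<noteq> 0" for j
    unfolding b_def by (rule pochhammer_nonzero) (use \<alpha>[of "N + 2 + k" for k] in \<open>simp add: add_ac\<close>)
  have W_B: "pochhammer (1 :: complex) j \<noteq> 0" for j
    by (simp add: pochhammer_fact[symmetric])
  have W_EA: "pochhammer (d + b) j \<noteq> 0" for j
  proof (rule pochhammer_nonzero)
    fix k
    have e: "d + b + of_nat k = \<alpha> + \<beta> + of_nat (2 * N + 3 + k)" using bd[of k] by (simp only: add.commute)
    show "d + b + of_nat k \<noteq> 0" unfolding e by (rule \<alpha>\<beta>) simp
  qed
  have W_EB: "pochhammer (d + 1) j \<noteq> 0" for j
    unfolding d_def by (rule pochhammer_nonzero) (use \<beta>[of "N + 2 + k" for k] in \<open>simp add: add_ac\<close>)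
  have \<Delta>_small: "?\<Delta> (?h n) = 0" if "n \<le> N" for n
  proof -
    have "degree (?h n) = n" using monic_ghahn by (simp add: hahn_poly_eq monic_of_degree_def)
    then show ?thesis using poly_diff_funpow_degree[of "?h n" "N + 1" 0] that by simp
  qed
  have D_large: "?D (?h n * q) = 0" if "N < n" for n q
    using that by (simp add: discrete_functional_def hahn_poly_root)
  have \<Delta>_large: "?\<Delta> (?h (N + 1 + j))
      = smult (fact (N + 1 + j) / fact j) (ghahn b 1 (\<alpha> + \<beta> + 1 + 2 * of_nat (N + 1)) j)" for j
  proof -
    have "\<alpha> + 1 + of_nat (N + 1) = b" "- complex_of_nat N + of_nat (N + 1) = 1" by (simp_all add: b_def)
    then show ?thesis unfolding hahn_poly_eq poly_diff_funpow_ghahn by simp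
  qed
  have orth: "?B (?h n) q = 0" if q: "q = 0 \<or> degree q < n" for n q
  proof (cases "n \<le> N")
    case True
    have "?D (?h n * q) = 0"
      using D.L_ghahn_mult_degree_less[of n q, unfolded DS] D_small[OF _ _ True] D_A[OF True] q
      unfolding hahn_poly_eq by blast
    then show ?thesis by (simp only: B \<Delta>_small[OF True] mult_zero_left W.L_0 add_0_right)
  next
    case False
    then obtain j where j: "n = N + 1 + j" by (metis add.commute add_Suc_right le_iff_add not_less_eq_eq plus_1_eq_Suc)
    have "?\<Delta> q = 0 \<or> degree (?\<Delta> q) < j"
      using q unfolding j by (rule poly_diff_funpow_degree)
    then have "?W (ghahn b 1 (\<alpha> + \<beta> + 1 + 2 * of_nat (N + 1)) j * ?\<Delta> q) = 0"
      using W.L_ghahn_mult_degree_less[of j "?\<Delta> q", unfolded WS] W_S W_A by blast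
    then show ?thesis
      using D_large[of n q] False unfolding B j \<Delta>_large mult_smult_left W.L_smult by simp
  qed
  have norm: "?B (?h n) (?h n) \<noteq> 0" for n
  proof (cases "n \<le> N")
    case True
    have "?D (?h n * ?h n) \<noteq> 0"
      using D.L_ghahn_norm[of n, unfolded DS] D_small[OF _ _ True] D_A[OF True] D_B[OF True]
        D_EA[OF True] D_EB[OF True] D1
      unfolding hahn_poly_eq by blast
    then show ?thesis by (simp only: B \<Delta>_small[OF True] mult_zero_left W.L_0 add_0_right not_False_eq_True)
  next
    case False
    then obtain j where j: "n = N + 1 + j" by (metis add.commute add_Suc_right le_iff_add not_less_eq_eq plus_1_eq_Suc)
    have "?W (ghahn b 1 (\<alpha> + \<beta> + 1 + 2 * of_nat (N + 1)) j * ghahn b 1 (\<alpha> + \<beta> + 1 + 2 * of_nat (N + 1)) j) \<noteq> 0"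
      using W.L_ghahn_norm[of j, unfolded WS] W_S W_A W_B W_EA W_EB W1 by blast
    moreover have "(fact (N + 1 + j) / fact j :: complex) \<noteq> 0"
      by (simp only: divide_eq_0_iff fact_nonzero simp_thms not_False_eq_True)
    moreover have D0: "?D (?h n * ?h n) = 0" using D_large False by simp
    ultimately show ?thesis
      unfolding B D0 unfolding j \<Delta>_large mult_smult_left mult_smult_right W.L_smult
      by (simp only: add_0_left mult_eq_0_iff simp_thms not_False_eq_True)
  qed
  have monic: "monic_of_degree n (?h n)" for n unfolding hahn_poly_eq by (rule monic_ghahn)
  have "\<exists>I. has_improper_contour_integral (sobolev_integrand N \<alpha> \<beta> f g) I C" for f g
    unfolding sobolev_integrand_eq using has_integral_weight_functional[OF sep] unfolding b_def d_def by blast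
  then show ?thesis
    using bil monic_OPS_characterization[of ?B ?h, OF bil monic orth norm] by blast
qed

end
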